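(* In the weighted Indian buffet model described in the context, let $\beta\in[0,1)$ and $B\in\mathcal{B}$, and let $L_n(B)=\mathrm{card}(B\cap S_n)$. If $\overline{R}_n:=\frac1n\sum_{i=1}^nR_i\to r$ almost surely for some constant $r$, then \[ \frac{L_n(B)}{a_n(\beta)}\longrightarrow m(B)\lambda(\beta)\quad\text{a.s.} \] Moreover, if in addition $\frac{\sum_{j=1}^n j^{\beta-1}E|\overline{R}_j-r|}{\sqrt{a_n(\beta)}}\to0$, then \[ \sqrt{a_n(\beta)}\Bigl\{\frac{L_n(B)}{a_n(\beta)}-m(B)\lambda(\beta)\Bigr\}\longrightarrow\mathcal{N}\bigl(0,m(B)\lambda(\beta)\bigr)\quad\text{stably}. \] Here $a_n(\beta)=\log n$ and $\lambda(\beta)=\alpha c/r$ if $\beta=0$, while $a_n(\beta)=n^\beta$ and $\lambda(\beta)=\frac{\alpha\Gamma(c+1)}{\Gamma(c+\beta)}\frac{1}{\beta r^{1-\beta}}$ if $\beta\in(0,1)$.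
   Context: Let $\mathcal{X}$ be a separable metric space with Borel $\sigma$-field $\mathcal{B}$, and let $\mathcal{M}$ be the set of finite positive measures on $\mathcal{B}$; $\mu\in\mathcal{M}$ is diffuse if $\mu\{x\}=0$ for all $x$. All random quantities live on a probability space $(\Omega,\mathcal{A},P)$. A random measure (r.m.) is a map $M:\Omega\to\mathcal{M}$ such that $\omega\mapsto M(\omega)(B)$ is measurable for each $B\in\mathcal{B}$. A Poisson r.m. with intensity $\nu\in\mathcal{M}$ is an r.m. $M$ with $M(B_1),\dots,M(B_k)$ independent for pairwise disjoint $B_j$ and $M(B)\sim\mathrm{Poi}(\nu(B))$ for all $B$ (with $\mathrm{Poi}(0)=\delta_0$). Each $\nu\in\mathcal{M}$ is uniquely $\nu=\nu_c+\nu_d$, $\nu_c$ diffuse, $\nu_d=\sum_j\gamma_j\delta_{x_j}$. $M\sim\mathrm{BeP}(\nu)$ (Bernoulli r.m. with hazard measure $\nu$) means $M=M_1+M_2$ with $M_1,M_2$ independent, $M_1$ Poisson with intensity $\nu_c$, $M_2=\sum_jV_j\delta_{x_j}$ with independent indicators $V_j$, $P(V_j=1)=\gamma_j$. "$X\mid\mathcal{G}\sim Y\mid\mathcal{G}$" means $P(X\in A\mid\mathcal{G})=P(Y\in A\mid\mathcal{G})$ a.s. for all measurable $A$. Model: fix a diffuse probability measure $m$ on $\mathcal{B}$ and reals $\alpha>0$, $\beta<1$, $c>-\beta$. $(M_n)_{n\ge1}$ are r.m.'s and $(R_n)_{n\ge1}$ real random variables such that for each $n\ge1$, $R_n$ is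 independent of $(M_1,\dots,M_n,R_1,\dots,R_{n-1})$ and $R_n\ge u$ for a constant $u>\max(\beta,0)$; and $M_{n+1}\mid\mathcal{F}_n\sim\mathrm{BeP}(\nu_n)$ for all $n\ge0$, where $\mathcal{F}_0=\{\varnothing,\Omega\}$, $\mathcal{F}_n=\sigma(M_1,\dots,M_n,R_1,\dots,R_n)$, $S_n=\{x: M_i\{x\}=1\text{ for some } i\le n\}$, $\nu_0=\alpha m$ and for $n\ge1$ \[ \nu_n=\sum_{x\in S_n}\frac{\sum_{i=1}^nR_iM_i\{x\}-\beta}{\sum_{i=1}^nR_i+c}\,\delta_x+\Lambda_n\, m,\qquad \Lambda_0=\alpha,\ \ \Lambda_n=\alpha\frac{\Gamma(c+1)\Gamma(c+\beta+\sum_{i=1}^nR_i)}{\Gamma(c+\beta)\Gamma(c+1+\sum_{i=1}^nR_i)}. \] Stable convergence: a kernel is an r.m. $K$ with $K(\omega)(\mathbb{R})=1$ for all $\omega$. Real random variables $X_n$ converge stably to $K$ if $E\{K(f)\mid H\}=\lim_nE\{f(X_n)\mid H\}$ for all $H\in\mathcal{A}$ with $P(H)>0$ and all bounded continuous $f$. $\mathcal{N}(0,a)$ is the Gaussian law with mean $0$ and variance $a\ge0$ ($\mathcal N(0,0)=\delta_0$), viewed as a constant kernel. *)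

theory Defs
  imports "HOL-Probability.Probability"
begin

text \<open>The measurable space of finite (positive) measures on the sigma-field of N, equipped with
  the sigma-field generated by the evaluation maps mu |-> mu(B), B in sets N
  (same construction as the library's subprob_algebra).\<close>
definition finite_measures :: "'a measure \<Rightarrow> 'a measure measure" where
  "finite_measures N =
    (SUP A \<in> sets N. vimage_algebra {\<mu>. finite_measure \<mu> \<and> sets \<mu> = sets N} (\<lambda>\<mu>. emeasure \<mu> A) borel)"

definition random_measure :: "'q measure \<Rightarrow> ('q \<Rightarrow> 'x::topological_space measure) \<Rightarrow> bool" where
  "random_measure Q N \<longleftrightarrow>
     (\<forall>\<omega>\<in>space Q. finite_measure (N \<omega>) \<and> sets (N \<omega>) = sets (borel :: 'x measure)) \<and>
     (\<forall>B\<in>sets (borel :: 'x measure). (\<lambda>\<omega>. measure (N \<omega>) B) \<in> borel_measurable Q)"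

text \<open>Poisson random measure with intensity given by the (finite) set function lam.
  Poi(0) is the Dirac mass at 0 (note 0^0 = 1).\<close>
definition poisson_rm :: "'q measure \<Rightarrow> ('q \<Rightarrow> 'x::topological_space measure) \<Rightarrow> ('x set \<Rightarrow> real) \<Rightarrow> bool" where
  "poisson_rm Q N lam \<longleftrightarrow>
     random_measure Q N \<and>
     (\<forall>(I::nat set) Bs. finite I \<longrightarrow> (\<forall>j\<in>I. Bs j \<in> sets (borel :: 'x measure)) \<longrightarrow>
        disjoint_family_on Bs I \<longrightarrow>
        prob_space.indep_vars Q (\<lambda>_. borel) (\<lambda>j \<omega>. measure (N \<omega>) (Bs j)) I) \<and>
     (\<forall>B\<in>sets (borel :: 'x measure). \<forall>k::nat.
        measure Q {\<omega>\<in>space Q. measure (N \<omega>) B = real k} = lam B ^ k / fact k * exp (- lam B))"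

definition atoms_of :: "'x measure \<Rightarrow> 'x set" where
  "atoms_of \<nu> = {x. measure \<nu> {x} \<noteq> 0}"

definition diffuse_part :: "'x measure \<Rightarrow> 'x set \<Rightarrow> real" where
  "diffuse_part \<nu> B = measure \<nu> B - (\<Sum>\<^sub>\<infinity>x\<in>atoms_of \<nu> \<inter> B. measure \<nu> {x})"

definition BeP_rm :: "'q measure \<Rightarrow> ('q \<Rightarrow> 'x::topological_space measure) \<Rightarrow> 'x measure \<Rightarrow> bool" where
  "BeP_rm Q N \<nu> \<longleftrightarrow>
     random_measure Q N \<and>
     (\<exists>N1 (V :: 'x \<Rightarrow> 'q \<Rightarrow> real).
        poisson_rm Q N1 (diffuse_part \<nu>) \<and>
        (\<forall>x\<in>atoms_of \<nu>. V x \<in> borel_measurable Q \<and> (\<forall>\<omega>\<in>space Q. V x \<omega> \<in> {0, 1}) \<and>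
            measure Q {\<omega>\<in>space Q. V x \<omega> = 1} = measure \<nu> {x}) \<and>
        prob_space.indep_vars Q (\<lambda>_. borel) V (atoms_of \<nu>) \<and>
        prob_space.indep_set Q
           (sets (vimage_algebra (space Q) N1 (finite_measures (borel :: 'x measure))))
           (sets (vimage_algebra (space Q) (\<lambda>\<omega>. restrict (\<lambda>x. V x \<omega>) (atoms_of \<nu>))
                    (PiM (atoms_of \<nu>) (\<lambda>_. borel :: real measure)))) \<and>
        (AE \<omega> in Q. \<forall>B\<in>sets (borel :: 'x measure).
            measure (N \<omega>) B = measure (N1 \<omega>) B + (\<Sum>\<^sub>\<infinity>x\<in>atoms_of \<nu> \<inter> B. V x \<omega>)))"

text \<open>The law BeP(nu) on the space of finite measures: the distribution of any N ~ BeP(nu)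
  (realized on some probability space; the pair type below is rich enough to carry N1 and N2).\<close>
definition BeP_law :: "'x::topological_space measure \<Rightarrow> 'x measure measure" where
  "BeP_law \<nu> = (THE D. \<exists>(Q :: ('x measure \<times> 'x measure) measure) N.
      prob_space Q \<and> BeP_rm Q N \<nu> \<and> D = distr Q (finite_measures (borel :: 'x measure)) N)"

definition gen_sigma :: "'o measure \<Rightarrow> (nat \<Rightarrow> 'o \<Rightarrow> 'x::topological_space measure) \<Rightarrow> (nat \<Rightarrow> 'o \<Rightarrow> real)
     \<Rightarrow> nat \<Rightarrow> nat \<Rightarrow> 'o measure" where
  "gen_sigma P M R n k = sigma (space P)
     ({{\<omega>\<in>space P. measure (M i \<omega>) B \<in> C} | i B C. i \<in> {1..n} \<and> B \<in> sets (borel :: 'x measure) \<and> C \<in> sets (borel :: real measure)} \<union>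
      {{\<omega>\<in>space P. R i \<omega> \<in> C} | i C. i \<in> {1..k} \<and> C \<in> sets (borel :: real measure)})"

definition filt :: "'o measure \<Rightarrow> (nat \<Rightarrow> 'o \<Rightarrow> 'x::topological_space measure) \<Rightarrow> (nat \<Rightarrow> 'o \<Rightarrow> real)
     \<Rightarrow> nat \<Rightarrow> 'o measure" where
  "filt P M R n = gen_sigma P M R n n"

definition feat :: "(nat \<Rightarrow> 'o \<Rightarrow> 'x measure) \<Rightarrow> nat \<Rightarrow> 'o \<Rightarrow> 'x set" where
  "feat M n \<omega> = {x. \<exists>i\<in>{1..n}. measure (M i \<omega>) {x} = 1}"

definition Lambda_n :: "real \<Rightarrow> real \<Rightarrow> real \<Rightarrow> real \<Rightarrow> real" where
  "Lambda_n \<alpha> \<beta> c s = \<alpha> * (Gamma (c + 1) * Gamma (c + \<beta> + s)) / (Gamma (c + \<beta>) * Gamma (c + 1 + s))"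

text \<open>The hazard measure nu_n(omega). For n = 0 it reduces to alpha m (S_0 empty, Lambda_0 = alpha).\<close>
definition ibp_nu :: "'x::topological_space measure \<Rightarrow> real \<Rightarrow> real \<Rightarrow> real \<Rightarrow> (nat \<Rightarrow> 'o \<Rightarrow> 'x measure)
     \<Rightarrow> (nat \<Rightarrow> 'o \<Rightarrow> real) \<Rightarrow> nat \<Rightarrow> 'o \<Rightarrow> 'x measure" where
  "ibp_nu m \<alpha> \<beta> c M R n \<omega> =
     measure_of UNIV (sets (borel :: 'x measure))
       (\<lambda>B. ennreal ((\<Sum>x\<in>feat M n \<omega> \<inter> B.
               ((\<Sum>i=1..n. R i \<omega> * measure (M i \<omega>) {x}) - \<beta>) / ((\<Sum>i=1..n. R i \<omega>) + c))
             + Lambda_n \<alpha> \<beta> c (\<Sum>i=1..n. R i \<omega>) * measure m B))"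

definition kernel :: "('o \<Rightarrow> real measure) \<Rightarrow> bool" where
  "kernel K \<longleftrightarrow> (\<forall>\<omega>. sets (K \<omega>) = sets (borel :: real measure) \<and> emeasure (K \<omega>) UNIV = 1)"

definition stably_to :: "'o measure \<Rightarrow> (nat \<Rightarrow> 'o \<Rightarrow> real) \<Rightarrow> ('o \<Rightarrow> real measure) \<Rightarrow> bool" where
  "stably_to P X K \<longleftrightarrow>
     (\<forall>H\<in>sets P. measure P H > 0 \<longrightarrow>
       (\<forall>f :: real \<Rightarrow> real. continuous_on UNIV f \<longrightarrow> bounded (range f) \<longrightarrow>
          (\<lambda>n. (\<integral>\<omega>. f (X n \<omega>) * indicator H \<omega> \<partial>P) / measure P H)
            \<longlonglongrightarrow> (\<integral>\<omega>. (\<integral>x. f x \<partial>K \<omega>) * indicator H \<omega> \<partial>P) / measure P H))"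

definition gauss0 :: "real \<Rightarrow> real measure" where
  "gauss0 a = (if a = 0 then return borel 0 else density lborel (normal_density 0 (sqrt a)))"

definition a_seq :: "real \<Rightarrow> nat \<Rightarrow> real" where
  "a_seq \<beta> n = (if \<beta> = 0 then ln (real n) else real n powr \<beta>)"

definition lam_const :: "real \<Rightarrow> real \<Rightarrow> real \<Rightarrow> real \<Rightarrow> real" where
  "lam_const \<alpha> \<beta> c r = (if \<beta> = 0 then \<alpha> * c / r
      else \<alpha> * Gamma (c + 1) / Gamma (c + \<beta>) * (1 / (\<beta> * r powr (1 - \<beta>))))"

end

theory Submission
  imports Defs "HOL-Real_Asymp.Real_Asymp"
begin

text \<open>
  Let N be the number of features in B and let C be its compensator, the sum of the increments
  m(B) \<Lambda>_j. Conditionally on the past, the number of new features in B is Poisson with mean m(B) \<Lambda>_n: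
  the atoms of the hazard measure sit on the old features and its diffuse part charges no fixed finite set.
  Hence exp(z N - (exp z - 1) C) has martingale increments for every complex z.

  For real z, the Chernoff bound makes the deviations of N - C of order a_n summable along the times at
  which a_n first reaches a square, monotonicity of N fills the gaps, and C / a_n converges because
  \<Lambda>_j is asymptotic to a multiple of (r j)^(\<beta> - 1).

  For z = i t / sqrt(a_n), the martingale property gives the limit of E(exp(i t Z_n); H) for the events H
  of the past, where Z_n is the normalised error: the rate condition says that C differs from its
  deterministic limit by o(sqrt(a_n)) in L1. The limit extends to all events because Z_n is adapted, so that H may be
  replaced by its conditional probability, and this is stable convergence by Levy's theorem.
\<close>

section \<open>Finite measures and finite kernels\<close>

text \<open>The law on the right of \<open>M_cond\<close> is a definite description, so nothing can
  be read off the hypothesis until existence and uniqueness of that law are both proved. Existence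
  must hold on the type of pairs of measures: the Poisson part and the Bernoulli part are therefore
  both realised as random elements of \<open>finms\<close>, one in each coordinate. Afterwards only
  three facts about the law are used: it is a probability on \<open>finms\<close>, it is
  concentrated on finite sums of unit masses at distinct points, and the mass of a Borel set without
  atoms of the hazard measure is Poisson.

  A second obstacle is that the set of interest, B minus the old features, is random, whereas
  \<open>M_cond\<close> fixes a set of measures first and then asserts an almost sure identity.
  Passing to sections of product sets bridges the gap. A third is that c may be negative, down to
  -\<beta>: the lower bound u > \<beta> on the weights keeps the arguments of the powers positive
  and comparable with the sums of the R.\<close>

abbreviation finms :: "'x::topological_space measure measure" where
  "finms \<equiv> finite_measures (borel :: 'x measure)"

lemma space_finite_measures: "space (finite_measures N) = {\<mu>. finite_measure \<mu> \<and> sets \<mu> = sets N}"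
  by (auto simp add: finite_measures_def space_Sup_eq_UN)

lemma space_finms: "\<mu> \<in> space (finms :: 'x::topological_space measure measure) \<longleftrightarrow>
    finite_measure \<mu> \<and> sets \<mu> = sets (borel :: 'x measure)"
  by (simp add: space_finite_measures)

lemma measurable_emeasure_finite_measures[measurable]:
  "a \<in> sets A \<Longrightarrow> (\<lambda>\<mu>. emeasure \<mu> a) \<in> borel_measurable (finite_measures A)"
  by (auto intro!: measurable_Sup1 measurable_vimage_algebra1 simp: finite_measures_def)

lemma measurable_measure_finite_measures[measurable]:
  "a \<in> sets A \<Longrightarrow> (\<lambda>\<mu>. measure \<mu> a) \<in> borel_measurable (finite_measures A)"
  unfolding measure_def by measurable

lemma measurable_finite_measures:
  "(\<And>a. a \<in> space M \<Longrightarrow> finite_measure (K a)) \<Longrightarrow>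
  (\<And>a. a \<in> space M \<Longrightarrow> sets (K a) = sets N) \<Longrightarrow>
  (\<And>A. A \<in> sets N \<Longrightarrow> (\<lambda>a. emeasure (K a) A) \<in> borel_measurable M) \<Longrightarrow>
  K \<in> measurable M (finite_measures N)"
  by (auto intro!: measurable_Sup2 measurable_vimage_algebra2 simp: finite_measures_def)

lemma finite_kernelD:
  assumes "K \<in> measurable M (finite_measures N)" "a \<in> space M"
  shows "finite_measure (K a)" "sets (K a) = sets N" "space (K a) = space N"
proof -
  have "K a \<in> space (finite_measures N)"
    using assms by (rule measurable_space)
  then show "finite_measure (K a)" "sets (K a) = sets N"
    by (auto simp: space_finite_measures)
  then show "space (K a) = space N"
    using sets_eq_imp_space_eq by blast
qed

text \<open>The evaluations generate the sigma-field of \<open>finms\<close>, and finiteness makes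
  measurability of \<open>measure\<close> and of \<open>emeasure\<close> equivalent. Random measures
  can then be composed like any other random element.\<close>

lemma random_measure_iff_measurable:
  "random_measure Q N \<longleftrightarrow> N \<in> measurable Q (finms :: 'x::topological_space measure measure)"
proof
  assume *: "random_measure Q N"
  show "N \<in> measurable Q finms"
  proof (rule measurable_finite_measures)
    fix A :: "'x set" assume A: "A \<in> sets borel"
    then have "(\<lambda>a. ennreal (measure (N a) A)) \<in> borel_measurable Q"
      using * by (auto simp: random_measure_def)
    then show "(\<lambda>a. emeasure (N a) A) \<in> borel_measurable Q"
      by (rule measurable_cong[THEN iffD1, rotated])
         (use * in \<open>auto simp: random_measure_def intro!: finite_measure.emeasure_eq_measure[symmetric]\<close>)
  qed (use * in \<open>auto simp: random_measure_def\<close>)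
next
  assume N[measurable]: "N \<in> measurable Q finms"
  show "random_measure Q N"
    unfolding random_measure_def
  proof (intro conjI ballI)
    fix A :: "'x set" assume [measurable]: "A \<in> sets borel"
    show "(\<lambda>\<omega>. measure (N \<omega>) A) \<in> borel_measurable Q"
      by measurable
  qed (use finite_kernelD[OF N] in auto)
qed

text \<open>Normalising the total mass reduces finite kernels to the sub-Markov kernels of the library.\<close>

lemma nn_integral_measurable_finite_kernel:
  assumes f[measurable]: "(\<lambda>(x, y). f x y) \<in> borel_measurable (M \<Otimes>\<^sub>M N)"
    and K[measurable]: "K \<in> measurable M (finite_measures N)"
  shows "(\<lambda>x. \<integral>\<^sup>+y. f x y \<partial>K x) \<in> borel_measurable M"
\<comment> \<open>Sub-probability spaces are non-empty, so an empty \<open>space N\<close>, where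
  all integrals vanish, is set apart.\<close>
proof (cases "space N = {}")
  case True
  have "(\<integral>\<^sup>+y. f x y \<partial>K x) = 0" if "x \<in> space M" for x
    using finite_kernelD(3)[OF K that] True by (simp add: nn_integral_empty)
  then show ?thesis
    by (simp cong: measurable_cong)
next
  case ne: False
  \<comment> \<open>The summand 1 keeps the normalising constant away from 0 where the kernel
    vanishes; the total mass alone could not be inverted there.\<close>
  define t where "t x = 1 + emeasure (K x) (space N)" for x
  have [measurable]: "t \<in> borel_measurable M"
    unfolding t_def by measurable
  have t: "t x \<noteq> 0" "t x \<noteq> top" if "x \<in> space M" for x
    using finite_kernelD[OF K that]
    by (auto simp: t_def finite_measure.emeasure_finite ennreal_add_eq_top add_eq_0_iff_both_eq_0)
  let ?L = "\<lambda>x. scale_measure (inverse (t x)) (K x)"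
  have L: "?L \<in> measurable M (subprob_algebra N)"
  proof (rule measurable_subprob_algebra)
    fix x assume x: "x \<in> space M"
    have "inverse (t x) * emeasure (K x) (space N) \<le> inverse (t x) * t x"
      by (intro mult_left_mono) (auto simp: t_def)
    also have "\<dots> = 1"
      using t[OF x] by (metis ennreal_divide_self divide_ennreal_def mult.commute top.not_eq_extremum)
    finally show "subprob_space (?L x)"
      using finite_kernelD[OF K x] ne
      by (intro subprob_spaceI) (auto simp: space_scale_measure)
    show "sets (?L x) = sets N"
      using finite_kernelD[OF K x] by simp
  next
    fix A assume [measurable]: "A \<in> sets N"
    show "(\<lambda>x. emeasure (?L x) A) \<in> borel_measurable M"
      by simp
  qed
  have "(\<lambda>x. t x * (\<integral>\<^sup>+y. f x y \<partial>?L x)) \<in> borel_measurable M"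
    by (intro borel_measurable_times_ennreal nn_integral_measurable_subprob_algebra2[OF f L]) simp
  then show ?thesis
  proof (rule measurable_cong[THEN iffD1, rotated])
    fix x assume x: "x \<in> space M"
    have "f x \<in> borel_measurable N"
      using measurable_compose[OF measurable_Pair1'[OF x, of N] f] by simp
    then have "f x \<in> borel_measurable (K x)"
      using finite_kernelD(2)[OF K x] by (simp cong: measurable_cong_sets)
    then have "(\<integral>\<^sup>+y. f x y \<partial>?L x) = inverse (t x) * (\<integral>\<^sup>+y. f x y \<partial>K x)"
      by (rule nn_integral_scale_measure)
    then show "t x * (\<integral>\<^sup>+y. f x y \<partial>?L x) = (\<integral>\<^sup>+y. f x y \<partial>K x)"
      using t[OF x]
      by (metis ennreal_divide_self divide_ennreal_def mult.assoc mult_1 top.not_eq_extremum)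
  qed
qed

section \<open>Point masses and simple point measures\<close>

lemma measurable_diagonal:
  "{p :: 'x::{metric_space, second_countable_topology} \<times> 'x. fst p = snd p} \<in> sets (borel \<Otimes>\<^sub>M borel)"
proof -
  have "{p \<in> space (borel \<Otimes>\<^sub>M borel). dist (fst p) (snd p :: 'x) = 0} \<in> sets (borel \<Otimes>\<^sub>M borel)"
    by measurable
  then show ?thesis by (simp add: space_pair_measure)
qed

text \<open>The mass of {x} is the integral of the indicator of the diagonal, which is measurable as
  the zero set of the distance. Joint measurability in the outcome and the point is needed because
  the points examined later are random.\<close>

lemma measurable_point_mass:
  fixes K :: "'o \<Rightarrow> 'x::{metric_space, second_countable_topology} measure"
  assumes K[measurable]: "K \<in> measurable M finms"
  shows "(\<lambda>(\<omega>, x). measure (K \<omega>) {x}) \<in> borel_measurable (M \<Otimes>\<^sub>M borel)"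
proof -
  have "(\<lambda>p. \<integral>\<^sup>+y. indicator {q. fst q = snd q} (y, snd p) \<partial>K (fst p))
      \<in> borel_measurable (M \<Otimes>\<^sub>M (borel :: 'x measure))"
  proof (rule nn_integral_measurable_finite_kernel)
    have [measurable]: "(\<lambda>q. indicator {q. fst q = snd q} q :: ennreal)
        \<in> borel_measurable ((borel :: 'x measure) \<Otimes>\<^sub>M borel)"
      using measurable_diagonal by (rule borel_measurable_indicator)
    show "(\<lambda>(p, y). indicator {q. fst q = snd q} (y, snd p) :: ennreal)
        \<in> borel_measurable ((M \<Otimes>\<^sub>M borel) \<Otimes>\<^sub>M (borel :: 'x measure))"
      unfolding split_beta' by measurable
  qed measurable
  then have "(\<lambda>p. enn2real (\<integral>\<^sup>+y. indicator {q. fst q = snd q} (y, snd p) \<partial>K (fst p)))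
      \<in> borel_measurable (M \<Otimes>\<^sub>M (borel :: 'x measure))"
    by measurable
  then show ?thesis
  proof (rule measurable_cong[THEN iffD1, rotated])
    fix p :: "'o \<times> 'x" assume p: "p \<in> space (M \<Otimes>\<^sub>M borel)"
    obtain \<omega> x where [simp]: "p = (\<omega>, x)" by (cases p)
    have "(\<integral>\<^sup>+y. indicator {q. fst q = snd q} (y, snd p) \<partial>K (fst p)) = (\<integral>\<^sup>+y. indicator {x} y \<partial>K \<omega>)"
      by (auto intro!: nn_integral_cong split: split_indicator)
    also have "\<dots> = emeasure (K \<omega>) {x}"
      using p finite_kernelD(2)[OF K, of \<omega>] by (simp add: space_pair_measure)
    finally show "enn2real (\<integral>\<^sup>+y. indicator {q. fst q = snd q} (y, snd p) \<partial>K (fst p))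
        = (case p of (\<omega>, x) \<Rightarrow> measure (K \<omega>) {x})"
      by (simp add: measure_def)
  qed
qed

text \<open>For a finite Borel measure this says that it is a finite sum of unit masses at distinct
  points. Stated as an almost-everywhere property under \<mu> itself, it avoids naming the atoms and
  can be tested by an integral.\<close>

definition simple_pm :: "'x measure \<Rightarrow> bool" where
  "simple_pm \<mu> \<longleftrightarrow> (AE x in \<mu>. measure \<mu> {x} = 1)"

text \<open>The points of mass different from 1 form a set that varies with \<mu>, so its
  \<mu>-measure is written as the integral of a jointly measurable function against the identity
  kernel. The property is the vanishing of that integral.\<close>

lemma sets_finms_simple_pm[measurable]:
  "Measurable.pred finms (simple_pm :: 'x::{metric_space, second_countable_topology} measure \<Rightarrow> bool)"
proof -
  have id[measurable]: "(\<lambda>\<mu>. \<mu>) \<in> measurable finms (finms :: 'x measure measure)"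
    by simp
  note pt = measurable_point_mass[OF id, unfolded split_beta']
  have [measurable]: "(\<lambda>\<mu>. \<integral>\<^sup>+x. (if measure \<mu> {x} = 1 then 0 else 1) \<partial>\<mu>)
      \<in> borel_measurable (finms :: 'x measure measure)"
    by (rule nn_integral_measurable_finite_kernel) (use pt in \<open>unfold split_beta', measurable\<close>)
  have "Measurable.pred finms (\<lambda>\<mu>::'x measure. (\<integral>\<^sup>+x. (if measure \<mu> {x} = 1 then 0 else 1) \<partial>\<mu>) = 0)"
    by measurable
  then show ?thesis
  proof (rule measurable_cong[THEN iffD1, rotated])
    fix \<mu> :: "'x measure" assume \<mu>: "\<mu> \<in> space finms"
    have "(\<lambda>x. measure \<mu> {x}) \<in> borel_measurable borel"
      using measurable_compose[OF measurable_Pair1'[OF \<mu>, of borel] pt] by simp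
    then have "(\<lambda>x. if measure \<mu> {x} = 1 then 0 else 1 :: ennreal) \<in> borel_measurable \<mu>"
      using \<mu> by (simp add: space_finms cong: measurable_cong_sets)
    then show "(\<integral>\<^sup>+x. (if measure \<mu> {x} = 1 then 0 else 1) \<partial>\<mu>) = 0 \<longleftrightarrow> simple_pm \<mu>"
      by (subst nn_integral_0_iff_AE) (auto simp: simple_pm_def)
  qed
qed

text \<open>Each unit atom uses up mass 1, so there are at most as many as the total mass
  allows.\<close>

lemma finite_unit_atoms:
  assumes "finite_measure \<mu>" "sets \<mu> = sets (borel :: 'x::t1_space measure)"
  shows "finite {x. measure \<mu> {x} = 1}"
proof (rule ccontr)
  interpret finite_measure \<mu> by fact
  assume "infinite {x. measure \<mu> {x} = 1}"
  moreover define n where "n = Suc (nat \<lceil>measure \<mu> (space \<mu>)\<rceil>)"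
  ultimately obtain F where F: "finite F" "card F = n" "F \<subseteq> {x. measure \<mu> {x} = 1}"
    using infinite_arbitrarily_large by blast
  have "measure \<mu> F = (\<Sum>x\<in>F. measure \<mu> {x})"
    using F assms by (intro finite_measure_eq_sum_singleton) auto
  also have "\<dots> = real n"
    using F by (simp add: subset_iff)
  finally have "real n \<le> measure \<mu> (space \<mu>)"
    using bounded_measure[of F] by simp
  then show False
    unfolding n_def by linarith
qed

text \<open>Almost every point is a unit atom, so a set has the same mass as the finite set of unit
  atoms inside it. Masses of simple point measures are thus natural numbers, which is how Poisson
  counts become numbers of features.\<close>

lemma simple_pm_measure_eq_card:
  assumes "finite_measure \<mu>" "sets \<mu> = sets (borel :: 'x::t1_space measure)" "simple_pm \<mu>" "A \<in> sets borel"
  shows "measure \<mu> A = real (card {x\<in>A. measure \<mu> {x} = 1})"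
proof -
  interpret finite_measure \<mu> by fact
  have f: "finite {x\<in>A. measure \<mu> {x} = 1}"
    using finite_unit_atoms[OF assms(1,2)] by (rule rev_finite_subset) auto
  then have m: "{x\<in>A. measure \<mu> {x} = 1} \<in> sets \<mu>"
    using assms by (metis borel_closed finite_imp_closed)
  have "measure \<mu> A = measure \<mu> {x\<in>A. measure \<mu> {x} = 1}"
    using assms m by (intro finite_measure_eq_AE) (auto simp: simple_pm_def)
  also have "\<dots> = (\<Sum>x\<in>{x\<in>A. measure \<mu> {x} = 1}. measure \<mu> {x})"
    using assms f by (intro finite_measure_eq_sum_singleton) auto
  finally show ?thesis by simp
qed

lemma simple_pm_point:
  assumes "finite_measure \<mu>" "sets \<mu> = sets (borel :: 'x::t1_space measure)" "simple_pm \<mu>"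
  shows "measure \<mu> {x} \<in> {0, 1}"
proof -
  have "{y\<in>{x}. measure \<mu> {y} = 1} = (if measure \<mu> {x} = 1 then {x} else {})"
    by auto
  then show ?thesis
    using simple_pm_measure_eq_card[OF assms, of "{x}"] by (auto split: if_splits)
qed

section \<open>Uniqueness of the law of a Bernoulli random measure\<close>

text \<open>Constraints on a finite list of evaluations, a generating system stable under
  intersection. The sets may overlap here; the reduction to disjoint ones comes when laws are
  compared.\<close>

definition finms_cylinders :: "'x::topological_space measure set set" where
  "finms_cylinders = {{\<mu> \<in> space finms. \<forall>i<q. measure \<mu> (Bs i) \<in> C i} | (q::nat) Bs C.
     (\<forall>i<q. Bs i \<in> sets borel) \<and> (\<forall>i<q. C i \<in> sets borel)}"

lemma finms_cylinders_subset: "(finms_cylinders :: 'x::topological_space measure set set) \<subseteq> sets finms"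
proof
  fix A :: "'x measure set" assume "A \<in> finms_cylinders"
  then obtain q :: nat and Bs C where A: "A = {\<mu> \<in> space finms. \<forall>i<q. measure \<mu> (Bs i) \<in> C i}"
    and [measurable]: "\<And>i. i < q \<Longrightarrow> Bs i \<in> sets borel" "\<And>i. i < q \<Longrightarrow> C i \<in> sets borel"
    unfolding finms_cylinders_def by blast
  have "A = {\<mu> \<in> space finms. \<forall>i\<in>{..<q}. measure \<mu> (Bs i) \<in> C i}"
    by (auto simp: A)
  also have "\<dots> \<in> sets finms"
    by measurable
  finally show "A \<in> sets finms" .
qed

lemma sets_finms_eq_sigma_cylinders:
  "sets (finms :: 'x::topological_space measure measure) = sigma_sets (space finms) finms_cylinders"
proof
  let ?\<Omega> = "space finms :: 'x measure set"
  have sub: "finms_cylinders \<subseteq> Pow ?\<Omega>"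
    by (auto simp: finms_cylinders_def)
  have id: "(\<lambda>\<mu>. \<mu>) \<in> measurable (sigma ?\<Omega> finms_cylinders) finms"
  proof (rule measurable_finite_measures)
    fix A :: "'x set" assume A: "A \<in> sets borel"
    have "(\<lambda>\<mu>. measure \<mu> A) \<in> borel_measurable (sigma ?\<Omega> finms_cylinders)"
    proof (rule measurableI)
      fix C :: "real set" assume C: "C \<in> sets borel"
      have "(\<lambda>\<mu>. measure \<mu> A) -` C \<inter> ?\<Omega> = {\<mu> \<in> ?\<Omega>. \<forall>i<(1::nat). measure \<mu> A \<in> C}"
        by auto
      also have "\<dots> \<in> finms_cylinders"
        unfolding finms_cylinders_def using A C
        by (intro CollectI exI[of _ "1::nat"] exI[of _ "\<lambda>_. A"] exI[of _ "\<lambda>_. C"]) auto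
      finally show "(\<lambda>\<mu>. measure \<mu> A) -` C \<inter> space (sigma ?\<Omega> finms_cylinders)
          \<in> sets (sigma ?\<Omega> finms_cylinders)"
        using sub by (auto simp: space_measure_of_conv)
    qed simp
    then have "(\<lambda>\<mu>. ennreal (measure \<mu> A)) \<in> borel_measurable (sigma ?\<Omega> finms_cylinders)"
      by measurable
    then show "(\<lambda>\<mu>. emeasure \<mu> A) \<in> borel_measurable (sigma ?\<Omega> finms_cylinders)"
      by (rule measurable_cong[THEN iffD1, rotated])
         (auto simp: space_measure_of_conv space_finms finite_measure.emeasure_eq_measure)
  qed (auto simp: space_measure_of_conv space_finms)
  show "sets finms \<subseteq> sigma_sets ?\<Omega> finms_cylinders"
  proof
    fix A assume A: "A \<in> sets (finms :: 'x measure measure)"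
    have "(\<lambda>\<mu>. \<mu>) -` A \<inter> space (sigma ?\<Omega> finms_cylinders) \<in> sets (sigma ?\<Omega> finms_cylinders)"
      using id A by (rule measurable_sets)
    moreover have "A \<inter> ?\<Omega> = A"
      using sets.sets_into_space[OF A] by auto
    ultimately show "A \<in> sigma_sets ?\<Omega> finms_cylinders"
      using sub by (simp add: space_measure_of_conv)
  qed
  show "sigma_sets ?\<Omega> finms_cylinders \<subseteq> sets finms"
    by (rule sets.sigma_sets_subset) (rule finms_cylinders_subset)
qed

lemma Int_stable_finms_cylinders: "Int_stable (finms_cylinders :: 'x::topological_space measure set set)"
proof (rule Int_stableI)
  fix A A' :: "'x measure set" assume "A \<in> finms_cylinders" "A' \<in> finms_cylinders"
  then obtain q :: nat and Bs C and q' :: nat and Bs' C'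
    where A: "A = {\<mu> \<in> space finms. \<forall>i<q. measure \<mu> (Bs i) \<in> C i}"
    and A': "A' = {\<mu> \<in> space finms. \<forall>i<q'. measure \<mu> (Bs' i) \<in> C' i}"
    and m: "\<forall>i<q. Bs i \<in> sets borel" "\<forall>i<q. C i \<in> sets borel"
      "\<forall>i<q'. Bs' i \<in> sets borel" "\<forall>i<q'. C' i \<in> sets borel"
    unfolding finms_cylinders_def by blast
  \<comment> \<open>The two lists of constraints are concatenated: positions from \<open>q\<close>
    on belong to the second.\<close>
  let ?B = "\<lambda>i. if i < q then Bs i else Bs' (i - q)"
  let ?C = "\<lambda>i. if i < q then C i else C' (i - q)"
  have "(\<forall>i<q + q'. measure \<mu> (?B i) \<in> ?C i) \<longleftrightarrow>
      (\<forall>i<q. measure \<mu> (Bs i) \<in> C i) \<and> (\<forall>i<q'. measure \<mu> (Bs' i) \<in> C' i)" for \<mu>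
  proof
    assume *: "\<forall>i<q + q'. measure \<mu> (?B i) \<in> ?C i"
    have "measure \<mu> (Bs i) \<in> C i" if "i < q" for i
      using spec[OF *, of i] that by simp
    moreover have "measure \<mu> (Bs' i) \<in> C' i" if "i < q'" for i
      using spec[OF *, of "q + i"] that by simp
    ultimately show "(\<forall>i<q. measure \<mu> (Bs i) \<in> C i) \<and> (\<forall>i<q'. measure \<mu> (Bs' i) \<in> C' i)"
      by blast
  next
    assume "(\<forall>i<q. measure \<mu> (Bs i) \<in> C i) \<and> (\<forall>i<q'. measure \<mu> (Bs' i) \<in> C' i)"
    then show "\<forall>i<q + q'. measure \<mu> (?B i) \<in> ?C i"
      by (simp add: less_diff_conv2 not_less)
  qed
  then have "A \<inter> A' = {\<mu> \<in> space finms. \<forall>i<q + q'. measure \<mu> (?B i) \<in> ?C i}"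
    unfolding A A' by (simp only:) blast
  moreover have "\<forall>i<q + q'. ?B i \<in> sets borel" "\<forall>i<q + q'. ?C i \<in> sets borel"
    using m by (simp_all add: less_diff_conv2 not_less)
  ultimately show "A \<inter> A' \<in> finms_cylinders"
    unfolding finms_cylinders_def
    by (intro CollectI exI[of _ "q + q'"] exI[of _ ?B] exI[of _ ?C]) simp
qed

text \<open>Every finite family of sets is a family of unions of the atoms of the algebra that it
  generates, so the joint laws over disjoint families determine the law of a random measure.\<close>

lemma distr_finms_eqI:
  fixes N :: "'q \<Rightarrow> 'x::topological_space measure" and N' :: "'r \<Rightarrow> 'x measure"
  assumes "prob_space Q" "prob_space Q'"
    and N[measurable]: "N \<in> measurable Q finms" and N'[measurable]: "N' \<in> measurable Q' finms"
    and eq: "\<And>(n::nat) Bs. 0 < n \<Longrightarrow> (\<And>j. j < n \<Longrightarrow> Bs j \<in> sets borel) \<Longrightarrow> disjoint_family_on Bs {..<n} \<Longrightarrow>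
      distr Q (PiM {..<n} (\<lambda>_. borel)) (\<lambda>\<omega>. \<lambda>j\<in>{..<n}. measure (N \<omega>) (Bs j))
      = distr Q' (PiM {..<n} (\<lambda>_. borel)) (\<lambda>\<omega>. \<lambda>j\<in>{..<n}. measure (N' \<omega>) (Bs j))"
  shows "distr Q finms N = distr Q' finms N'"
proof (rule measure_eqI_generator_eq[where \<Omega>="space finms" and A="\<lambda>_. space finms", OF Int_stable_finms_cylinders])
  interpret Q: prob_space Q by fact
  interpret Q': prob_space Q' by fact
  show "finms_cylinders \<subseteq> Pow (space (finms :: 'x measure measure))"
    by (auto simp: finms_cylinders_def)
  show "sets (distr Q finms N) = sigma_sets (space finms) finms_cylinders"
    "sets (distr Q' finms N') = sigma_sets (space finms) finms_cylinders"
    by (simp_all add: sets_finms_eq_sigma_cylinders)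
  have "space finms = {\<mu> \<in> space finms. \<forall>i<(0::nat). measure \<mu> ({} :: 'x set) \<in> ({} :: real set)}"
    by auto
  also have "\<dots> \<in> finms_cylinders"
    unfolding finms_cylinders_def by (intro CollectI exI[of _ "0::nat"] exI[of _ "\<lambda>_. {}"]) auto
  finally show "range (\<lambda>_. space finms) \<subseteq> (finms_cylinders :: 'x measure set set)"
    by auto
  show "emeasure (distr Q finms N) (space finms) \<noteq> \<infinity>"
    by (simp add: emeasure_distr)
  fix A :: "'x measure set" assume A_in: "A \<in> finms_cylinders"
  then obtain q :: nat and Bs C where A: "A = {\<mu> \<in> space finms. \<forall>i<q. measure \<mu> (Bs i) \<in> C i}"
    and Bs[measurable]: "\<And>i. i < q \<Longrightarrow> Bs i \<in> sets borel" and C[measurable]: "\<And>i. i < q \<Longrightarrow> C i \<in> sets borel"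
    unfolding finms_cylinders_def by blast
  define n where "n = card (Pow {..<q})"
  obtain f where f: "bij_betw f {0..<n} (Pow {..<q})"
    unfolding n_def using ex_bij_betw_nat_finite[of "Pow {..<q}"] by auto
  have n: "0 < n"
    unfolding n_def by (subst card_gt_0_iff) auto
  \<comment> \<open>\<open>f\<close> enumerates the subsets of the index set, and \<open>D l\<close>
    collects the points whose pattern of membership in the sets \<open>Bs i\<close> is exactly
    \<open>f l\<close>. Each point has one pattern, so these cells are disjoint and each
    \<open>Bs i\<close> is the union of the cells whose pattern contains i.\<close>
  define D where "D l = {x. \<forall>i<q. x \<in> Bs i \<longleftrightarrow> i \<in> f l}" for l
  have D[measurable]: "D l \<in> sets borel" for l
  proof -
    have "D l = {x \<in> space borel. \<forall>i\<in>{..<q}. x \<in> Bs i \<longleftrightarrow> i \<in> f l}"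
      by (auto simp: D_def)
    also have "\<dots> \<in> sets borel"
    proof (rule sets.sets_Collect_finite_All)
      fix i assume "i \<in> {..<q}"
      then have "Bs i \<in> sets borel" "- Bs i \<in> sets borel"
        using Bs by (auto intro: borel_comp)
      moreover have "{x \<in> space borel. x \<in> Bs i \<longleftrightarrow> i \<in> f l} = (if i \<in> f l then Bs i else - Bs i)"
        by auto
      ultimately show "{x \<in> space borel. x \<in> Bs i \<longleftrightarrow> i \<in> f l} \<in> sets borel"
        by simp
    qed simp
    finally show ?thesis .
  qed
  have disj: "disjoint_family_on D {..<n}"
  unfolding disjoint_family_on_def
  proof (intro ballI impI)
    fix k l assume *: "k \<in> {..<n}" "l \<in> {..<n}" "k \<noteq> l"
    have "f k \<noteq> f l" "f k \<subseteq> {..<q}" "f l \<subseteq> {..<q}"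
      using * bij_betw_inv_into_left[OF f, of k] bij_betw_inv_into_left[OF f, of l]
        bij_betwE[OF f] by auto
    then show "D k \<inter> D l = {}"
      by (auto simp: D_def)
  qed
  have Bs_eq: "Bs i = (\<Union>l\<in>{l\<in>{..<n}. i \<in> f l}. D l)" if "i < q" for i
  proof (intro set_eqI iffI)
    fix x assume x: "x \<in> Bs i"
    have "{i. i < q \<and> x \<in> Bs i} \<in> Pow {..<q}"
      by auto
    then obtain l where l: "l \<in> {0..<n}" "{i. i < q \<and> x \<in> Bs i} = f l"
      unfolding bij_betw_imp_surj_on[OF f, symmetric] by blast
    have "x \<in> D l"
      unfolding D_def l(2)[symmetric] by simp
    moreover have "i \<in> f l"
      unfolding l(2)[symmetric] using x that by simp
    ultimately show "x \<in> (\<Union>l\<in>{l\<in>{..<n}. i \<in> f l}. D l)"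
      using l(1) by (intro UN_I[of l]) simp_all
  next
    fix x assume "x \<in> (\<Union>l\<in>{l\<in>{..<n}. i \<in> f l}. D l)"
    then show "x \<in> Bs i"
      using that unfolding D_def by blast
  qed
  have sum_eq: "measure \<mu> (Bs i) = (\<Sum>l\<in>{l\<in>{..<n}. i \<in> f l}. measure \<mu> (D l))"
    if "\<mu> \<in> space finms" "i < q" for \<mu> i
  proof -
    interpret finite_measure \<mu> using that by (simp add: space_finms)
    show ?thesis
      unfolding Bs_eq[OF that(2)] using that disj
      by (intro finite_measure_finite_Union)
         (auto simp: space_finms disjoint_family_on_def)
  qed
  let ?Pi = "PiM {..<n} (\<lambda>_. borel :: real measure)"
  \<comment> \<open>The cylinder condition rewritten for the vector of cell masses: by additivity
    the mass of \<open>Bs i\<close> is a partial sum of that vector.\<close>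
  define W where "W = {v \<in> space ?Pi. \<forall>i\<in>{..<q}. (\<Sum>l\<in>{l\<in>{..<n}. i \<in> f l}. v l) \<in> C i}"
  have W[measurable]: "W \<in> sets ?Pi"
    unfolding W_def
  proof (intro sets.sets_Collect_finite_All)
    fix i assume i: "i \<in> {..<q}"
    have "(\<lambda>v. \<Sum>l\<in>{l\<in>{..<n}. i \<in> f l}. v l) \<in> borel_measurable ?Pi"
      by (intro borel_measurable_sum measurable_component_singleton) auto
    moreover have "C i \<in> sets borel"
      using C i by auto
    ultimately show "{v \<in> space ?Pi. (\<Sum>l\<in>{l\<in>{..<n}. i \<in> f l}. v l) \<in> C i} \<in> sets ?Pi"
      using measurable_sets[of _ ?Pi borel "C i"] by (simp add: vimage_def Int_def conj_commute)
  qed simp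
  have *: "emeasure (distr R finms L) A = emeasure (distr R ?Pi (\<lambda>\<omega>. \<lambda>j\<in>{..<n}. measure (L \<omega>) (D j))) W"
    if L[measurable]: "L \<in> measurable R finms" for R :: "'t measure" and L
  proof -
    have "L \<omega> \<in> A \<longleftrightarrow> (\<lambda>j\<in>{..<n}. measure (L \<omega>) (D j)) \<in> W" if "\<omega> \<in> space R" for \<omega>
    proof -
      have L\<omega>: "L \<omega> \<in> space finms"
        using L that by (rule measurable_space)
      have "(\<Sum>l\<in>{l\<in>{..<n}. i \<in> f l}. (\<lambda>j\<in>{..<n}. measure (L \<omega>) (D j)) l) = measure (L \<omega>) (Bs i)"
        if "i < q" for i
        unfolding sum_eq[OF L\<omega> that] by (intro sum.cong) auto
      then show ?thesis
        using L\<omega> by (simp add: A W_def space_PiM Ball_def)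
    qed
    then have "L -` A \<inter> space R = (\<lambda>\<omega>. \<lambda>j\<in>{..<n}. measure (L \<omega>) (D j)) -` W \<inter> space R"
      by blast
    moreover have "A \<in> sets finms"
      using A_in finms_cylinders_subset by auto
    moreover have "(\<lambda>\<omega>. \<lambda>j\<in>{..<n}. measure (L \<omega>) (D j)) \<in> measurable R ?Pi"
      by (intro measurable_restrict measurable_compose[OF L measurable_measure_finite_measures] D)
    ultimately show ?thesis
      using W L by (simp add: emeasure_distr)
  qed
  show "emeasure (distr Q finms N) A = emeasure (distr Q' finms N') A"
    unfolding *[OF N] *[OF N'] eq[OF n D disj] ..
qed auto

section \<open>Laws carried by the natural numbers\<close>

lemma nat_valued_measure_eq_suminf:
  assumes "prob_space Q" and Y[measurable]: "Y \<in> borel_measurable Q"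
    and p: "\<And>k::nat. measure Q {\<omega>\<in>space Q. Y \<omega> = real k} = p k" and p1: "p sums 1"
    and [measurable]: "A \<in> sets borel"
  shows "measure Q {\<omega>\<in>space Q. Y \<omega> \<in> A} = (\<Sum>k. indicator A (real k) * p k)"
proof -
  interpret prob_space Q by fact
  have *: "(\<lambda>k. measure Q {\<omega>\<in>space Q. Y \<omega> = real k \<and> Y \<omega> \<in> A'}) sums
      measure Q (\<Union>k. {\<omega>\<in>space Q. Y \<omega> = real k \<and> Y \<omega> \<in> A'})" if [measurable]: "A' \<in> sets borel" for A'
    by (intro finite_measure_UNION) (auto simp: disjoint_family_on_def)
  \<comment> \<open>No pointwise integrality of Y is assumed: the prescribed probabilities sum to 1,
    so Y is a natural number almost surely.\<close>
  have "measure Q (\<Union>k. {\<omega>\<in>space Q. Y \<omega> = real k \<and> Y \<omega> \<in> UNIV}) = 1"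
    using *[of UNIV] p1 by (auto simp: p intro: sums_unique2)
  then have "AE \<omega> in Q. \<omega> \<in> (\<Union>k. {\<omega>\<in>space Q. Y \<omega> = real k \<and> Y \<omega> \<in> UNIV})"
    by (subst (asm) prob_eq_1) auto
  then have "measure Q {\<omega>\<in>space Q. Y \<omega> \<in> A} = measure Q (\<Union>k. {\<omega>\<in>space Q. Y \<omega> = real k \<and> Y \<omega> \<in> A})"
    by (intro finite_measure_eq_AE) auto
  also have "\<dots> = (\<Sum>k. measure Q {\<omega>\<in>space Q. Y \<omega> = real k \<and> Y \<omega> \<in> A})"
    using *[of A] by (simp add: sums_unique)
  also have "(\<lambda>k. measure Q {\<omega>\<in>space Q. Y \<omega> = real k \<and> Y \<omega> \<in> A}) = (\<lambda>k. indicator A (real k) * p k)"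
  proof
    fix k
    have "{\<omega>\<in>space Q. Y \<omega> = real k \<and> Y \<omega> \<in> A} = (if real k \<in> A then {\<omega>\<in>space Q. Y \<omega> = real k} else {})"
      by auto
    then show "measure Q {\<omega>\<in>space Q. Y \<omega> = real k \<and> Y \<omega> \<in> A} = indicator A (real k) * p k"
      by (simp add: p)
  qed
  finally show ?thesis .
qed

definition nat_law :: "(nat \<Rightarrow> real) \<Rightarrow> real measure" where
  "nat_law p = distr (density (count_space UNIV) (\<lambda>k. ennreal (p k))) borel real"

lemma distr_eq_nat_law:
  assumes Q: "prob_space Q" and Y[measurable]: "Y \<in> borel_measurable Q"
    and p: "\<And>k::nat. measure Q {\<omega>\<in>space Q. Y \<omega> = real k} = p k" and p1: "p sums 1"
  shows "distr Q borel Y = nat_law p"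
proof (rule measure_eqI)
  interpret prob_space Q by fact
  fix A assume "A \<in> sets (distr Q borel Y)"
  then have A[measurable]: "A \<in> sets borel" by simp
  have p0: "0 \<le> p k" for k
    unfolding p[symmetric] by simp
  have "summable (\<lambda>k. indicator A (real k) * p k)"
    by (rule summable_comparison_test'[OF sums_summable[OF p1], of 0]) (auto simp: indicator_def p0)
  then have "emeasure (nat_law p) A = (\<Sum>k. indicator A (real k) * p k)"
    unfolding nat_law_def
    by (simp add: emeasure_distr emeasure_density nn_integral_count_space_nat indicator_vimage[symmetric]
        ennreal_indicator[symmetric] ennreal_mult'[symmetric] suminf_ennreal2 p0 mult.commute
        del: ennreal_indicator)
  moreover have "emeasure (distr Q borel Y) A = (\<Sum>k. indicator A (real k) * p k)"
    unfolding nat_valued_measure_eq_suminf[OF Q Y p p1 A, symmetric]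
    by (simp add: emeasure_distr emeasure_eq_measure vimage_def Int_def conj_commute)
  ultimately show "emeasure (distr Q borel Y) A = emeasure (nat_law p) A"
    by simp
qed (simp add: nat_law_def)

abbreviation poisson_prob :: "real \<Rightarrow> nat \<Rightarrow> real" where
  "poisson_prob x k \<equiv> x ^ k / fact k * exp (- x)"

definition bernoulli_prob :: "real \<Rightarrow> nat \<Rightarrow> real" where
  "bernoulli_prob p k = (if k = 0 then 1 - p else if k = 1 then p else 0)"

lemma poisson_sums: "poisson_prob x sums 1"
proof -
  have "(\<lambda>k. x ^ k / fact k * exp (- x)) sums (exp x * exp (- x))"
    using exp_converges[of x] by (intro sums_mult2) (simp add: divide_inverse mult.commute scaleR_conv_of_real)
  then show ?thesis by (simp add: exp_minus_inverse)
qed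

lemma bernoulli_sums: "bernoulli_prob p sums 1"
proof -
  have "(\<lambda>k::nat. if k = 0 then 1 - p else if k = 1 then p else (0::real)) sums
      (\<Sum>k\<in>{0, 1::nat}. if k = 0 then 1 - p else if k = 1 then p else 0)"
    by (intro sums_finite) auto
  then show ?thesis by (simp add: bernoulli_prob_def[abs_def])
qed

section \<open>The joint law of a Bernoulli random measure over disjoint sets\<close>

lemma (in prob_space) indep_vars_imp_distr_eq_PiM:
  assumes "indep_vars M' X I"
  shows "distr M (PiM I M') (\<lambda>\<omega>. \<lambda>i\<in>I. X i \<omega>) = PiM I (\<lambda>i. distr M (M' i) (X i))"
\<comment> \<open>The empty family arises from a hazard measure without atoms, as at time 0; both
  sides are then the point mass at the function that is \<open>undefined\<close> everywhere.\<close>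
proof (cases "I = {}")
  case True
  have rv: "random_variable (PiM {} M') (\<lambda>\<omega>. \<lambda>i\<in>{}. X i \<omega>)"
    by (rule measurable_restrict) auto
  show ?thesis
    unfolding True
  proof (rule measure_eqI)
    fix A assume "A \<in> sets (distr M (PiM {} M') (\<lambda>\<omega>. \<lambda>i\<in>{}. X i \<omega>))"
    then have "A = {} \<or> A = {\<lambda>_. undefined}"
      by (auto simp: PiM_empty)
    then show "emeasure (distr M (PiM {} M') (\<lambda>\<omega>. \<lambda>i\<in>{}. X i \<omega>)) A
        = emeasure (PiM {} (\<lambda>i. distr M (M' i) (X i))) A"
      using rv by (auto simp: PiM_empty emeasure_distr restrict_def emeasure_space_1)
  qed (simp add: PiM_empty)
next
  case False
  then show ?thesis
    using assms indep_vars_iff_distr_eq_PiM'[OF False, where M'=M' and X=X] by (auto simp: indep_vars_def)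
qed

lemma (in prob_space) indep_set_imp_distr_pair:
  assumes ind: "indep_set (sets F1) (sets F2)" and F: "space F1 = space M" "space F2 = space M"
    and X: "X \<in> measurable F1 S" and Y: "Y \<in> measurable F2 T"
  shows "distr M S X \<Otimes>\<^sub>M distr M T Y = distr M (S \<Otimes>\<^sub>M T) (\<lambda>\<omega>. (X \<omega>, Y \<omega>))"
proof -
  have sub: "sets F1 \<subseteq> events" "sets F2 \<subseteq> events"
    using ind by (auto simp: indep_sets2_eq)
  have [measurable]: "X \<in> measurable M S" "Y \<in> measurable M T"
    using X Y sub F by (auto simp: measurable_def)
  interpret X: prob_space "distr M S X" by (rule prob_space_distr) fact
  interpret Y: prob_space "distr M T Y" by (rule prob_space_distr) fact
  show ?thesis
  proof (rule pair_measure_eqI)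
    fix A B assume "A \<in> sets (distr M S X)" "B \<in> sets (distr M T Y)"
    then have [measurable]: "A \<in> sets S" "B \<in> sets T" by simp_all
    have "X -` A \<inter> space M \<in> sets F1" "Y -` B \<inter> space M \<in> sets F2"
      using measurable_sets[OF X, of A] measurable_sets[OF Y, of B] F by auto
    then have "prob ((X -` A \<inter> space M) \<inter> (Y -` B \<inter> space M)) = prob (X -` A \<inter> space M) * prob (Y -` B \<inter> space M)"
      using ind by (auto simp: indep_sets2_eq)
    moreover have "(\<lambda>\<omega>. (X \<omega>, Y \<omega>)) -` (A \<times> B) \<inter> space M = (X -` A \<inter> space M) \<inter> (Y -` B \<inter> space M)"
      by auto
    ultimately show "emeasure (distr M S X) A * emeasure (distr M T Y) B
        = emeasure (distr M (S \<Otimes>\<^sub>M T) (\<lambda>\<omega>. (X \<omega>, Y \<omega>))) (A \<times> B)"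
      by (simp add: emeasure_distr emeasure_eq_measure ennreal_mult)
  qed (auto intro: X.sigma_finite_measure Y.sigma_finite_measure)
qed

text \<open>The right side depends on \<nu> alone: the choice of the Poisson part and of the
  indicators, existentially quantified in \<open>BeP_rm\<close>, has disappeared. Finitely many
  atoms make the indicator sum a finite, hence measurable, function of the indicator vector.\<close>

lemma BeP_rm_joint_law:
  fixes \<nu> :: "'x::topological_space measure"
  assumes "prob_space Q" and bep: "BeP_rm Q N \<nu>" and S: "finite (atoms_of \<nu>)"
    and Bs: "\<And>j. j < n \<Longrightarrow> Bs j \<in> sets borel" and disj: "disjoint_family_on Bs {..<n::nat}"
  shows "distr Q (PiM {..<n} (\<lambda>_. borel)) (\<lambda>\<omega>. \<lambda>j\<in>{..<n}. measure (N \<omega>) (Bs j))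
      = distr (PiM {..<n} (\<lambda>j. nat_law (poisson_prob (diffuse_part \<nu> (Bs j))))
            \<Otimes>\<^sub>M PiM (atoms_of \<nu>) (\<lambda>x. nat_law (bernoulli_prob (measure \<nu> {x}))))
          (PiM {..<n} (\<lambda>_. borel)) (\<lambda>p. \<lambda>j\<in>{..<n}. fst p j + (\<Sum>x\<in>atoms_of \<nu> \<inter> Bs j. snd p x))"
proof -
  interpret prob_space Q by fact
  let ?S = "atoms_of \<nu>"
  let ?I = "{..<n}"
  let ?PI = "PiM ?I (\<lambda>_. borel :: real measure)"
  let ?PS = "PiM ?S (\<lambda>_. borel :: real measure)"
  from bep obtain N1 and V :: "'x \<Rightarrow> 'a \<Rightarrow> real" where
      N: "random_measure Q N" and po: "poisson_rm Q N1 (diffuse_part \<nu>)"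
    and V: "\<And>x. x \<in> ?S \<Longrightarrow> V x \<in> borel_measurable Q" "\<And>x \<omega>. x \<in> ?S \<Longrightarrow> \<omega> \<in> space Q \<Longrightarrow> V x \<omega> \<in> {0, 1}"
      "\<And>x. x \<in> ?S \<Longrightarrow> measure Q {\<omega>\<in>space Q. V x \<omega> = 1} = measure \<nu> {x}"
    and Vi: "indep_vars (\<lambda>_. borel) V ?S"
    and NV: "indep_set (sets (vimage_algebra (space Q) N1 finms))
        (sets (vimage_algebra (space Q) (\<lambda>\<omega>. restrict (\<lambda>x. V x \<omega>) ?S) ?PS))"
    and ae: "AE \<omega> in Q. \<forall>B\<in>sets (borel :: 'x measure).
            measure (N \<omega>) B = measure (N1 \<omega>) B + (\<Sum>\<^sub>\<infinity>x\<in>?S \<inter> B. V x \<omega>)"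
    unfolding BeP_rm_def by blast
  have N1: "N1 \<in> measurable Q finms" and N': "N \<in> measurable Q finms"
    using po N by (auto simp: poisson_rm_def random_measure_iff_measurable)
  define a where "a j \<omega> = measure (N1 \<omega>) (Bs j)" for j \<omega>
  have Y: "(\<lambda>\<mu>. \<lambda>j\<in>?I. measure \<mu> (Bs j)) \<in> measurable finms ?PI"
    using Bs by (intro measurable_restrict measurable_measure_finite_measures) auto
  have ai: "indep_vars (\<lambda>_. borel) a ?I"
    using po Bs disj unfolding poisson_rm_def a_def by auto
  have am: "a j \<in> borel_measurable Q" if "j < n" for j
    using ai that by (auto simp: indep_vars_def)
  let ?Xa = "\<lambda>\<omega>. \<lambda>j\<in>?I. a j \<omega>" and ?Xb = "\<lambda>\<omega>. \<lambda>x\<in>?S. V x \<omega>"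
  have Xa[measurable]: "?Xa \<in> measurable Q ?PI"
    using am by (intro measurable_restrict) auto
  have Xb[measurable]: "?Xb \<in> measurable Q ?PS"
    using V by (intro measurable_restrict) auto
  have Xa': "?Xa \<in> measurable (vimage_algebra (space Q) N1 finms) ?PI"
  proof -
    have "N1 \<in> measurable (vimage_algebra (space Q) N1 finms) finms"
      using measurable_space[OF N1] by (intro measurable_vimage_algebra1) auto
    from measurable_compose[OF this Y] show ?thesis
      by (simp add: a_def)
  qed
  have Xb': "?Xb \<in> measurable (vimage_algebra (space Q) ?Xb ?PS) ?PS"
    using measurable_space[OF Xb] by (intro measurable_vimage_algebra1) auto
  have joint: "distr Q ?PI ?Xa \<Otimes>\<^sub>M distr Q ?PS ?Xb = distr Q (?PI \<Otimes>\<^sub>M ?PS) (\<lambda>\<omega>. (?Xa \<omega>, ?Xb \<omega>))"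
    by (rule indep_set_imp_distr_pair[OF NV _ _ Xa' Xb']) (simp_all add: space_vimage_algebra)
  \<comment> \<open>\<open>\<Phi>\<close> adds the Bernoulli count to the Poisson count in each set.
    The law sought is the image of a product law under \<open>\<Phi>\<close>, because the two
    vectors are independent and each has independent entries.\<close>
  define \<Phi> where "\<Phi> p = (\<lambda>j\<in>?I. fst p j + (\<Sum>x\<in>?S \<inter> Bs j. snd p x))" for p :: "(nat \<Rightarrow> real) \<times> ('x \<Rightarrow> real)"
  have \<Phi>: "\<Phi> \<in> measurable (?PI \<Otimes>\<^sub>M ?PS) ?PI"
    unfolding \<Phi>_def
  proof (rule measurable_restrict)
    fix j assume j: "j \<in> ?I"
    have "(\<lambda>p. snd p x) \<in> borel_measurable (?PI \<Otimes>\<^sub>M ?PS)" if "x \<in> ?S \<inter> Bs j" for x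
      using that by (intro measurable_compose[OF measurable_snd measurable_component_singleton]) auto
    moreover have "(\<lambda>p. fst p j) \<in> borel_measurable (?PI \<Otimes>\<^sub>M ?PS)"
      using j by (intro measurable_compose[OF measurable_fst measurable_component_singleton]) auto
    ultimately show "(\<lambda>p. fst p j + (\<Sum>x\<in>?S \<inter> Bs j. snd p x)) \<in> borel_measurable (?PI \<Otimes>\<^sub>M ?PS)"
      by (intro borel_measurable_add borel_measurable_sum) auto
  qed
  have "distr Q ?PI (\<lambda>\<omega>. \<lambda>j\<in>?I. measure (N \<omega>) (Bs j)) = distr Q ?PI (\<lambda>\<omega>. \<Phi> (?Xa \<omega>, ?Xb \<omega>))"
  proof (rule distr_cong_AE)
    show "AE \<omega> in Q. (\<lambda>j\<in>?I. measure (N \<omega>) (Bs j)) = \<Phi> (?Xa \<omega>, ?Xb \<omega>)"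
      using ae
    proof eventually_elim
      case (elim \<omega>)
      have "measure (N \<omega>) (Bs j) = a j \<omega> + (\<Sum>x\<in>?S \<inter> Bs j. ?Xb \<omega> x)" if "j < n" for j
      proof -
        have "(\<Sum>\<^sub>\<infinity>x\<in>?S \<inter> Bs j. V x \<omega>) = (\<Sum>x\<in>?S \<inter> Bs j. V x \<omega>)"
          using S by (intro infsum_finite) auto
        also have "\<dots> = (\<Sum>x\<in>?S \<inter> Bs j. ?Xb \<omega> x)"
          by (intro sum.cong) auto
        finally show ?thesis
          using elim Bs[OF that] by (simp add: a_def)
      qed
      then show ?case
        by (auto simp: \<Phi>_def restrict_def)
    qed
    show "(\<lambda>\<omega>. \<lambda>j\<in>?I. measure (N \<omega>) (Bs j)) \<in> measurable Q ?PI"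
      using measurable_compose[OF N' Y] .
    show "(\<lambda>\<omega>. \<Phi> (?Xa \<omega>, ?Xb \<omega>)) \<in> measurable Q ?PI"
      by (rule measurable_compose[OF _ \<Phi>]) measurable
  qed auto
  also have "\<dots> = distr (distr Q (?PI \<Otimes>\<^sub>M ?PS) (\<lambda>\<omega>. (?Xa \<omega>, ?Xb \<omega>))) ?PI \<Phi>"
    using \<Phi> by (subst distr_distr) (auto simp: comp_def)
  also have "\<dots> = distr (distr Q ?PI ?Xa \<Otimes>\<^sub>M distr Q ?PS ?Xb) ?PI \<Phi>"
    by (simp add: joint)
  also have "\<dots> = distr (PiM ?I (\<lambda>j. distr Q borel (a j)) \<Otimes>\<^sub>M PiM ?S (\<lambda>x. distr Q borel (V x))) ?PI \<Phi>"
    by (simp add: indep_vars_imp_distr_eq_PiM[OF ai] indep_vars_imp_distr_eq_PiM[OF Vi])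
  finally have law: "distr Q ?PI (\<lambda>\<omega>. \<lambda>j\<in>?I. measure (N \<omega>) (Bs j)) = \<dots>" .
  have Vk: "measure Q {\<omega>\<in>space Q. V x \<omega> = real k}
        = bernoulli_prob (measure \<nu> {x}) k" if x: "x \<in> ?S" for x k
  proof -
    have "{\<omega>\<in>space Q. V x \<omega> = 0} = space Q - {\<omega>\<in>space Q. V x \<omega> = 1}"
      using V(2)[OF x] by auto
    moreover have "{\<omega>\<in>space Q. V x \<omega> = 1} \<in> events"
      using V(1)[OF x] by measurable
    ultimately have 0: "measure Q {\<omega>\<in>space Q. V x \<omega> = 0} = 1 - measure \<nu> {x}"
      using V(3)[OF x] by (simp add: prob_compl)
    have "{\<omega>\<in>space Q. V x \<omega> = real k} = {}" if "k \<noteq> 0" "k \<noteq> 1"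
      using V(2)[OF x] that by (fastforce simp: eq_commute[of _ "real k"])
    then have "measure Q {\<omega>\<in>space Q. V x \<omega> = real k} = 0" if "k \<noteq> 0" "k \<noteq> 1"
      using that by (metis measure_empty)
    then show ?thesis
      using V(3)[OF x] 0 by (cases "k = 0"; cases "k = 1") (simp_all add: bernoulli_prob_def)
  qed
  have "PiM ?I (\<lambda>j. distr Q borel (a j)) = PiM ?I (\<lambda>j. nat_law (poisson_prob (diffuse_part \<nu> (Bs j))))"
    using am Bs po by (intro PiM_cong refl distr_eq_nat_law poisson_sums \<open>prob_space Q\<close>)
      (auto simp: poisson_rm_def a_def)
  moreover have "PiM ?S (\<lambda>x. distr Q borel (V x)) = PiM ?S (\<lambda>x. nat_law (bernoulli_prob (measure \<nu> {x})))"
    using V(1) Vk by (intro PiM_cong refl distr_eq_nat_law bernoulli_sums \<open>prob_space Q\<close>) auto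
  ultimately show ?thesis
    using law by (simp add: \<Phi>_def[abs_def])
qed

lemma BeP_rm_unique:
  fixes \<nu> :: "'x::topological_space measure"
  assumes Q: "prob_space Q" and Q': "prob_space Q'" and bep: "BeP_rm Q N \<nu>" and bep': "BeP_rm Q' N' \<nu>"
    and S: "finite (atoms_of \<nu>)"
  shows "distr Q finms N = distr Q' finms N'"
proof (rule distr_finms_eqI[OF Q Q'])
  show "N \<in> measurable Q finms" "N' \<in> measurable Q' finms"
    using bep bep' by (auto simp: BeP_rm_def random_measure_iff_measurable)
  fix n :: nat and Bs assume Bs: "\<And>j. j < n \<Longrightarrow> Bs j \<in> sets (borel :: 'x measure)"
    and disj: "disjoint_family_on Bs {..<n}"
  show "distr Q (PiM {..<n} (\<lambda>_. borel)) (\<lambda>\<omega>. \<lambda>j\<in>{..<n}. measure (N \<omega>) (Bs j))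
      = distr Q' (PiM {..<n} (\<lambda>_. borel)) (\<lambda>\<omega>. \<lambda>j\<in>{..<n}. measure (N' \<omega>) (Bs j))"
    using BeP_rm_joint_law[OF Q bep S Bs disj] BeP_rm_joint_law[OF Q' bep' S Bs disj] by (rule trans[OF _ sym])
qed

section \<open>Existence of the law of a Bernoulli random measure\<close>

definition madd :: "'x::topological_space measure \<Rightarrow> 'x measure \<Rightarrow> 'x measure" where
  "madd \<mu> \<nu> = measure_of UNIV (sets borel) (\<lambda>A. emeasure \<mu> A + emeasure \<nu> A)"

lemma sets_madd[simp]: "sets (madd \<mu> \<nu>) = sets (borel :: 'x::topological_space measure)"
  using sets.sigma_sets_eq[of "borel :: 'x measure"] by (simp add: madd_def)

lemma emeasure_madd:
  fixes \<mu> \<nu> :: "'x::topological_space measure"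
  assumes "sets \<mu> = sets borel" "sets \<nu> = sets borel" "A \<in> sets borel"
  shows "emeasure (madd \<mu> \<nu>) A = emeasure \<mu> A + emeasure \<nu> A"
proof (rule emeasure_measure_of[OF madd_def])
  show "countably_additive (sets (madd \<mu> \<nu>)) (\<lambda>A. emeasure \<mu> A + emeasure \<nu> A)"
  proof (rule countably_additiveI)
    fix F :: "nat \<Rightarrow> 'x set" assume F: "range F \<subseteq> sets (madd \<mu> \<nu>)" "disjoint_family F"
    have "(\<Sum>i. emeasure \<mu> (F i) + emeasure \<nu> (F i)) = (\<Sum>i. emeasure \<mu> (F i)) + (\<Sum>i. emeasure \<nu> (F i))"
      by (intro suminf_add[symmetric] summableI)
    also have "\<dots> = emeasure \<mu> (\<Union>i. F i) + emeasure \<nu> (\<Union>i. F i)"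
      using F assms by (intro arg_cong2[where f="(+)"] suminf_emeasure) auto
    finally show "(\<Sum>i. emeasure \<mu> (F i) + emeasure \<nu> (F i)) = emeasure \<mu> (\<Union>i. F i) + emeasure \<nu> (\<Union>i. F i)" .
  qed
qed (use assms sets.space_closed[of "borel :: 'x measure"] in \<open>auto simp: positive_def\<close>)

lemma
  assumes "\<mu> \<in> space finms" "\<nu> \<in> space finms"
  shows madd_in_space: "madd \<mu> \<nu> \<in> space finms"
    and measure_madd: "A \<in> sets borel \<Longrightarrow> measure (madd \<mu> \<nu>) A = measure \<mu> A + measure \<nu> A"
proof -
  interpret \<mu>: finite_measure \<mu> using assms by (simp add: space_finms)
  interpret \<nu>: finite_measure \<nu> using assms by (simp add: space_finms)
  have *: "emeasure (madd \<mu> \<nu>) A = emeasure \<mu> A + emeasure \<nu> A" if "A \<in> sets borel" for A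
    using assms that by (intro emeasure_madd) (auto simp: space_finms)
  have "space (madd \<mu> \<nu>) = UNIV"
    using sets_eq_imp_space_eq[OF sets_madd] by simp
  then have "emeasure (madd \<mu> \<nu>) (space (madd \<mu> \<nu>)) \<noteq> \<infinity>"
    using *[of UNIV] by simp
  then show "madd \<mu> \<nu> \<in> space finms"
    by (auto simp: space_finms intro: finite_measureI)
  show "measure (madd \<mu> \<nu>) A = measure \<mu> A + measure \<nu> A" if "A \<in> sets borel"
    unfolding measure_def *[OF that] by (intro enn2real_plus) (simp_all add: less_top[symmetric])
qed

lemma measurable_madd:
  fixes f g :: "'a \<Rightarrow> 'x::topological_space measure"
  assumes f[measurable]: "f \<in> measurable M finms" and g[measurable]: "g \<in> measurable M finms"
  shows "(\<lambda>x. madd (f x) (g x)) \<in> measurable M finms"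
proof (rule measurable_finite_measures)
  fix x assume "x \<in> space M"
  then have "madd (f x) (g x) \<in> space finms"
    using measurable_space[OF f] measurable_space[OF g] by (intro madd_in_space)
  then show "finite_measure (madd (f x) (g x))"
    by (simp add: space_finms)
next
  fix A :: "'x set" assume [measurable]: "A \<in> sets borel"
  have "(\<lambda>x. emeasure (f x) A + emeasure (g x) A) \<in> borel_measurable M"
    by measurable
  then show "(\<lambda>x. emeasure (madd (f x) (g x)) A) \<in> borel_measurable M"
    by (rule measurable_cong[THEN iffD1, rotated])
       (use measurable_space[OF f] measurable_space[OF g] in \<open>auto simp: space_finms emeasure_madd\<close>)
qed simp

text \<open>Without a common unit atom no point acquires mass 2, and outside the finite set of all
  unit atoms both measures vanish.\<close>

lemma simple_pm_madd:
  fixes \<mu> \<nu> :: "'x::t1_space measure"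
  assumes fin: "\<mu> \<in> space finms" "\<nu> \<in> space finms" and simp: "simple_pm \<mu>" "simple_pm \<nu>"
    and disj: "\<And>x. measure \<mu> {x} = 1 \<Longrightarrow> measure \<nu> {x} = 1 \<Longrightarrow> False"
  shows "simple_pm (madd \<mu> \<nu>)"
proof -
  have \<mu>: "finite_measure \<mu>" "sets \<mu> = sets borel" and \<nu>: "finite_measure \<nu>" "sets \<nu> = sets borel"
    using fin by (auto simp: space_finms)
  define A where "A = {x. measure \<mu> {x} = 1} \<union> {x. measure \<nu> {x} = 1}"
  have "finite A"
    unfolding A_def using finite_unit_atoms[OF \<mu>] finite_unit_atoms[OF \<nu>] by simp
  then have [measurable]: "A \<in> sets borel"
    by (simp add: borel_closed finite_imp_closed)
  then have nA: "- A \<in> sets borel" by simp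
  have one: "measure (madd \<mu> \<nu>) {x} = 1" if "x \<in> A" for x
    using that disj[of x] simple_pm_point[OF \<mu> simp(1), of x] simple_pm_point[OF \<nu> simp(2), of x]
    by (auto simp: A_def measure_madd[OF fin])
  have "{x \<in> - A. measure \<mu> {x} = 1} = {}" "{x \<in> - A. measure \<nu> {x} = 1} = {}"
    by (auto simp: A_def)
  then have "measure \<mu> (- A) = 0" "measure \<nu> (- A) = 0"
    using simple_pm_measure_eq_card[OF \<mu> simp(1) nA] simple_pm_measure_eq_card[OF \<nu> simp(2) nA]
    by (simp_all only: card.empty of_nat_0)
  then have "measure (madd \<mu> \<nu>) (- A) = 0"
    using nA by (simp add: measure_madd[OF fin])
  moreover have "finite_measure (madd \<mu> \<nu>)"
    using madd_in_space[OF fin] by (simp add: space_finms)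
  ultimately have "emeasure (madd \<mu> \<nu>) (- A) = 0"
    by (simp add: finite_measure.emeasure_eq_measure)
  then show ?thesis
    unfolding simple_pm_def using nA one
    by (intro AE_I[of _ _ "- A"]) auto
qed

section \<open>Finitely many independent points\<close>

lemma return_in_finms: "return borel y \<in> space finms"
  by (simp add: space_finms prob_space_return prob_space.finite_measure)

lemma measurable_return_finms: "return borel \<in> measurable borel finms"
  by (rule measurable_finite_measures)
     (auto simp: prob_space_return prob_space.finite_measure)

lemma null_in_finms: "null_measure borel \<in> space finms"
  by (auto simp: space_finms intro: finite_measureI)

text \<open>The binomial point process: the law of the sum of n unit masses at independent points
  with law m. Adding one fresh point per step needs only products of two factors and makes induction
  on n available.\<close>

primrec iid_points_law :: "'x::topological_space measure \<Rightarrow> nat \<Rightarrow> 'x measure measure" where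
  "iid_points_law m 0 = return finms (null_measure borel)"
| "iid_points_law m (Suc n) = distr (iid_points_law m n \<Otimes>\<^sub>M m) finms (\<lambda>(\<mu>, y). madd \<mu> (return borel y))"

lemma measurable_add_point:
  assumes "sets m = sets (borel :: 'x::topological_space measure)"
  shows "(\<lambda>(\<mu>, y). madd \<mu> (return borel y)) \<in> measurable (finms \<Otimes>\<^sub>M m) (finms :: 'x measure measure)"
proof -
  have "return borel \<in> measurable m (finms :: 'x measure measure)"
    using measurable_return_finms assms by (simp cong: measurable_cong_sets)
  from measurable_compose[OF measurable_snd this] show ?thesis
    unfolding split_beta' by (intro measurable_madd) auto
qed

lemma sets_iid_points_law[simp, measurable_cong]: "sets (iid_points_law m n) = sets finms"
  by (cases n) auto

lemma prob_space_iid_points_law: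
  assumes m: "prob_space m" "sets m = sets (borel :: 'x::topological_space measure)"
  shows "prob_space (iid_points_law m n)"
proof (induction n)
  case 0
  then show ?case by (simp add: prob_space_return null_in_finms)
next
  case (Suc n)
  interpret m: prob_space m by fact
  interpret D: prob_space "iid_points_law m n" by fact
  interpret pair_prob_space "iid_points_law m n" m ..
  show ?case
    using measurable_add_point[OF m(2)]
    by (auto intro!: prob_space_distr simp: measurable_cong_sets[OF sets_pair_measure_cong[OF sets_iid_points_law refl] refl])
qed

context
  fixes m :: "'x::{metric_space, second_countable_topology} measure"
  assumes m: "prob_space m" "sets m = sets borel"
begin

interpretation m: prob_space m by (rule m)

lemma space_m: "space m = UNIV"
  using sets_eq_imp_space_eq[OF m(2)] by simp

lemma add_point_measurable: "(\<lambda>(\<mu>, y). madd \<mu> (return borel y)) \<in> measurable (iid_points_law m n \<Otimes>\<^sub>M m) finms"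
  using measurable_add_point[OF m(2)]
  by (simp add: measurable_cong_sets[OF sets_pair_measure_cong[OF sets_iid_points_law refl] refl])

definition "occ J Bs k = {\<mu> \<in> space finms. \<forall>j\<in>J. measure \<mu> (Bs j) = real (k j)}"
  for J :: "'i set" and Bs :: "'i \<Rightarrow> 'x set" and k :: "'i \<Rightarrow> nat"

lemma sets_occ:
  assumes "finite J" and [measurable]: "\<And>j. j \<in> J \<Longrightarrow> Bs j \<in> sets borel"
  shows "occ J Bs k \<in> sets finms"
  unfolding occ_def using assms(1) by measurable

text \<open>The multinomial distribution of occupation numbers over a finite partition. The
  induction step splits according to the cell of the last point: before it, that cell held one point
  fewer.\<close>

lemma iid_points_law_occ:
  assumes J: "finite J" and Bs: "\<And>j. j \<in> J \<Longrightarrow> Bs j \<in> sets borel"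
    and disj: "disjoint_family_on Bs J" and cover: "(\<Union>j\<in>J. Bs j) = UNIV"
  shows "measure (iid_points_law m n) (occ J Bs k)
    = (if sum k J = n then fact n / (\<Prod>j\<in>J. fact (k j)) * (\<Prod>j\<in>J. measure m (Bs j) ^ k j) else 0)"
proof (induction n arbitrary: k)
  case 0
  have "measure (iid_points_law m 0) (occ J Bs k) = indicator (occ J Bs k) (null_measure borel)"
    using sets_occ[OF J Bs] by (simp add: measure_return)
  also have "\<dots> = (if sum k J = 0 then 1 else 0)"
    using J null_in_finms by (auto simp: occ_def indicator_def sum_eq_0_iff)
  finally show ?case
    using J by (auto simp: sum_eq_0_iff)
next
  case (Suc n)
  let ?D = "iid_points_law m n"
  interpret D: prob_space ?D by (rule prob_space_iid_points_law[OF m])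
  interpret pair_prob_space ?D m ..
  \<comment> \<open>One point fewer in cell i. Subtraction is truncated, so the case
    \<open>k i = 0\<close>, where the last point cannot lie in cell i, is given the empty event in
    \<open>E\<close>.\<close>
  let ?k = "\<lambda>i. k(i := k i - 1)"
  define E where "E i = (if k i = 0 then {} else occ J Bs (?k i))" for i
  have E: "E i \<in> sets ?D" for i
    using sets_occ[OF J Bs] by (simp add: E_def)
  have Bm: "Bs i \<in> sets m" if "i \<in> J" for i
    using Bs m(2) that by auto
  have EB: "E i \<times> Bs i \<in> sets (?D \<Otimes>\<^sub>M m)" if "i \<in> J" for i
    using E Bm that by (intro pair_measureI) auto
  have pre: "(\<lambda>(\<mu>, y). madd \<mu> (return borel y)) -` occ J Bs k \<inter> space (?D \<Otimes>\<^sub>M m) = (\<Union>i\<in>J. E i \<times> Bs i)"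
  proof (intro set_eqI)
    fix p :: "'x measure \<times> 'x"
    obtain \<mu> y where p[simp]: "p = (\<mu>, y)" by (cases p)
    obtain i where i: "i \<in> J" "y \<in> Bs i"
      using cover by blast
    have i': "j = i" if "j \<in> J" "y \<in> Bs j" for j
      using disj i that unfolding disjoint_family_on_def by blast
    have "p \<in> (\<Union>i\<in>J. E i \<times> Bs i) \<longleftrightarrow> (\<exists>j\<in>J. \<mu> \<in> E j \<and> y \<in> Bs j)"
      by simp
    also have "\<dots> \<longleftrightarrow> \<mu> \<in> E i"
      using i i' by blast
    also have "\<dots> \<longleftrightarrow> k i \<noteq> 0 \<and> \<mu> \<in> space finms \<and> (\<forall>j\<in>J. measure \<mu> (Bs j) = real (?k i j))"
      by (simp add: occ_def E_def)
    also have "\<dots> \<longleftrightarrow> \<mu> \<in> space finms \<and> (\<forall>j\<in>J. measure \<mu> (Bs j) + indicator (Bs j) y = real (k j))"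
    proof (rule iffI)
      assume *: "k i \<noteq> 0 \<and> \<mu> \<in> space finms \<and> (\<forall>j\<in>J. measure \<mu> (Bs j) = real (?k i j))"
      have "measure \<mu> (Bs j) + indicator (Bs j) y = real (k j)" if "j \<in> J" for j
      proof -
        have mj: "measure \<mu> (Bs j) = real (?k i j)" and ki: "k i \<noteq> 0"
          using * that by blast+
        show ?thesis
        proof (cases "j = i")
          case True
          then show ?thesis using mj ki i by (simp add: of_nat_diff)
        next
          case False
          then have "y \<notin> Bs j" using i' that by blast
          then show ?thesis using mj False by simp
        qed
      qed
      then show "\<mu> \<in> space finms \<and> (\<forall>j\<in>J. measure \<mu> (Bs j) + indicator (Bs j) y = real (k j))"
        using * by blast
    next
      assume *: "\<mu> \<in> space finms \<and> (\<forall>j\<in>J. measure \<mu> (Bs j) + indicator (Bs j) y = real (k j))"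
      then have "measure \<mu> (Bs i) + indicator (Bs i) y = real (k i)"
        using i(1) by blast
      then have ki: "measure \<mu> (Bs i) + 1 = real (k i)"
        using i(2) by simp
      then have "k i \<noteq> 0"
        using measure_nonneg[of \<mu> "Bs i"] by (cases "k i = 0") auto
      moreover have "measure \<mu> (Bs j) = real (?k i j)" if "j \<in> J" for j
      proof (cases "j = i")
        case True
        then show ?thesis using ki \<open>k i \<noteq> 0\<close> by (simp add: of_nat_diff)
      next
        case False
        then have "y \<notin> Bs j" using i' that by blast
        moreover have "measure \<mu> (Bs j) + indicator (Bs j) y = real (k j)"
          using * that by blast
        ultimately show ?thesis using False by simp
      qed
      ultimately show "k i \<noteq> 0 \<and> \<mu> \<in> space finms \<and> (\<forall>j\<in>J. measure \<mu> (Bs j) = real (?k i j))"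
        using * by blast
    qed
    also have "\<dots> \<longleftrightarrow> p \<in> (\<lambda>(\<mu>, y). madd \<mu> (return borel y)) -` occ J Bs k \<inter> space (?D \<Otimes>\<^sub>M m)"
      using Bs madd_in_space[OF _ return_in_finms, of \<mu> y] sets_eq_imp_space_eq[OF sets_iid_points_law, of m n]
      by (auto simp: occ_def space_pair_measure space_m measure_madd[OF _ return_in_finms] measure_return)
    finally show "p \<in> (\<lambda>(\<mu>, y). madd \<mu> (return borel y)) -` occ J Bs k \<inter> space (?D \<Otimes>\<^sub>M m)
        \<longleftrightarrow> p \<in> (\<Union>i\<in>J. E i \<times> Bs i)" by simp
  qed
  have "measure (iid_points_law m (Suc n)) (occ J Bs k) = measure (?D \<Otimes>\<^sub>M m) (\<Union>i\<in>J. E i \<times> Bs i)"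
    using sets_occ[OF J Bs] by (simp only: iid_points_law.simps measure_distr[OF add_point_measurable] pre)
  also have "\<dots> = (\<Sum>i\<in>J. measure (?D \<Otimes>\<^sub>M m) (E i \<times> Bs i))"
    using J EB disj by (intro P.finite_measure_finite_Union) (auto simp: disjoint_family_on_def)
  \<comment> \<open>Relative to the target with \<open>fact (Suc n)\<close>, the i-th summand
    carries \<open>fact n\<close> and an extra factor \<open>k i\<close>. These factors sum to
    \<open>Suc n\<close>, which restores the factorial.\<close>
  also have "\<dots> = (\<Sum>i\<in>J. (if sum k J = Suc n
      then fact n / (\<Prod>j\<in>J. fact (k j)) * (\<Prod>j\<in>J. measure m (Bs j) ^ k j) else 0) * real (k i))"
  proof (rule sum.cong[OF refl])
    fix i assume i: "i \<in> J"
    have "emeasure (?D \<Otimes>\<^sub>M m) (E i \<times> Bs i) = emeasure ?D (E i) * emeasure m (Bs i)"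
      using E Bm[OF i] by (intro m.emeasure_pair_measure_Times)
    then have 1: "measure (?D \<Otimes>\<^sub>M m) (E i \<times> Bs i) = measure ?D (E i) * measure m (Bs i)"
      by (simp add: measure_def enn2real_mult)
    show "measure (?D \<Otimes>\<^sub>M m) (E i \<times> Bs i) = (if sum k J = Suc n
      then fact n / (\<Prod>j\<in>J. fact (k j)) * (\<Prod>j\<in>J. measure m (Bs j) ^ k j) else 0) * real (k i)"
    proof (cases "k i = 0")
      case True
      then show ?thesis unfolding 1 by (simp add: E_def)
    next
      case False
      then obtain q where q: "k i = Suc q" by (cases "k i") auto
      let ?J = "J - {i}"
      have split: "sum (?k i) J = q + sum k ?J" "sum k J = Suc q + sum k ?J"
        "(\<Prod>j\<in>J. fact (?k i j) :: real) = fact q * (\<Prod>j\<in>?J. fact (k j))"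
        "(\<Prod>j\<in>J. fact (k j) :: real) = fact (Suc q) * (\<Prod>j\<in>?J. fact (k j))"
        "(\<Prod>j\<in>J. measure m (Bs j) ^ ?k i j) = measure m (Bs i) ^ q * (\<Prod>j\<in>?J. measure m (Bs j) ^ k j)"
        "(\<Prod>j\<in>J. measure m (Bs j) ^ k j) = measure m (Bs i) ^ Suc q * (\<Prod>j\<in>?J. measure m (Bs j) ^ k j)"
        by (simp_all only: sum.remove[OF J i] prod.remove[OF J i] q fun_upd_same diff_Suc_1 power_Suc)
           (simp_all add: q cong: sum.cong_simp prod.cong_simp)
      have "(\<Prod>j\<in>?J. fact (k j) :: real) \<noteq> 0"
        using J by simp
      moreover have "measure ?D (E i) = (if sum (?k i) J = n then fact n / (\<Prod>j\<in>J. fact (?k i j))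
          * (\<Prod>j\<in>J. measure m (Bs j) ^ ?k i j) else 0)"
        by (simp only: E_def False if_False Suc.IH)
      moreover obtain r where r: "real (Suc q) = r" "r \<noteq> 0" "fact (Suc q) = r * fact q"
        by (simp add: fact_Suc del: of_nat_Suc)
      ultimately show ?thesis
        unfolding 1 split unfolding q r by (simp add: field_simps)
    qed
  qed
  also have "\<dots> = (if sum k J = Suc n
      then fact (Suc n) / (\<Prod>j\<in>J. fact (k j)) * (\<Prod>j\<in>J. measure m (Bs j) ^ k j) else 0)"
    by (simp add: sum_distrib_left[symmetric] of_nat_sum[symmetric] del: of_nat_sum)
  finally show ?case .
qed

text \<open>A fresh point with a diffuse law almost surely avoids the finitely many atoms already
  present, so no mass exceeds 1.\<close>

lemma AE_iid_points_law_simple: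
  assumes diffuse: "\<And>x. measure m {x} = 0"
  shows "AE \<mu> in iid_points_law m n. simple_pm \<mu>"
proof (induction n)
  case 0
  have "simple_pm (null_measure borel :: 'x measure)"
    by (auto simp: simple_pm_def intro: AE_I[where N=UNIV])
  then show ?case
    unfolding iid_points_law.simps AE_return[OF null_in_finms sets_finms_simple_pm] .
next
  case (Suc n)
  let ?D = "iid_points_law m n"
  interpret D: prob_space ?D by (rule prob_space_iid_points_law[OF m])
  interpret pair_prob_space ?D m ..
  have "AE p in ?D \<Otimes>\<^sub>M m. simple_pm (case p of (\<mu>, y) \<Rightarrow> madd \<mu> (return borel y))"
  proof (rule AE_pair_measure)
    show "{p \<in> space (?D \<Otimes>\<^sub>M m). simple_pm (case p of (\<mu>, y) \<Rightarrow> madd \<mu> (return borel y))} \<in> sets (?D \<Otimes>\<^sub>M m)"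
      using measurable_compose[OF add_point_measurable sets_finms_simple_pm] by (simp add: pred_def)
    show "AE \<mu> in ?D. AE y in m. simple_pm (case (\<mu>, y) of (\<mu>, y) \<Rightarrow> madd \<mu> (return borel y))"
      using Suc AE_space
    proof eventually_elim
      case (elim \<mu>)
      then have \<mu>: "\<mu> \<in> space finms" "finite_measure \<mu>" "sets \<mu> = sets borel" "simple_pm \<mu>"
        using sets_eq_imp_space_eq[OF sets_iid_points_law, of m n] by (auto simp: space_finms)
      have fin: "finite {x. measure \<mu> {x} = 1}"
        by (rule finite_unit_atoms[OF \<mu>(2,3)])
      have "measure m {x. measure \<mu> {x} = 1} = (\<Sum>x\<in>{x. measure \<mu> {x} = 1}. measure m {x})"
        using fin m(2) by (intro m.finite_measure_eq_sum_singleton) auto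
      then have "emeasure m {x. measure \<mu> {x} = 1} = 0"
        by (simp add: diffuse m.emeasure_eq_measure)
      moreover have "{x. measure \<mu> {x} = 1} \<in> sets m"
        using fin m(2) by (simp add: borel_closed finite_imp_closed)
      ultimately have "AE y in m. measure \<mu> {y} \<noteq> 1"
        by (intro AE_I[of _ _ "{x. measure \<mu> {x} = 1}"]) auto
      then show ?case
      proof eventually_elim
        case (elim y)
        have ret: "measure (return borel y) {x} = indicator {x} y" for x
          by (simp add: measure_return)
        have "simple_pm (return borel y)"
          unfolding simple_pm_def by (subst AE_return) (auto simp: ret)
        moreover have "measure \<mu> {x} = 1 \<Longrightarrow> measure (return borel y) {x} = 1 \<Longrightarrow> False" for x
          using elim by (auto simp: ret indicator_def split: if_splits)
        ultimately show ?case
          unfolding prod.case by (rule simple_pm_madd[OF \<mu>(1) return_in_finms \<mu>(4)])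
      qed
    qed
  qed
  then show ?case
    unfolding iid_points_law.simps
    using AE_distr_iff[OF add_point_measurable, of simple_pm n] sets_finms_simple_pm
    by (simp add: pred_def)
qed

section \<open>Poisson random measures as mixed binomial processes\<close>

definition "poisson_law \<theta> = measure_pmf (poisson_pmf \<theta>) \<bind> iid_points_law m"

context
  fixes \<theta> :: real
  assumes \<theta>: "0 < \<theta>"
begin

lemma iid_points_law_measurable: "iid_points_law m \<in> measurable (measure_pmf (poisson_pmf \<theta>)) (subprob_algebra finms)"
  using prob_space_iid_points_law[OF m] prob_space_imp_subprob_space
  by (auto simp: space_subprob_algebra)

lemma sets_poisson_law[simp, measurable_cong]: "sets (poisson_law \<theta>) = sets finms"
  unfolding poisson_law_def by (rule sets_bind) auto

lemma space_poisson_law[simp]: "space (poisson_law \<theta>) = space finms"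
  by (rule sets_eq_imp_space_eq) simp

lemma prob_space_poisson_law: "prob_space (poisson_law \<theta>)"
  unfolding poisson_law_def
  by (rule measure_pmf.prob_space_bind[OF _ iid_points_law_measurable])
     (simp add: prob_space_iid_points_law[OF m])

lemma AE_poisson_law_simple:
  assumes diffuse: "\<And>x. measure m {x} = 0"
  shows "AE \<mu> in poisson_law \<theta>. simple_pm \<mu>"
  unfolding poisson_law_def
  by (subst AE_bind[OF iid_points_law_measurable]) (auto simp: AE_iid_points_law_simple[OF diffuse] sets_finms_simple_pm)

text \<open>A partition forces the number of points to be the sum of the occupation numbers, so only
  one term of the mixture survives. The factorials cancel, and \<open>exp (- \<theta>)\<close>
  splits into factors because the cells have total probability 1 under m. What remains is a product
  of Poisson weights, hence independence.\<close>

lemma poisson_law_occ_cover: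
  assumes J: "finite J" and Bs: "\<And>j. j \<in> J \<Longrightarrow> Bs j \<in> sets borel"
    and disj: "disjoint_family_on Bs J" and cover: "(\<Union>j\<in>J. Bs j) = UNIV"
  shows "measure (poisson_law \<theta>) (occ J Bs k) = (\<Prod>j\<in>J. poisson_prob (\<theta> * measure m (Bs j)) (k j))"
proof -
  let ?n = "sum k J"
  let ?c = "fact ?n / (\<Prod>j\<in>J. fact (k j)) * (\<Prod>j\<in>J. measure m (Bs j) ^ k j)"
  have c: "0 \<le> ?c"
    by (intro mult_nonneg_nonneg divide_nonneg_nonneg prod_nonneg) auto
  interpret P: prob_space "poisson_law \<theta>" by (rule prob_space_poisson_law)
  have "emeasure (poisson_law \<theta>) (occ J Bs k)
      = (\<integral>\<^sup>+n. emeasure (iid_points_law m n) (occ J Bs k) \<partial>measure_pmf (poisson_pmf \<theta>))"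
    unfolding poisson_law_def
    by (rule emeasure_bind[OF _ iid_points_law_measurable sets_occ[OF J Bs]]) auto
  also have "\<dots> = (\<integral>\<^sup>+n. ennreal ?c * indicator {?n} n \<partial>measure_pmf (poisson_pmf \<theta>))"
  proof (rule nn_integral_cong)
    fix n
    interpret D: prob_space "iid_points_law m n" by (rule prob_space_iid_points_law[OF m])
    show "emeasure (iid_points_law m n) (occ J Bs k) = ennreal ?c * indicator {?n} n"
      using iid_points_law_occ[OF J Bs disj cover, of n k]
      by (auto simp: D.emeasure_eq_measure indicator_def)
  qed
  also have "\<dots> = ennreal ?c * ennreal (pmf (poisson_pmf \<theta>) ?n)"
    by (subst nn_integral_cmult_indicator) (auto simp: emeasure_pmf_single)
  also have "\<dots> = ennreal (?c * pmf (poisson_pmf \<theta>) ?n)"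
    using c by (intro ennreal_mult[symmetric]) auto
  finally have "measure (poisson_law \<theta>) (occ J Bs k) = ?c * pmf (poisson_pmf \<theta>) ?n"
    unfolding P.emeasure_eq_measure
    using mult_nonneg_nonneg[OF c pmf_nonneg[of "poisson_pmf \<theta>" ?n]] by (simp only: ennreal_inj measure_nonneg)
  also have "\<dots> = (\<Prod>j\<in>J. measure m (Bs j) ^ k j) / (\<Prod>j\<in>J. fact (k j)) * \<theta> ^ ?n * exp (- \<theta>)"
    using \<theta> by simp
  also have "exp (- \<theta>) = (\<Prod>j\<in>J. exp (- (\<theta> * measure m (Bs j))))"
  proof -
    have "(\<Sum>j\<in>J. measure m (Bs j)) = measure m (\<Union>j\<in>J. Bs j)"
      using J Bs disj m(2) by (intro m.finite_measure_finite_Union[symmetric]) auto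
    also have "\<dots> = 1"
      using cover space_m m.prob_space by simp
    finally show ?thesis
      using J by (simp add: exp_sum[symmetric] sum_negf sum_distrib_left[symmetric])
  qed
  also have "\<theta> ^ ?n = (\<Prod>j\<in>J. \<theta> ^ k j)"
    by (rule power_sum)
  finally show ?thesis
    by (simp add: prod.distrib prod_dividef power_mult_distrib)
qed

text \<open>The family is completed to a partition by a cell z, the complement, and the occupation
  number of that cell is summed out. The sum exhausts the event because almost every realisation is
  simple, so that its mass on the extra cell is a natural number.\<close>

lemma poisson_law_occ:
  fixes J :: "nat set"
  assumes diffuse: "\<And>x. measure m {x} = 0"
    and J: "finite J" and Bs: "\<And>j. j \<in> J \<Longrightarrow> Bs j \<in> sets borel"
    and disj: "disjoint_family_on Bs J"
  shows "measure (poisson_law \<theta>) (occ J Bs k) = (\<Prod>j\<in>J. poisson_prob (\<theta> * measure m (Bs j)) (k j))"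
proof -
  interpret P: prob_space "poisson_law \<theta>" by (rule prob_space_poisson_law)
  obtain z where z: "z \<notin> J"
    using ex_new_if_finite[OF infinite_UNIV_nat J] by blast
  define B' where "B' = Bs(z := - (\<Union>j\<in>J. Bs j))"
  have B'J: "B' j = Bs j" if "j \<in> J" for j
    using that z by (auto simp: B'_def)
  have B'[measurable]: "B' j \<in> sets borel" if "j \<in> insert z J" for j
  proof (cases "j = z")
    case True
    have "(\<Union>j\<in>J. Bs j) \<in> sets borel"
      using Bs J by (intro sets.finite_UN) auto
    then show ?thesis
      using True by (simp only: B'_def fun_upd_same borel_comp)
  next
    case False
    then show ?thesis using that Bs by (simp add: B'_def)
  qed
  have disj': "disjoint_family_on B' (insert z J)"
    using disj z by (auto simp: disjoint_family_on_def B'_def)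
  have cover': "(\<Union>j\<in>insert z J. B' j) = UNIV"
    using z by (auto simp: B'_def)
  let ?k = "\<lambda>q. k(z := q)"
  have occ: "occ (insert z J) B' (?k q) = {\<mu> \<in> occ J Bs k. measure \<mu> (B' z) = real q}" for q
    using z B'J by (auto simp: occ_def)
  have "(\<lambda>q. measure (poisson_law \<theta>) (occ (insert z J) B' (?k q)))
      sums measure (poisson_law \<theta>) (\<Union>q. occ (insert z J) B' (?k q))"
  proof (rule P.finite_measure_UNION)
    show "range (\<lambda>q. occ (insert z J) B' (?k q)) \<subseteq> P.events"
      using sets_occ[of "insert z J" B'] J B' by auto
    show "disjoint_family (\<lambda>q. occ (insert z J) B' (?k q))"
      by (auto simp: disjoint_family_on_def occ)
  qed
  moreover have "measure (poisson_law \<theta>) (\<Union>q. occ (insert z J) B' (?k q)) = measure (poisson_law \<theta>) (occ J Bs k)"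
  proof (rule P.finite_measure_eq_AE)
    show "AE \<mu> in poisson_law \<theta>. \<mu> \<in> (\<Union>q. occ (insert z J) B' (?k q)) \<longleftrightarrow> \<mu> \<in> occ J Bs k"
      using AE_poisson_law_simple[OF diffuse] AE_space
    proof eventually_elim
      case (elim \<mu>)
      then have "measure \<mu> (B' z) = real (card {x \<in> B' z. measure \<mu> {x} = 1})"
        by (intro simple_pm_measure_eq_card) (auto simp: space_finms B')
      then show ?case
        by (auto simp: occ)
    qed
    show "(\<Union>q. occ (insert z J) B' (?k q)) \<in> sets (poisson_law \<theta>)" "occ J Bs k \<in> sets (poisson_law \<theta>)"
      using sets_occ[of "insert z J" B'] sets_occ[of J Bs] J B' Bs by auto
  qed
  moreover have "measure (poisson_law \<theta>) (occ (insert z J) B' (?k q))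
      = (\<Prod>j\<in>J. poisson_prob (\<theta> * measure m (Bs j)) (k j)) * poisson_prob (\<theta> * measure m (B' z)) q" for q
  proof -
    have "(\<Prod>j\<in>J. poisson_prob (\<theta> * measure m (B' j)) (?k q j)) = (\<Prod>j\<in>J. poisson_prob (\<theta> * measure m (Bs j)) (k j))"
      using z B'J by (intro prod.cong) auto
    then show ?thesis
      using poisson_law_occ_cover[OF _ B' disj' cover', of "?k q"] J z by simp
  qed
  ultimately have "(\<lambda>q. (\<Prod>j\<in>J. poisson_prob (\<theta> * measure m (Bs j)) (k j)) * poisson_prob (\<theta> * measure m (B' z)) q)
      sums measure (poisson_law \<theta>) (occ J Bs k)"
    by (simp only:)
  moreover have "(\<lambda>q. (\<Prod>j\<in>J. poisson_prob (\<theta> * measure m (Bs j)) (k j)) * poisson_prob (\<theta> * measure m (B' z)) q)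
      sums ((\<Prod>j\<in>J. poisson_prob (\<theta> * measure m (Bs j)) (k j)) * 1)"
    by (intro sums_mult poisson_sums)
  ultimately show ?thesis
    using sums_unique2 by (simp only: mult_1_right)
qed

end

end

text \<open>For variables with natural values the product formula on joint point events is enough:
  the events {Z = k} of one variable generate its sigma-field.\<close>

lemma (in prob_space) indep_vars_nat_valuedI:
  fixes Z :: "'i \<Rightarrow> 'a \<Rightarrow> real"
  assumes Z[measurable]: "\<And>i. i \<in> I \<Longrightarrow> Z i \<in> borel_measurable M"
    and nat: "\<And>i \<omega>. i \<in> I \<Longrightarrow> \<omega> \<in> space M \<Longrightarrow> Z i \<omega> \<in> range real"
    and prod: "\<And>J k. J \<subseteq> I \<Longrightarrow> finite J \<Longrightarrow> prob {\<omega>\<in>space M. \<forall>j\<in>J. Z j \<omega> = real (k j)}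
      = (\<Prod>j\<in>J. prob {\<omega>\<in>space M. Z j \<omega> = real (k j)})"
  shows "indep_vars (\<lambda>_. borel) Z I"
proof -
  \<comment> \<open>Two different point events of one variable are disjoint; adding the empty set
    makes the family stable under intersection.\<close>
  let ?F = "\<lambda>i. insert {} (range (\<lambda>k. {\<omega>\<in>space M. Z i \<omega> = real k}))"
  have F: "?F i \<subseteq> events" if "i \<in> I" for i
    using Z[OF that] by auto
  have "indep_sets ?F I"
  proof (rule indep_setsI)
    fix A J assume J: "J \<noteq> {}" "J \<subseteq> I" "finite J" and A: "\<forall>j\<in>J. A j \<in> ?F j"
    show "prob (\<Inter>j\<in>J. A j) = (\<Prod>j\<in>J. prob (A j))"
    proof (cases "\<exists>j\<in>J. A j = {}")
      case True
      then obtain j where j: "j \<in> J" "A j = {}" by blast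
      then have "(\<Inter>j\<in>J. A j) = {}" by blast
      moreover have "(\<Prod>j\<in>J. prob (A j)) = 0"
        using J(3) j by (intro prod_zero bexI[of _ j]) simp_all
      ultimately show ?thesis by simp
    next
      case False
      then have "\<forall>j\<in>J. \<exists>k. A j = {\<omega>\<in>space M. Z j \<omega> = real k}"
        using A by (simp add: image_iff)
      from bchoice[OF this] obtain k where k: "\<And>j. j \<in> J \<Longrightarrow> A j = {\<omega>\<in>space M. Z j \<omega> = real (k j)}"
        by blast
      then have "(\<Inter>j\<in>J. A j) = {\<omega>\<in>space M. \<forall>j\<in>J. Z j \<omega> = real (k j)}"
        using J by auto
      then show ?thesis
        using prod[OF J(2,3), of k] k by simp
    qed
  qed (rule F)
  then have "indep_sets (\<lambda>i. sigma_sets (space M) (?F i)) I"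
    by (rule indep_sets_sigma) (auto simp: Int_stable_def)
  then have "indep_sets (\<lambda>i. {Z i -` A \<inter> space M | A. A \<in> sets borel}) I"
  proof (rule indep_sets_mono_sets)
    fix i assume i: "i \<in> I"
    show "{Z i -` A \<inter> space M | A. A \<in> sets borel} \<subseteq> sigma_sets (space M) (?F i)"
    proof
      fix X assume "X \<in> {Z i -` A \<inter> space M | A. A \<in> sets borel}"
      then obtain A where X: "X = Z i -` A \<inter> space M" by auto
      have "X = (\<Union>k. if real k \<in> A then {\<omega>\<in>space M. Z i \<omega> = real k} else {})"
      proof (intro set_eqI iffI)
        fix \<omega> assume \<omega>: "\<omega> \<in> X"
        then obtain k where "Z i \<omega> = real k"
          using nat[OF i, of \<omega>] by (auto simp: X)
        with \<omega> show "\<omega> \<in> (\<Union>k. if real k \<in> A then {\<omega>\<in>space M. Z i \<omega> = real k} else {})"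
          by (intro UN_I[of k]) (simp_all add: X)
      qed (auto simp: X split: if_splits)
      also have "\<dots> \<in> sigma_sets (space M) (?F i)"
        by (rule sigma_sets.Union) (auto intro: sigma_sets.Basic sigma_sets.Empty)
      finally show "X \<in> sigma_sets (space M) (?F i)" .
    qed
  qed
  then show ?thesis
    unfolding indep_vars_def2 using Z by auto
qed

text \<open>Encodes the selected points of S as a measure, since the Bernoulli component has to live
  on a space of measures. Each selected point gets mass 1; a value of \<open>v\<close> other than 1
  counts as not selected.\<close>

definition bern_meas :: "'x::topological_space set \<Rightarrow> ('x \<Rightarrow> real) \<Rightarrow> 'x measure" where
  "bern_meas S v = distr (count_space {x\<in>S. v x = 1}) borel (\<lambda>x. x)"

lemma sets_bern_meas[simp]: "sets (bern_meas S v) = sets borel"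
  by (simp add: bern_meas_def)

lemma emeasure_bern_meas:
  assumes S: "finite S" and A: "A \<in> sets borel"
  shows "emeasure (bern_meas S v) A = ennreal (\<Sum>x\<in>S \<inter> A. if v x = 1 then 1 else 0)"
proof -
  have "emeasure (bern_meas S v) A = emeasure (count_space {x\<in>S. v x = 1}) {x\<in>S \<inter> A. v x = 1}"
    unfolding bern_meas_def using A
    by (subst emeasure_distr) (auto simp: measurable_count_space_eq1 intro!: arg_cong2[where f=emeasure])
  also have "\<dots> = ennreal (real (card {x\<in>S \<inter> A. v x = 1}))"
    using S by (subst emeasure_count_space_finite) (auto simp: ennreal_of_nat_eq_real_of_nat)
  also have "real (card {x\<in>S \<inter> A. v x = 1}) = (\<Sum>x\<in>S \<inter> A. if v x = 1 then 1 else 0)"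
    using S by (simp add: sum.inter_filter[symmetric])
  finally show ?thesis .
qed

lemma measure_bern_meas:
  assumes "finite S" "A \<in> sets borel"
  shows "measure (bern_meas S v) A = (\<Sum>x\<in>S \<inter> A. if v x = 1 then 1 else 0)"
  unfolding measure_def emeasure_bern_meas[OF assms] by (simp add: sum_nonneg)

lemma bern_meas_in_space: "finite S \<Longrightarrow> bern_meas S v \<in> space finms"
  using sets_eq_imp_space_eq[OF sets_bern_meas, of S v]
  by (simp add: space_finms emeasure_bern_meas finite_measureI)

lemma measure_bern_meas_point:
  fixes S :: "'x::t1_space set"
  assumes "finite S"
  shows "measure (bern_meas S v) {x} = (if x \<in> S \<and> v x = 1 then 1 else 0)"
  using assms by (cases "x \<in> S") (auto simp: measure_bern_meas)

lemma simple_pm_bern_meas: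
  fixes S :: "'x::t1_space set"
  assumes S: "finite S"
  shows "simple_pm (bern_meas S v)"
proof -
  let ?N = "- {x\<in>S. v x = 1}"
  have "finite {x\<in>S. v x = 1}" using S by simp
  then have N: "?N \<in> sets borel"
    by (intro borel_comp borel_closed finite_imp_closed)
  have "(\<Sum>x\<in>S \<inter> ?N. if v x = 1 then 1 else 0) = (0::real)"
    by (intro sum.neutral) auto
  then have "emeasure (bern_meas S v) ?N = 0"
    by (simp only: emeasure_bern_meas[OF S N] ennreal_0)
  then show ?thesis
    unfolding simple_pm_def using N measure_bern_meas_point[OF S, of v]
    by (intro AE_I[of _ _ ?N]) auto
qed

lemma measurable_bern_meas:
  fixes v :: "'o \<Rightarrow> 'x::topological_space \<Rightarrow> real"
  assumes S: "finite S" and v: "\<And>x. x \<in> S \<Longrightarrow> (\<lambda>\<omega>. v \<omega> x) \<in> borel_measurable M"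
  shows "(\<lambda>\<omega>. bern_meas S (v \<omega>)) \<in> measurable M finms"
proof (rule measurable_finite_measures)
  fix \<omega> show "finite_measure (bern_meas S (v \<omega>))"
    using bern_meas_in_space[OF S, of "v \<omega>"] by (simp add: space_finms)
next
  fix A :: "'x set" assume A: "A \<in> sets borel"
  have "(\<lambda>\<omega>. if v \<omega> x = 1 then 1 else 0 :: real) \<in> borel_measurable M" if x: "x \<in> S \<inter> A" for x
  proof -
    have [measurable]: "(\<lambda>\<omega>. v \<omega> x) \<in> borel_measurable M" using v x by blast
    show ?thesis by measurable
  qed
  then have "(\<lambda>\<omega>. ennreal (\<Sum>x\<in>S \<inter> A. if v \<omega> x = 1 then 1 else 0)) \<in> borel_measurable M"
    by (intro measurable_compose[OF _ measurable_ennreal] borel_measurable_sum)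
  then show "(\<lambda>\<omega>. emeasure (bern_meas S (v \<omega>)) A) \<in> borel_measurable M"
    by (simp only: emeasure_bern_meas[OF S A])
qed simp

section \<open>The product construction of a Bernoulli random measure\<close>

lemma (in pair_prob_space) measure_Times:
  assumes "A \<in> sets M1" "B \<in> sets M2"
  shows "measure (M1 \<Otimes>\<^sub>M M2) (A \<times> B) = measure M1 A * measure M2 B"
  using M2.emeasure_pair_measure_Times[OF assms] by (simp add: measure_def enn2real_mult)

lemma (in pair_prob_space) indep_set_vimage:
  assumes f: "f \<in> measurable M1 S" and g: "g \<in> measurable M2 T"
  shows "prob_space.indep_set (M1 \<Otimes>\<^sub>M M2)
      (sets (vimage_algebra (space (M1 \<Otimes>\<^sub>M M2)) (\<lambda>\<omega>. f (fst \<omega>)) S))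
      (sets (vimage_algebra (space (M1 \<Otimes>\<^sub>M M2)) (\<lambda>\<omega>. g (snd \<omega>)) T))"
proof -
  have f': "(\<lambda>\<omega>. f (fst \<omega>)) \<in> space (M1 \<Otimes>\<^sub>M M2) \<rightarrow> space S"
    using measurable_space[OF f] by (auto simp: space_pair_measure)
  have g': "(\<lambda>\<omega>. g (snd \<omega>)) \<in> space (M1 \<Otimes>\<^sub>M M2) \<rightarrow> space T"
    using measurable_space[OF g] by (auto simp: space_pair_measure)
  have eq1: "(\<lambda>\<omega>. f (fst \<omega>)) -` A \<inter> space (M1 \<Otimes>\<^sub>M M2) = (f -` A \<inter> space M1) \<times> space M2" for A
    by (auto simp: space_pair_measure)
  have eq2: "(\<lambda>\<omega>. g (snd \<omega>)) -` A \<inter> space (M1 \<Otimes>\<^sub>M M2) = space M1 \<times> (g -` A \<inter> space M2)" for A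
    by (auto simp: space_pair_measure)
  show ?thesis
    unfolding P.indep_sets2_eq sets_vimage_algebra2[OF f'] sets_vimage_algebra2[OF g'] eq1 eq2
  proof (intro conjI ballI subsetI)
    fix X assume "X \<in> {(f -` A \<inter> space M1) \<times> space M2 |A. A \<in> sets S}"
    then show "X \<in> sets (M1 \<Otimes>\<^sub>M M2)"
      using measurable_sets[OF f] by (auto intro!: pair_measureI)
  next
    fix X assume "X \<in> {space M1 \<times> (g -` A \<inter> space M2) |A. A \<in> sets T}"
    then show "X \<in> sets (M1 \<Otimes>\<^sub>M M2)"
      using measurable_sets[OF g] by (auto intro!: pair_measureI)
  next
    fix X Y assume "X \<in> {(f -` A \<inter> space M1) \<times> space M2 |A. A \<in> sets S}"
      "Y \<in> {space M1 \<times> (g -` A \<inter> space M2) |A. A \<in> sets T}"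
    then obtain A B where X: "X = (f -` A \<inter> space M1) \<times> space M2" "A \<in> sets S"
      and Y: "Y = space M1 \<times> (g -` B \<inter> space M2)" "B \<in> sets T"
      by blast
    have XY: "X \<inter> Y = (f -` A \<inter> space M1) \<times> (g -` B \<inter> space M2)"
      unfolding X Y by blast
    have m: "f -` A \<inter> space M1 \<in> sets M1" "g -` B \<inter> space M2 \<in> sets M2"
      using X Y measurable_sets[OF f] measurable_sets[OF g] by auto
    show "P.prob (X \<inter> Y) = P.prob X * P.prob Y"
      unfolding XY unfolding X Y using m by (simp add: measure_Times M1.prob_space M2.prob_space)
  qed
qed

text \<open>The first coordinate of the pair is the Poisson part, the second the encoded Bernoulli
  part, and the product law makes them independent. Independence within each part is then checked on
  counts with natural values.\<close>

lemma BeP_rm_exists: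
  fixes m :: "'x::{metric_space, second_countable_topology} measure"
  assumes m: "prob_space m" "sets m = sets borel" and diffuse: "\<And>x. measure m {x} = 0"
    and \<theta>: "0 < \<theta>" and S: "finite (atoms_of \<nu>)" and le1: "\<And>x. measure \<nu> {x} \<le> 1"
    and dp: "\<And>B. B \<in> sets borel \<Longrightarrow> diffuse_part \<nu> B = \<theta> * measure m B"
  shows "\<exists>(Q :: ('x measure \<times> 'x measure) measure) N. prob_space Q \<and> BeP_rm Q N \<nu> \<and> (AE \<omega> in Q. simple_pm (N \<omega>))"
proof -
  let ?S = "atoms_of \<nu>"
  let ?P = "poisson_law m \<theta>"
  note occ_eq = poisson_law_occ[OF m \<theta> diffuse]
  note occ_def' = occ_def[OF m]
  interpret P1: prob_space ?P by (rule prob_space_poisson_law[OF m \<theta>])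
  note [simp, measurable_cong] = sets_poisson_law[OF m \<theta>]
  note [simp] = space_poisson_law[OF m \<theta>]
  \<comment> \<open>Here \<open>\<beta> x\<close> is the Bernoulli law, on the reals, of the
    indicator at the atom x; it is unrelated to the model parameter.\<close>
  define \<beta> where "\<beta> x = distr (measure_pmf (bernoulli_pmf (measure \<nu> {x}))) borel (of_bool :: bool \<Rightarrow> real)" for x
  have sets_\<beta>[simp, measurable_cong]: "sets (\<beta> x) = sets borel" for x
    by (simp add: \<beta>_def)
  interpret \<beta>: prob_space "\<beta> x" for x
    unfolding \<beta>_def by (rule measure_pmf.prob_space_distr) simp
  interpret W: product_prob_space \<beta> ?S ..
  let ?W = "PiM ?S \<beta>"
  have Tm: "bern_meas ?S \<in> measurable ?W finms"
    using S by (rule measurable_bern_meas) simp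
  let ?D = "distr ?W finms (bern_meas ?S)"
  interpret D: prob_space ?D by (rule W.P.prob_space_distr[OF Tm])
  interpret pair_prob_space ?P ?D ..
  let ?Q = "?P \<Otimes>\<^sub>M ?D"
  have spQ: "\<omega> \<in> space ?Q \<longleftrightarrow> fst \<omega> \<in> space finms \<and> snd \<omega> \<in> space finms" for \<omega>
    by (auto simp: space_pair_measure mem_Times_iff)
  \<comment> \<open>The first coordinate is simple only almost surely. Replacing it by the null
    measure elsewhere makes all its masses natural numbers everywhere, as the independence criterion
    requires, without changing its law.\<close>
  define g where "g \<mu> = (if simple_pm \<mu> then \<mu> else null_measure borel)" for \<mu> :: "'x measure"
  have gm: "g \<in> measurable finms finms"
    unfolding g_def
    by (intro measurable_If sets_finms_simple_pm[unfolded pred_def] measurable_const null_in_finms) simp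
  have simple_g: "simple_pm (g \<mu>)" for \<mu>
    unfolding g_def by (auto simp: simple_pm_def intro: AE_I[where N=UNIV])
  have g_space: "g \<mu> \<in> space finms" if "\<mu> \<in> space finms" for \<mu>
    using gm that by (rule measurable_space)
  \<comment> \<open>Decodes the indicator at x from the second coordinate; comparing with 1 forces
    the values 0 and 1 for every outcome.\<close>
  define h where "h x \<mu> = (if measure \<mu> {x} = 1 then 1 else 0 :: real)" for x and \<mu> :: "'x measure"
  have hm: "h x \<in> borel_measurable finms" for x
    unfolding h_def by measurable
  define N where "N \<omega> = madd (g (fst \<omega>)) (bern_meas ?S (\<lambda>x. h x (snd \<omega>)))" for \<omega> :: "'x measure \<times> 'x measure"
  have fstQ: "fst \<in> measurable ?Q finms" and sndQ: "snd \<in> measurable ?Q finms"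
    using measurable_fst[of ?P ?D] measurable_snd[of ?P ?D] by (simp_all cong: measurable_cong_sets)
  have N1m: "(\<lambda>\<omega>. g (fst \<omega>)) \<in> measurable ?Q finms"
    by (rule measurable_compose[OF fstQ gm])
  have Vm: "(\<lambda>\<omega>. h x (snd \<omega>)) \<in> borel_measurable ?Q" for x
    by (rule measurable_compose[OF sndQ hm])
  have Nm: "N \<in> measurable ?Q finms"
    unfolding N_def by (intro measurable_madd N1m measurable_bern_meas S Vm)
  have V01: "h x \<mu> \<in> {0, 1}" for x \<mu>
    by (simp add: h_def)
  have N_eq: "measure (N \<omega>) B = measure (g (fst \<omega>)) B + (\<Sum>x\<in>?S \<inter> B. h x (snd \<omega>))"
    if "\<omega> \<in> space ?Q" "B \<in> sets borel" for \<omega> B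
  proof -
    have "measure (N \<omega>) B = measure (g (fst \<omega>)) B + measure (bern_meas ?S (\<lambda>x. h x (snd \<omega>))) B"
      unfolding N_def using that spQ by (intro measure_madd g_space bern_meas_in_space S) auto
    also have "measure (bern_meas ?S (\<lambda>x. h x (snd \<omega>))) B = (\<Sum>x\<in>?S \<inter> B. h x (snd \<omega>))"
      unfolding measure_bern_meas[OF S that(2)] by (intro sum.cong) (auto simp: h_def)
    finally show ?thesis .
  qed
  have nat: "measure (g \<mu>) B \<in> range real" if "\<mu> \<in> space finms" "B \<in> sets borel" for \<mu> B
    using simple_pm_measure_eq_card[of "g \<mu>" B] simple_g[of \<mu>] g_space[OF that(1)] that(2)
    by (simp add: space_finms)
  have pois: "measure ?Q {\<omega>\<in>space ?Q. \<forall>j\<in>J. measure (g (fst \<omega>)) (Bs j) = real (k j)}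
      = (\<Prod>j\<in>J. poisson_prob (\<theta> * measure m (Bs j)) (k j))"
    if J: "finite J" and Bs: "\<And>j. j \<in> J \<Longrightarrow> Bs j \<in> sets borel" and disj: "disjoint_family_on Bs J"
    for J :: "nat set" and Bs k
  proof -
    let ?A = "{\<mu>\<in>space finms. \<forall>j\<in>J. measure (g \<mu>) (Bs j) = real (k j)}"
    have A: "?A \<in> sets finms"
    proof (rule sets.sets_Collect_finite_All[OF _ J])
      fix j assume "j \<in> J"
      then have "(\<lambda>\<mu>. measure (g \<mu>) (Bs j)) \<in> borel_measurable finms"
        using Bs by (intro measurable_compose[OF gm measurable_measure_finite_measures])
      then show "{\<mu>\<in>space finms. measure (g \<mu>) (Bs j) = real (k j)} \<in> sets finms"
        by measurable
    qed
    have "{\<omega>\<in>space ?Q. \<forall>j\<in>J. measure (g (fst \<omega>)) (Bs j) = real (k j)} = ?A \<times> space ?D"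
      by (auto simp: space_pair_measure)
    then have "measure ?Q {\<omega>\<in>space ?Q. \<forall>j\<in>J. measure (g (fst \<omega>)) (Bs j) = real (k j)} = measure ?P ?A"
      using A by (simp only: measure_Times[OF _ sets.top] D.prob_space sets_poisson_law[OF m \<theta>] mult_1_right)
    also have "\<dots> = measure ?P (occ J Bs k)"
    proof (rule P1.finite_measure_eq_AE)
      show "AE \<mu> in ?P. \<mu> \<in> ?A \<longleftrightarrow> \<mu> \<in> occ J Bs k"
        using AE_poisson_law_simple[OF m \<theta> diffuse]
        by eventually_elim (simp add: g_def occ_def')
    qed (use A sets_occ[OF m J Bs] in simp_all)
    finally show ?thesis
      using occ_eq[OF J Bs disj, of k] by simp
  qed
  have pois1: "measure ?Q {\<omega>\<in>space ?Q. measure (g (fst \<omega>)) B = real k} = poisson_prob (\<theta> * measure m B) k"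
    if "B \<in> sets borel" for B k
    using pois[of "{0}" "\<lambda>_. B" "\<lambda>_. k"] that by (simp add: disjoint_family_on_def)
  have po: "poisson_rm ?Q (\<lambda>\<omega>. g (fst \<omega>)) (diffuse_part \<nu>)"
    unfolding poisson_rm_def random_measure_iff_measurable
  proof (intro conjI allI impI ballI)
    fix I :: "nat set" and Bs :: "nat \<Rightarrow> 'x set" assume I: "finite I" "\<forall>j\<in>I. Bs j \<in> sets borel" "disjoint_family_on Bs I"
    show "P.indep_vars (\<lambda>_. borel) (\<lambda>j \<omega>. measure (g (fst \<omega>)) (Bs j)) I"
    proof (rule P.indep_vars_nat_valuedI)
      fix i assume i: "i \<in> I"
      show "(\<lambda>\<omega>. measure (g (fst \<omega>)) (Bs i)) \<in> borel_measurable ?Q"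
        using I(2) i by (intro measurable_compose[OF N1m measurable_measure_finite_measures]) auto
      show "measure (g (fst \<omega>)) (Bs i) \<in> range real" if "\<omega> \<in> space ?Q" for \<omega>
        using I(2) i that spQ by (intro nat) auto
    next
      fix J k assume J: "J \<subseteq> I" "finite J"
      have "disjoint_family_on Bs J"
        using I(3) J(1) by (rule disjoint_family_on_mono[rotated])
      then show "P.prob {\<omega>\<in>space ?Q. \<forall>j\<in>J. measure (g (fst \<omega>)) (Bs j) = real (k j)}
          = (\<Prod>j\<in>J. P.prob {\<omega>\<in>space ?Q. measure (g (fst \<omega>)) (Bs j) = real (k j)})"
        using J I(2) by (subst pois) (auto intro!: prod.cong simp: pois1)
    qed
  next
    fix B :: "'x set" and k assume "B \<in> sets borel"
    then show "measure ?Q {\<omega>\<in>space ?Q. measure (g (fst \<omega>)) B = real k} = poisson_prob (diffuse_part \<nu> B) k"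
      by (simp only: pois1 dp)
  qed (rule N1m)
  \<comment> \<open>The values of a Bernoulli coordinate that are decoded as k. Since decoding only
    tests for 1, \<open>?X 0\<close> is the complement of {1}.\<close>
  let ?X = "\<lambda>k::nat. {t::real. (if t = 1 then 1 else 0) = real k}"
  have Xm: "?X k \<in> sets borel" for k
  proof -
    have "{t \<in> space borel. (if t = 1 then 1 else 0) = real k} \<in> sets (borel :: real measure)"
      by measurable
    then show ?thesis by simp
  qed
  have bern: "measure ?Q {\<omega>\<in>space ?Q. \<forall>x\<in>J. h x (snd \<omega>) = real (k x)} = (\<Prod>x\<in>J. measure (\<beta> x) (?X (k x)))"
    if J: "J \<subseteq> ?S" "finite J" for J k
  proof -
    let ?A = "{\<mu>\<in>space finms. \<forall>x\<in>J. h x \<mu> = real (k x)}"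
    have A: "?A \<in> sets finms"
      using hm by (intro sets.sets_Collect_finite_All[OF _ J(2)]) measurable
    have "{\<omega>\<in>space ?Q. \<forall>x\<in>J. h x (snd \<omega>) = real (k x)} = space ?P \<times> ?A"
      by (auto simp: space_pair_measure)
    then have "measure ?Q {\<omega>\<in>space ?Q. \<forall>x\<in>J. h x (snd \<omega>) = real (k x)} = measure ?D ?A"
      using A measure_Times[OF sets.top, of ?A] by (simp add: P1.prob_space[simplified])
    also have "\<dots> = measure ?W (bern_meas ?S -` ?A \<inter> space ?W)"
      using A by (intro measure_distr Tm)
    also have "bern_meas ?S -` ?A \<inter> space ?W = {v\<in>space ?W. \<forall>x\<in>J. v x \<in> ?X (k x)}"
    proof -
      have "h x (bern_meas ?S v) = (if v x = 1 then 1 else 0)" if "x \<in> J" for x v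
        using J that unfolding h_def measure_bern_meas_point[OF S] by auto
      then show ?thesis
        using bern_meas_in_space[OF S] by auto
    qed
    also have "measure ?W \<dots> = (\<Prod>x\<in>J. measure (\<beta> x) (?X (k x)))"
      using W.emeasure_PiM_Collect[OF J, of "\<lambda>x. ?X (k x)"] Xm
      by (simp add: W.P.emeasure_eq_measure \<beta>.emeasure_eq_measure prod_ennreal prod_nonneg)
    finally show ?thesis .
  qed
  have bern1: "measure ?Q {\<omega>\<in>space ?Q. h x (snd \<omega>) = real k} = measure (\<beta> x) (?X k)" if "x \<in> ?S" for x k
    using bern[of "{x}" "\<lambda>_. k"] that by simp
  have Vi: "P.indep_vars (\<lambda>_. borel) (\<lambda>x \<omega>. h x (snd \<omega>)) ?S"
  proof (rule P.indep_vars_nat_valuedI)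
    fix i \<omega> show "h i (snd \<omega>) \<in> range real"
      using V01[of i "snd \<omega>"] by (auto intro: range_eqI[of _ _ 0] range_eqI[of _ _ 1])
  next
    fix J k assume J: "J \<subseteq> ?S" "finite J"
    show "P.prob {\<omega>\<in>space ?Q. \<forall>j\<in>J. h j (snd \<omega>) = real (k j)}
        = (\<Prod>j\<in>J. P.prob {\<omega>\<in>space ?Q. h j (snd \<omega>) = real (k j)})"
      unfolding bern[OF J] using J(1) by (intro prod.cong refl bern1[symmetric]) blast
  qed (rule Vm)
  have V1: "measure ?Q {\<omega>\<in>space ?Q. h x (snd \<omega>) = 1} = measure \<nu> {x}" if "x \<in> ?S" for x
  proof -
    have "measure ?Q {\<omega>\<in>space ?Q. h x (snd \<omega>) = 1} = measure (\<beta> x) {1}"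
      using bern1[OF that, of 1] by simp
    also have "\<dots> = measure (measure_pmf (bernoulli_pmf (measure \<nu> {x}))) {True}"
      unfolding \<beta>_def by (subst measure_distr) (auto intro!: arg_cong2[where f=measure] simp: of_bool_def split: if_splits)
    also have "\<dots> = measure \<nu> {x}"
      using le1 by (simp add: measure_pmf_single)
    finally show ?thesis .
  qed
  have hvec: "(\<lambda>\<mu>. \<lambda>x\<in>?S. h x \<mu>) \<in> measurable ?D (PiM ?S (\<lambda>_. borel))"
    using hm by (intro measurable_restrict) simp
  have gm': "g \<in> measurable ?P finms"
    using gm by (simp cong: measurable_cong_sets)
  \<comment> \<open>m is diffuse, so the Poisson part misses the finitely many atoms of \<nu>.
    Otherwise the two parts could share a point and produce mass 2.\<close>
  have ae0: "AE \<omega> in ?Q. \<forall>x\<in>?S. measure (g (fst \<omega>)) {x} = 0"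
  proof (rule AE_finite_allI[OF S])
    fix x
    have "P.prob {\<omega>\<in>space ?Q. measure (g (fst \<omega>)) {x} = 0} = 1"
      using pois1[of "{x}" 0] by (simp add: diffuse)
    then show "AE \<omega> in ?Q. measure (g (fst \<omega>)) {x} = 0"
      by (rule P.AE_prob_1[THEN AE_mp]) simp
  qed
  have "AE \<omega> in ?Q. simple_pm (N \<omega>)"
    using ae0 AE_space
  proof eventually_elim
    case (elim \<omega>)
    show ?case
      unfolding N_def
    proof (rule simple_pm_madd)
      show "g (fst \<omega>) \<in> space finms"
        using elim spQ by (intro g_space) auto
      fix x assume "measure (g (fst \<omega>)) {x} = 1" "measure (bern_meas ?S (\<lambda>x. h x (snd \<omega>))) {x} = 1"
      then show False
        using elim(1) by (auto simp: measure_bern_meas_point[OF S] split: if_splits)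
    qed (intro bern_meas_in_space S simple_g simple_pm_bern_meas)+
  qed
  moreover have "BeP_rm ?Q N \<nu>"
    unfolding BeP_rm_def random_measure_iff_measurable
  proof (intro conjI exI[of _ "\<lambda>\<omega>. g (fst \<omega>)"] exI[of _ "\<lambda>x \<omega>. h x (snd \<omega>)"] ballI)
    show "P.indep_set (sets (vimage_algebra (space ?Q) (\<lambda>\<omega>. g (fst \<omega>)) finms))
        (sets (vimage_algebra (space ?Q) (\<lambda>\<omega>. \<lambda>x\<in>?S. h x (snd \<omega>)) (PiM ?S (\<lambda>_. borel))))"
      by (rule indep_set_vimage[OF gm' hvec])
    show "AE \<omega> in ?Q. \<forall>B\<in>sets borel. measure (N \<omega>) B
        = measure (g (fst \<omega>)) B + (\<Sum>\<^sub>\<infinity>x\<in>?S \<inter> B. h x (snd \<omega>))"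
    proof (rule AE_I2, intro ballI)
      fix \<omega> and B :: "'x set" assume "\<omega> \<in> space ?Q" "B \<in> sets borel"
      then show "measure (N \<omega>) B = measure (g (fst \<omega>)) B + (\<Sum>\<^sub>\<infinity>x\<in>?S \<inter> B. h x (snd \<omega>))"
        using S by (subst infsum_finite) (simp_all add: N_eq)
    qed
  qed (rule Nm po Vi V1 Vm V01 | assumption)+
  ultimately show ?thesis
    using P.prob_space_axioms by blast
qed

text \<open>Uniqueness identifies every candidate for the definite description with one constructed
  law. The description ranges over the pair type, and this is the type on which existence was
  proved.\<close>

lemma BeP_law_eq_distr:
  fixes m :: "'x::{metric_space, second_countable_topology} measure"
  assumes m: "prob_space m" "sets m = sets borel" and diffuse: "\<And>x. measure m {x} = 0"
    and \<theta>: "0 < \<theta>" and S: "finite (atoms_of \<nu>)" and le1: "\<And>x. measure \<nu> {x} \<le> 1"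
    and dp: "\<And>B. B \<in> sets borel \<Longrightarrow> diffuse_part \<nu> B = \<theta> * measure m B"
  obtains Q :: "('x measure \<times> 'x measure) measure" and N where
    "prob_space Q" "BeP_rm Q N \<nu>" "AE \<omega> in Q. simple_pm (N \<omega>)" "BeP_law \<nu> = distr Q finms N"
proof -
  obtain Q :: "('x measure \<times> 'x measure) measure" and N where
    Q: "prob_space Q" "BeP_rm Q N \<nu>" "AE \<omega> in Q. simple_pm (N \<omega>)"
    using BeP_rm_exists[OF assms] by blast
  have "BeP_law \<nu> = distr Q finms N"
    unfolding BeP_law_def
  proof (rule the_equality)
    show "\<exists>(Q' :: ('x measure \<times> 'x measure) measure) N'.
        prob_space Q' \<and> BeP_rm Q' N' \<nu> \<and> distr Q finms N = distr Q' finms N'"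
      using Q by blast
    fix D assume "\<exists>(Q' :: ('x measure \<times> 'x measure) measure) N'.
        prob_space Q' \<and> BeP_rm Q' N' \<nu> \<and> D = distr Q' finms N'"
    then show "D = distr Q finms N"
      using BeP_rm_unique[OF _ Q(1) _ Q(2) S] by blast
  qed
  with Q show thesis by (rule that)
qed

text \<open>All that the sequel uses about the law. Off the atoms the indicator sum is empty, so the
  mass agrees almost surely with that of the Poisson part; simplicity is inherited from the
  constructed representative.\<close>

lemma
  fixes m :: "'x::{metric_space, second_countable_topology} measure"
  assumes m: "prob_space m" "sets m = sets borel" and diffuse: "\<And>x. measure m {x} = 0"
    and \<theta>: "0 < \<theta>" and S: "finite (atoms_of \<nu>)" and le1: "\<And>x. measure \<nu> {x} \<le> 1"
    and dp: "\<And>B. B \<in> sets borel \<Longrightarrow> diffuse_part \<nu> B = \<theta> * measure m B"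
  shows prob_space_BeP_law: "prob_space (BeP_law \<nu>)"
    and sets_BeP_law: "sets (BeP_law \<nu>) = sets finms"
    and BeP_law_simple: "measure (BeP_law \<nu>) {\<mu>\<in>space finms. simple_pm \<mu>} = 1"
    and BeP_law_off_atoms: "B \<in> sets borel \<Longrightarrow> B \<inter> atoms_of \<nu> = {} \<Longrightarrow>
      measure (BeP_law \<nu>) {\<mu>\<in>space finms. measure \<mu> B = real k} = poisson_prob (\<theta> * measure m B) k"
proof -
  obtain Q :: "('x measure \<times> 'x measure) measure" and N where
    Q: "prob_space Q" and bep: "BeP_rm Q N \<nu>" and si: "AE \<omega> in Q. simple_pm (N \<omega>)" and law: "BeP_law \<nu> = distr Q finms N"
    using BeP_law_eq_distr[OF assms] by blast
  interpret prob_space Q by fact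
  have N[measurable]: "N \<in> measurable Q finms"
    using bep by (auto simp: BeP_rm_def random_measure_iff_measurable)
  show "prob_space (BeP_law \<nu>)" "sets (BeP_law \<nu>) = sets finms"
    unfolding law by (simp_all add: prob_space_distr)
  have "measure (distr Q finms N) {\<mu>\<in>space finms. simple_pm \<mu>} = prob (N -` {\<mu>\<in>space finms. simple_pm \<mu>} \<inter> space Q)"
    by (rule measure_distr) measurable
  also have "\<dots> = 1"
    using si measurable_space[OF N] by (subst prob_eq_1) (auto elim!: eventually_mono intro!: measurable_sets[OF N])
  finally show "measure (BeP_law \<nu>) {\<mu>\<in>space finms. simple_pm \<mu>} = 1"
    unfolding law .
  assume B[measurable]: "B \<in> sets borel" and disj: "B \<inter> atoms_of \<nu> = {}"
  obtain N1 V where po: "poisson_rm Q N1 (diffuse_part \<nu>)"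
    and ae: "AE \<omega> in Q. \<forall>B\<in>sets (borel :: 'x measure).
            measure (N \<omega>) B = measure (N1 \<omega>) B + (\<Sum>\<^sub>\<infinity>x\<in>atoms_of \<nu> \<inter> B. V x \<omega>)"
    using bep unfolding BeP_rm_def by blast
  have N1[measurable]: "N1 \<in> measurable Q finms"
    using po by (auto simp: poisson_rm_def random_measure_iff_measurable)
  have "measure (distr Q finms N) {\<mu>\<in>space finms. measure \<mu> B = real k}
      = prob (N -` {\<mu>\<in>space finms. measure \<mu> B = real k} \<inter> space Q)"
    by (intro measure_distr N) measurable
  also have "N -` {\<mu>\<in>space finms. measure \<mu> B = real k} \<inter> space Q = {\<omega>\<in>space Q. measure (N \<omega>) B = real k}"
    using measurable_space[OF N] by auto
  also have "prob {\<omega>\<in>space Q. measure (N \<omega>) B = real k} = prob {\<omega>\<in>space Q. measure (N1 \<omega>) B = real k}"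
  proof (rule finite_measure_eq_AE)
    show "AE \<omega> in Q. \<omega> \<in> {\<omega>\<in>space Q. measure (N \<omega>) B = real k} \<longleftrightarrow> \<omega> \<in> {\<omega>\<in>space Q. measure (N1 \<omega>) B = real k}"
      using ae
    proof eventually_elim
      case (elim \<omega>)
      have "measure (N \<omega>) B = measure (N1 \<omega>) B"
        using bspec[OF elim B] disj by (simp add: Int_commute)
      then show ?case by simp
    qed
  qed measurable
  also have "\<dots> = poisson_prob (\<theta> * measure m B) k"
    using po B dp[OF B] unfolding poisson_rm_def by simp
  finally show "measure (BeP_law \<nu>) {\<mu>\<in>space finms. measure \<mu> B = real k} = poisson_prob (\<theta> * measure m B) k"
    unfolding law .
qed

section \<open>The number of new features\<close>

text \<open>The kernel need not be measurable, only its values on fixed sets agree almost surely with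
  measurable functions; hence the version g.\<close>

lemma disintegration_sections:
  fixes P F :: "'o measure" and G :: "'g measure" and \<kappa> :: "'o \<Rightarrow> 'g measure"
  assumes "prob_space P" and sub: "subalgebra P F" and Y[measurable]: "Y \<in> measurable P G"
    and \<kappa>: "AE \<omega> in P. prob_space (\<kappa> \<omega>) \<and> sets (\<kappa> \<omega>) = sets G"
    and cond: "\<And>A. A \<in> sets G \<Longrightarrow> AE \<omega> in P. real_cond_exp P F (indicator {\<omega>\<in>space P. Y \<omega> \<in> A}) \<omega> = measure (\<kappa> \<omega>) A"
    and W: "W \<in> sets (F \<Otimes>\<^sub>M G)"
  shows "\<exists>g\<in>borel_measurable F. (AE \<omega> in P. emeasure (\<kappa> \<omega>) (Pair \<omega> -` W) = g \<omega>) \<and>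
    (\<forall>H\<in>sets F. emeasure P {\<omega>\<in>H. (\<omega>, Y \<omega>) \<in> W} = (\<integral>\<^sup>+\<omega>. g \<omega> * indicator H \<omega> \<partial>P))"
proof -
  interpret prob_space P by fact
  interpret finite_measure_subalgebra P F by unfold_locales (rule sub)
  have spF: "space F = space P" and setsF: "sets F \<subseteq> sets P"
    using sub by (auto simp: subalgebra_def)
  have mF: "f \<in> borel_measurable P" if "f \<in> borel_measurable F" for f :: "'o \<Rightarrow> ennreal"
    using measurable_from_subalg[OF sub that] .
  have idF: "(\<lambda>\<omega>. \<omega>) \<in> measurable P F"
    using setsF spF by (auto simp: measurable_def dest: sets.sets_into_space intro!: sets.Int)
  have pairY: "(\<lambda>\<omega>. (\<omega>, Y \<omega>)) \<in> measurable P (F \<Otimes>\<^sub>M G)"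
    using idF Y by measurable
  have ev: "{\<omega>\<in>H. (\<omega>, Y \<omega>) \<in> V} \<in> sets P" if "H \<in> sets F" "V \<in> sets (F \<Otimes>\<^sub>M G)" for H V
  proof -
    have "{\<omega>\<in>H. (\<omega>, Y \<omega>) \<in> V} = H \<inter> ((\<lambda>\<omega>. (\<omega>, Y \<omega>)) -` V \<inter> space P)"
      using sets.sets_into_space[OF that(1)] spF by auto
    then show ?thesis
      using measurable_sets[OF pairY that(2)] that(1) setsF by auto
  qed
  show ?thesis
    using W unfolding sets_pair_measure
  \<comment> \<open>Rectangles are stable under intersection and generate the product sigma-field.
    On a rectangle the section is \<open>b\<close> or empty, and the conditional probability of
    \<open>b\<close>, cut off by \<open>a\<close>, is the required version. Complements and disjoint
    unions follow.\<close>
  proof (induction rule: sigma_sets_induct_disjoint[OF Int_stable_pair_measure_generator pair_measure_closed, consumes 1, case_names basic empty compl union])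
    case (basic W)
    then obtain a b where W: "W = a \<times> b" and a: "a \<in> sets F" and b: "b \<in> sets G" by blast
    define f where "f = real_cond_exp P F (indicator {\<omega>\<in>space P. Y \<omega> \<in> b})"
    have Yb: "{\<omega>\<in>space P. Y \<omega> \<in> b} \<in> sets P"
      using b by measurable
    have fF: "f \<in> borel_measurable F"
      unfolding f_def by simp
    have int: "integrable P (indicator {\<omega>\<in>space P. Y \<omega> \<in> b} :: 'o \<Rightarrow> real)"
      using Yb by (intro integrable_real_indicator) (simp_all add: less_top[symmetric])
    have f0: "AE \<omega> in P. 0 \<le> f \<omega>"
      unfolding f_def by (rule real_cond_exp_pos) (use Yb in auto)
    have aF: "indicator a \<in> borel_measurable F" using a by simp
    show ?case
    proof (intro bexI[of _ "\<lambda>\<omega>. indicator a \<omega> * ennreal (f \<omega>)"] conjI ballI)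
      show "(\<lambda>\<omega>. indicator a \<omega> * ennreal (f \<omega>)) \<in> borel_measurable F"
        using fF a by measurable
      show "AE \<omega> in P. emeasure (\<kappa> \<omega>) (Pair \<omega> -` W) = indicator a \<omega> * ennreal (f \<omega>)"
        using \<kappa> cond[OF b]
      proof eventually_elim
        case (elim \<omega>)
        then interpret K: prob_space "\<kappa> \<omega>" by simp
        have "Pair \<omega> -` W = (if \<omega> \<in> a then b else {})" by (auto simp: W)
        then show ?case
          using elim by (simp add: K.emeasure_eq_measure f_def)
      qed
      fix H assume H: "H \<in> sets F"
      have Ha: "H \<inter> a \<in> sets F" using H a by simp
      have "(\<integral>\<^sup>+\<omega>. indicator a \<omega> * ennreal (f \<omega>) * indicator H \<omega> \<partial>P)
          = (\<integral>\<^sup>+\<omega>. ennreal (indicator (H \<inter> a) \<omega> * f \<omega>) \<partial>P)"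
        by (intro nn_integral_cong) (auto split: split_indicator)
      also have "\<dots> = ennreal (\<integral>\<omega>. indicator (H \<inter> a) \<omega> * f \<omega> \<partial>P)"
      proof (rule nn_integral_eq_integral)
        show "integrable P (\<lambda>\<omega>. indicator (H \<inter> a) \<omega> * f \<omega>)"
          using Ha setsF real_cond_exp_int(1)[OF int] integrable_real_mult_indicator[of "H \<inter> a" P f]
          unfolding f_def by (auto simp: mult.commute)
        show "AE \<omega> in P. 0 \<le> indicator (H \<inter> a) \<omega> * f \<omega>"
          using f0 by eventually_elim simp
      qed
      also have "(\<integral>\<omega>. indicator (H \<inter> a) \<omega> * f \<omega> \<partial>P) = (\<integral>\<omega>. indicator (H \<inter> a) \<omega> * indicator {\<omega>\<in>space P. Y \<omega> \<in> b} \<omega> \<partial>P)"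
        unfolding f_def using real_cond_exp_intA[OF int Ha] by (simp add: set_lebesgue_integral_def)
      also have "\<dots> = (\<integral>\<omega>. indicator {\<omega>\<in>H. (\<omega>, Y \<omega>) \<in> W} \<omega> \<partial>P)"
        using sets.sets_into_space[OF H] spF
        by (intro Bochner_Integration.integral_cong) (auto simp: W split: split_indicator)
      also have "ennreal \<dots> = emeasure P {\<omega>\<in>H. (\<omega>, Y \<omega>) \<in> W}"
        using ev[OF H, of W] a b by (simp add: W emeasure_eq_measure pair_measureI)
      finally show "emeasure P {\<omega>\<in>H. (\<omega>, Y \<omega>) \<in> W} = (\<integral>\<^sup>+\<omega>. indicator a \<omega> * ennreal (f \<omega>) * indicator H \<omega> \<partial>P)" ..
    qed
  next
    case empty
    show ?case by (intro bexI[of _ "\<lambda>_. 0"]) auto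
  next
    case (compl W)
    then obtain g where g: "g \<in> borel_measurable F" and ae: "AE \<omega> in P. emeasure (\<kappa> \<omega>) (Pair \<omega> -` W) = g \<omega>"
      and eq: "\<And>H. H \<in> sets F \<Longrightarrow> emeasure P {\<omega>\<in>H. (\<omega>, Y \<omega>) \<in> W} = (\<integral>\<^sup>+\<omega>. g \<omega> * indicator H \<omega> \<partial>P)"
      by blast
    note [measurable] = mF[OF g]
    have W': "W \<in> sets (F \<Otimes>\<^sub>M G)"
      using compl by (simp add: sets_pair_measure)
    \<comment> \<open>Subtraction in \<open>ennreal\<close> is truncated, so the complement needs
      that g is at most 1.\<close>
    have le1: "AE \<omega> in P. g \<omega> \<le> 1"
      using \<kappa> ae
    proof eventually_elim
      case (elim \<omega>)
      then show ?case
        using prob_space.measure_le_1[of "\<kappa> \<omega>"] by (metis prob_space.emeasure_le_1)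
    qed
    show ?case
    proof (intro bexI[of _ "\<lambda>\<omega>. 1 - g \<omega>"] conjI ballI)
      show "(\<lambda>\<omega>. 1 - g \<omega>) \<in> borel_measurable F" using g by measurable
      show "AE \<omega> in P. emeasure (\<kappa> \<omega>) (Pair \<omega> -` (space F \<times> space G - W)) = 1 - g \<omega>"
        using \<kappa> ae AE_space
      proof eventually_elim
        case (elim \<omega>)
        then interpret K: prob_space "\<kappa> \<omega>" by simp
        have sp: "space (\<kappa> \<omega>) = space G" using elim by (auto dest: sets_eq_imp_space_eq)
        have "Pair \<omega> -` (space F \<times> space G - W) = space (\<kappa> \<omega>) - Pair \<omega> -` W"
          using elim(3) by (auto simp: spF sp)
        moreover have "Pair \<omega> -` W \<in> sets (\<kappa> \<omega>)"
          using sets_Pair1[OF W', of \<omega>] elim(1) by simp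
        ultimately show ?case
          using elim(2) K.emeasure_finite[of "Pair \<omega> -` W"] emeasure_compl[of "Pair \<omega> -` W" "\<kappa> \<omega>"] by (simp add: K.emeasure_space_1)
      qed
      fix H assume H: "H \<in> sets F"
      have HP[measurable]: "H \<in> sets P" using H setsF by blast
      have "{\<omega>\<in>H. (\<omega>, Y \<omega>) \<in> space F \<times> space G - W} = H - {\<omega>\<in>H. (\<omega>, Y \<omega>) \<in> W}"
        using sets.sets_into_space[OF H] spF measurable_space[OF Y] by auto
      then have "emeasure P {\<omega>\<in>H. (\<omega>, Y \<omega>) \<in> space F \<times> space G - W} = emeasure P H - (\<integral>\<^sup>+\<omega>. g \<omega> * indicator H \<omega> \<partial>P)"
        using ev[OF H W'] by (simp add: emeasure_Diff eq[OF H, symmetric])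
      also have "\<dots> = (\<integral>\<^sup>+\<omega>. indicator H \<omega> - g \<omega> * indicator H \<omega> \<partial>P)"
      proof (subst nn_integral_diff)
        show "(\<integral>\<^sup>+\<omega>. g \<omega> * indicator H \<omega> \<partial>P) \<noteq> \<infinity>"
          unfolding eq[OF H, symmetric] by simp
        show "AE \<omega> in P. g \<omega> * indicator H \<omega> \<le> indicator H \<omega>"
          using le1 by eventually_elim (auto split: split_indicator)
      qed auto
      also have "\<dots> = (\<integral>\<^sup>+\<omega>. (1 - g \<omega>) * indicator H \<omega> \<partial>P)"
        by (intro nn_integral_cong) (auto split: split_indicator)
      finally show "emeasure P {\<omega>\<in>H. (\<omega>, Y \<omega>) \<in> space F \<times> space G - W} = (\<integral>\<^sup>+\<omega>. (1 - g \<omega>) * indicator H \<omega> \<partial>P)" .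
    qed
  next
    case (union A)
    have "\<exists>g. \<forall>i. g i \<in> borel_measurable F \<and> (AE \<omega> in P. emeasure (\<kappa> \<omega>) (Pair \<omega> -` A i) = g i \<omega>) \<and>
        (\<forall>H\<in>sets F. emeasure P {\<omega>\<in>H. (\<omega>, Y \<omega>) \<in> A i} = (\<integral>\<^sup>+\<omega>. g i \<omega> * indicator H \<omega> \<partial>P))"
      by (intro choice allI) (use union(3) in blast)
    then obtain g where g: "\<And>i. g i \<in> borel_measurable F"
      and ae: "\<And>i. AE \<omega> in P. emeasure (\<kappa> \<omega>) (Pair \<omega> -` A i) = g i \<omega>"
      and eq: "\<And>i H. H \<in> sets F \<Longrightarrow> emeasure P {\<omega>\<in>H. (\<omega>, Y \<omega>) \<in> A i} = (\<integral>\<^sup>+\<omega>. g i \<omega> * indicator H \<omega> \<partial>P)"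
      by blast
    note [measurable] = mF[OF g]
    have A: "A i \<in> sets (F \<Otimes>\<^sub>M G)" for i
      using union(2) by (auto simp: sets_pair_measure)
    show ?case
    proof (intro bexI[of _ "\<lambda>\<omega>. \<Sum>i. g i \<omega>"] conjI ballI)
      show "(\<lambda>\<omega>. \<Sum>i. g i \<omega>) \<in> borel_measurable F" using g by measurable
      have "AE \<omega> in P. \<forall>i. emeasure (\<kappa> \<omega>) (Pair \<omega> -` A i) = g i \<omega>"
        using ae by (simp add: AE_all_countable)
      then show "AE \<omega> in P. emeasure (\<kappa> \<omega>) (Pair \<omega> -` (\<Union>i. A i)) = (\<Sum>i. g i \<omega>)"
        using \<kappa>
      proof eventually_elim
        case (elim \<omega>)
        have "range (\<lambda>i. Pair \<omega> -` A i) \<subseteq> sets (\<kappa> \<omega>)"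
          using sets_Pair1[OF A, of \<omega>] elim(2) by auto
        moreover have "disjoint_family (\<lambda>i. Pair \<omega> -` A i)"
          using union(1) by (auto simp: disjoint_family_on_def)
        ultimately have "(\<Sum>i. emeasure (\<kappa> \<omega>) (Pair \<omega> -` A i)) = emeasure (\<kappa> \<omega>) (\<Union>i. Pair \<omega> -` A i)"
          by (rule suminf_emeasure)
        then show ?case
          using elim(1) by (simp add: vimage_UN)
      qed
      fix H assume H: "H \<in> sets F"
      have HP[measurable]: "H \<in> sets P" using H setsF by blast
      have "{\<omega>\<in>H. (\<omega>, Y \<omega>) \<in> (\<Union>i. A i)} = (\<Union>i. {\<omega>\<in>H. (\<omega>, Y \<omega>) \<in> A i})"
        by auto
      also have "emeasure P \<dots> = (\<Sum>i. emeasure P {\<omega>\<in>H. (\<omega>, Y \<omega>) \<in> A i})"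
        using ev[OF H A] union(1) by (intro suminf_emeasure[symmetric]) (auto simp: disjoint_family_on_def)
      also have "\<dots> = (\<integral>\<^sup>+\<omega>. (\<Sum>i. g i \<omega> * indicator H \<omega>) \<partial>P)"
        unfolding eq[OF H] by (rule nn_integral_suminf[symmetric]) measurable
      finally show "emeasure P {\<omega>\<in>H. (\<omega>, Y \<omega>) \<in> (\<Union>i. A i)} = (\<integral>\<^sup>+\<omega>. (\<Sum>i. g i \<omega>) * indicator H \<omega> \<partial>P)"
        by simp
    qed
  qed
qed

text \<open>\<open>measure_of\<close> returns the given set function only if that is a measure, so
  it is identified with an honest sum of two measures. Strictly positive weights make every point of
  S an atom, and diffuseness of m adds no others.\<close>

lemma atomic_plus_diffuse:
  fixes m :: "'x::{metric_space, second_countable_topology} measure" and p :: "'x \<Rightarrow> real"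
  assumes m: "prob_space m" "sets m = sets borel" and diffuse: "\<And>x. measure m {x} = 0"
    and S: "finite S" and p: "\<And>x. x \<in> S \<Longrightarrow> 0 < p x" and \<theta>: "0 \<le> \<theta>"
  defines "\<nu> \<equiv> measure_of UNIV (sets borel) (\<lambda>B. ennreal ((\<Sum>x\<in>S \<inter> B. p x) + \<theta> * measure m B))"
  shows "atoms_of \<nu> = S" and "x \<in> S \<Longrightarrow> measure \<nu> {x} = p x"
    and "B \<in> sets borel \<Longrightarrow> diffuse_part \<nu> B = \<theta> * measure m B"
proof -
  interpret m: prob_space m by fact
  let ?pm = "distr (point_measure S (\<lambda>x. ennreal (p x))) borel (\<lambda>x. x)"
  let ?\<nu> = "madd ?pm (scale_measure (ennreal \<theta>) m)"
  have pm: "emeasure ?pm A = ennreal (\<Sum>x\<in>S \<inter> A. p x)" if "A \<in> sets borel" for A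
  proof -
    have "emeasure ?pm A = emeasure (point_measure S (\<lambda>x. ennreal (p x))) (S \<inter> A)"
      using that by (subst emeasure_distr) (auto simp: point_measure_def measurable_count_space_eq1 Int_commute cong: measurable_cong_sets)
    also have "\<dots> = (\<Sum>x\<in>S \<inter> A. ennreal (p x))"
      using S by (intro emeasure_point_measure_finite2) auto
    also have "\<dots> = ennreal (\<Sum>x\<in>S \<inter> A. p x)"
      using p by (intro sum_ennreal) (auto intro: less_imp_le)
    finally show ?thesis .
  qed
  have e: "emeasure ?\<nu> A = ennreal ((\<Sum>x\<in>S \<inter> A. p x) + \<theta> * measure m A)" if "A \<in> sets borel" for A
  proof -
    have "emeasure ?\<nu> A = emeasure ?pm A + emeasure (scale_measure (ennreal \<theta>) m) A"
      using m that by (intro emeasure_madd) auto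
    also have "\<dots> = ennreal (\<Sum>x\<in>S \<inter> A. p x) + ennreal (\<theta> * measure m A)"
      using \<theta> by (simp add: pm[OF that] m.emeasure_eq_measure ennreal_mult)
    also have "\<dots> = ennreal ((\<Sum>x\<in>S \<inter> A. p x) + \<theta> * measure m A)"
      using \<theta> p by (intro ennreal_plus[symmetric] sum_nonneg) (auto intro: less_imp_le)
    finally show ?thesis .
  qed
  have "\<nu> = measure_of UNIV (sets borel) (emeasure ?\<nu>)"
    unfolding \<nu>_def using e sets.sigma_sets_eq[of "borel :: 'x measure"] by (intro measure_of_eq) auto
  also have "\<dots> = ?\<nu>"
    using measure_of_of_measure[of ?\<nu>] sets_eq_imp_space_eq[of ?\<nu> "borel :: 'x measure"] by simp
  finally have \<nu>: "\<nu> = ?\<nu>" .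
  have me: "measure \<nu> A = (\<Sum>x\<in>S \<inter> A. p x) + \<theta> * measure m A" if "A \<in> sets borel" for A
    unfolding \<nu> measure_def[of ?\<nu>] e[OF that] using \<theta> p
    by (intro enn2real_ennreal add_nonneg_nonneg sum_nonneg mult_nonneg_nonneg) (auto intro: less_imp_le)
  have pt: "measure \<nu> {x} = (if x \<in> S then p x else 0)" for x
    using me[of "{x}"] by (simp add: diffuse)
  then show "x \<in> S \<Longrightarrow> measure \<nu> {x} = p x" by simp
  show at: "atoms_of \<nu> = S"
    unfolding atoms_of_def pt using p by force
  have "(\<Sum>\<^sub>\<infinity>x\<in>S \<inter> B. measure \<nu> {x}) = (\<Sum>x\<in>S \<inter> B. p x)" for B
    using S by (subst infsum_finite) (auto simp: pt intro: sum.cong)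
  then show "B \<in> sets borel \<Longrightarrow> diffuse_part \<nu> B = \<theta> * measure m B"
    unfolding diffuse_part_def at by (simp add: me)
qed

section \<open>The model, its filtration and its hazard measures\<close>

lemma Lambda_n_pos:
  assumes "0 < \<alpha>" "\<beta> < 1" "- \<beta> < c" "0 \<le> s"
  shows "0 < Lambda_n \<alpha> \<beta> c s"
  unfolding Lambda_n_def using assms by (intro divide_pos_pos mult_pos_pos Gamma_real_pos) auto

text \<open>The lower bound u of the weights is a parameter, and B is fixed once and for all. As
  \<beta> is non-negative, the model's bound max(\<beta>, 0) reduces to \<beta>.\<close>

locale ibp = prob_space P
  for P :: "'o measure" +
  fixes m :: "'x::{metric_space, second_countable_topology} measure"
    and M :: "nat \<Rightarrow> 'o \<Rightarrow> 'x measure" and R :: "nat \<Rightarrow> 'o \<Rightarrow> real" and \<alpha> \<beta> c u :: real and B :: "'x set"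
  assumes m_prob: "prob_space m" and m_sets: "sets m = sets borel"
    and m_diffuse: "\<And>x. measure m {x} = 0"
    and \<alpha>: "\<alpha> > 0" and \<beta>: "0 \<le> \<beta>" "\<beta> < 1" and c: "c > - \<beta>"
    and M_rm: "\<And>n. 1 \<le> n \<Longrightarrow> random_measure P (M n)"
    and R_rv: "\<And>n. 1 \<le> n \<Longrightarrow> R n \<in> borel_measurable P"
    and u: "u > \<beta>"
    and R_lower: "\<And>n \<omega>. 1 \<le> n \<Longrightarrow> \<omega> \<in> space P \<Longrightarrow> R n \<omega> \<ge> u"
    and M_cond: "\<And>n A. A \<in> sets (finms :: 'x measure measure) \<Longrightarrow>
                   AE \<omega> in P. real_cond_exp P (filt P M R n)
                       (indicator {\<omega>\<in>space P. M (Suc n) \<omega> \<in> A}) \<omega>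
                     = measure (BeP_law (ibp_nu m \<alpha> \<beta> c M R n \<omega>)) A"
    and B: "B \<in> sets borel"
begin

interpretation m: prob_space m by (rule m_prob)

abbreviation "F \<equiv> filt P M R"

definition Rsum :: "nat \<Rightarrow> 'o \<Rightarrow> real" where
  "Rsum n \<omega> = (\<Sum>i=1..n. R i \<omega>)"

definition rate :: "nat \<Rightarrow> 'o \<Rightarrow> real" where
  "rate n \<omega> = Lambda_n \<alpha> \<beta> c (Rsum n \<omega>) * measure m B"

lemma M_measurable: "1 \<le> n \<Longrightarrow> M n \<in> measurable P finms"
  using M_rm by (simp add: random_measure_iff_measurable)

lemma filt_gen: "{{\<omega>\<in>space P. measure (M i \<omega>) A \<in> C} | i A C. i \<in> {1..n} \<and> A \<in> sets (borel :: 'x measure) \<and> C \<in> sets (borel :: real measure)} \<union>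
      {{\<omega>\<in>space P. R i \<omega> \<in> C} | i C. i \<in> {1..n} \<and> C \<in> sets (borel :: real measure)} \<subseteq> sets P"
proof -
  have "{\<omega>\<in>space P. measure (M i \<omega>) A \<in> C} \<in> sets P" if "i \<in> {1..n}" "A \<in> sets borel" "C \<in> sets borel" for i A C
  proof -
    have [measurable]: "(\<lambda>\<omega>. measure (M i \<omega>) A) \<in> borel_measurable P"
      using that by (intro measurable_compose[OF M_measurable measurable_measure_finite_measures]) auto
    show ?thesis using that by measurable
  qed
  moreover have "{\<omega>\<in>space P. R i \<omega> \<in> C} \<in> sets P" if "i \<in> {1..n}" "C \<in> sets borel" for i C
  proof -
    have [measurable]: "R i \<in> borel_measurable P" using that R_rv by simp
    show ?thesis using that by measurable
  qed
  ultimately show ?thesis by blast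
qed

lemma space_F[simp]: "space (F n) = space P"
  by (simp add: filt_def gen_sigma_def space_measure_of_conv)

lemma sets_F: "sets (F n) = sigma_sets (space P)
   ({{\<omega>\<in>space P. measure (M i \<omega>) A \<in> C} | i A C. i \<in> {1..n} \<and> A \<in> sets (borel :: 'x measure) \<and> C \<in> sets (borel :: real measure)} \<union>
      {{\<omega>\<in>space P. R i \<omega> \<in> C} | i C. i \<in> {1..n} \<and> C \<in> sets (borel :: real measure)})"
  unfolding filt_def gen_sigma_def
  using filt_gen[of n] sets.space_closed[of P] by (intro sets_measure_of) (rule subset_trans)

lemma subalgebra_F: "subalgebra P (F n)"
  unfolding subalgebra_def sets_F using sets.sigma_sets_subset[OF filt_gen] by simp

lemma F_mono: "n \<le> k \<Longrightarrow> sets (F n) \<subseteq> sets (F k)"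
proof -
  assume "n \<le> k"
  then have "{1..n} \<subseteq> {1..k}" by auto
  then show ?thesis
    unfolding sets_F by (intro sigma_sets_mono' Un_mono) blast+
qed

lemma measurable_F_mono: "f \<in> measurable (F n) N \<Longrightarrow> n \<le> k \<Longrightarrow> f \<in> measurable (F k) N"
  using F_mono[of n k] by (auto simp: measurable_def)

lemma measurable_F_P: "f \<in> measurable (F n) N \<Longrightarrow> f \<in> measurable P N"
  by (rule measurable_from_subalg[OF subalgebra_F])

lemma M_measurable_F: "i \<in> {1..n} \<Longrightarrow> M i \<in> measurable (F n) finms"
proof (rule measurable_finite_measures)
  assume i: "i \<in> {1..n}"
  fix \<omega> assume "\<omega> \<in> space (F n)"
  then have "M i \<omega> \<in> space finms"
    using i measurable_space[OF M_measurable, of i \<omega>] by simp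
  then show "finite_measure (M i \<omega>)" "sets (M i \<omega>) = sets borel"
    by (simp_all add: space_finms)
next
  fix A :: "'x set" assume i: "i \<in> {1..n}" and A: "A \<in> sets borel"
  have "(\<lambda>\<omega>. measure (M i \<omega>) A) \<in> borel_measurable (F n)"
  proof (rule measurableI)
    fix C :: "real set" assume "C \<in> sets borel"
    then have "{\<omega>\<in>space P. measure (M i \<omega>) A \<in> C} \<in> sets (F n)"
      unfolding sets_F using i A by (intro sigma_sets.Basic) blast
    moreover have "(\<lambda>\<omega>. measure (M i \<omega>) A) -` C \<inter> space (F n) = {\<omega>\<in>space P. measure (M i \<omega>) A \<in> C}"
      by auto
    ultimately show "(\<lambda>\<omega>. measure (M i \<omega>) A) -` C \<inter> space (F n) \<in> sets (F n)" by simp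
  qed simp
  then have "(\<lambda>\<omega>. ennreal (measure (M i \<omega>) A)) \<in> borel_measurable (F n)"
    by measurable
  then show "(\<lambda>\<omega>. emeasure (M i \<omega>) A) \<in> borel_measurable (F n)"
  proof (rule measurable_cong[THEN iffD1, rotated])
    fix \<omega> assume "\<omega> \<in> space (F n)"
    then have "M i \<omega> \<in> space finms"
      using i measurable_space[OF M_measurable, of i \<omega>] by simp
    then show "ennreal (measure (M i \<omega>) A) = emeasure (M i \<omega>) A"
      by (simp add: space_finms finite_measure.emeasure_eq_measure)
  qed
qed

lemma R_measurable_F: "i \<in> {1..n} \<Longrightarrow> R i \<in> borel_measurable (F n)"
proof (rule measurableI)
  fix C :: "real set" assume i: "i \<in> {1..n}" and C: "C \<in> sets borel"
  have "{\<omega>\<in>space P. R i \<omega> \<in> C} \<in> sets (F n)"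
    unfolding sets_F using i C by (intro sigma_sets.Basic) blast
  moreover have "R i -` C \<inter> space (F n) = {\<omega>\<in>space P. R i \<omega> \<in> C}" by auto
  ultimately show "R i -` C \<inter> space (F n) \<in> sets (F n)" by simp
qed simp

lemma Rsum_measurable_F: "Rsum n \<in> borel_measurable (F n)"
  unfolding Rsum_def by (intro borel_measurable_sum R_measurable_F)

lemma Rsum_lower: "\<omega> \<in> space P \<Longrightarrow> real n * u \<le> Rsum n \<omega>"
  unfolding Rsum_def using sum_bounded_below[of "{1..n}" u "\<lambda>i. R i \<omega>"] R_lower by simp

lemma u_pos: "0 < u"
  using u \<beta> by simp

lemma Rsum_nonneg: "\<omega> \<in> space P \<Longrightarrow> 0 \<le> Rsum n \<omega>"
  using Rsum_lower[of \<omega> n] u_pos by (meson mult_nonneg_nonneg of_nat_0_le_iff order_trans less_imp_le)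

lemma Lambda_pos: "\<omega> \<in> space P \<Longrightarrow> 0 < Lambda_n \<alpha> \<beta> c (Rsum n \<omega>)"
  using \<alpha> \<beta> c Rsum_nonneg by (intro Lambda_n_pos) auto

lemma rate_nonneg: "\<omega> \<in> space P \<Longrightarrow> 0 \<le> rate n \<omega>"
  unfolding rate_def using Lambda_pos[of \<omega> n] by (intro mult_nonneg_nonneg) auto

lemma M_in_space: "1 \<le> i \<Longrightarrow> \<omega> \<in> space P \<Longrightarrow> M i \<omega> \<in> space finms"
  using measurable_space[OF M_measurable] .

lemma finite_feat: "\<omega> \<in> space P \<Longrightarrow> finite (feat M n \<omega>)"
proof -
  assume \<omega>: "\<omega> \<in> space P"
  have "feat M n \<omega> = (\<Union>i\<in>{1..n}. {x. measure (M i \<omega>) {x} = 1})"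
    by (auto simp: feat_def)
  moreover have "finite {x. measure (M i \<omega>) {x} = 1}" if "i \<in> {1..n}" for i
    using M_in_space[of i \<omega>] \<omega> that by (intro finite_unit_atoms) (auto simp: space_finms)
  ultimately show ?thesis by simp
qed

lemma feat_Suc: "feat M (Suc n) \<omega> = feat M n \<omega> \<union> {x. measure (M (Suc n) \<omega>) {x} = 1}"
  by (auto simp: feat_def atLeastAtMostSuc_conv)

text \<open>Validity of the hazard measure while the past is simple. A feature is carried by some
  M_i whose weight is at least u > \<beta>, so its numerator is positive. With point masses at most
  1, the numerator is at most the sum of the R minus \<beta>, which is less than the denominator
  since c > - \<beta>.\<close>

lemma nu_n:
  assumes \<omega>: "\<omega> \<in> space P" and simple: "\<forall>i\<in>{1..n}. simple_pm (M i \<omega>)"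
  defines "\<nu> \<equiv> ibp_nu m \<alpha> \<beta> c M R n \<omega>"
  shows "atoms_of \<nu> = feat M n \<omega>" "finite (atoms_of \<nu>)" "\<And>x. measure \<nu> {x} \<le> 1"
    "\<And>A. A \<in> sets borel \<Longrightarrow> diffuse_part \<nu> A = Lambda_n \<alpha> \<beta> c (Rsum n \<omega>) * measure m A"
proof -
  let ?S = "feat M n \<omega>" and ?\<theta> = "Lambda_n \<alpha> \<beta> c (Rsum n \<omega>)"
  define p where "p x = ((\<Sum>i=1..n. R i \<omega> * measure (M i \<omega>) {x}) - \<beta>) / ((\<Sum>i=1..n. R i \<omega>) + c)" for x
  have Mx: "measure (M i \<omega>) {x} \<le> 1" if "i \<in> {1..n}" for i x
    using simple_pm_point[of "M i \<omega>" x] M_in_space[of i \<omega>] \<omega> simple that by (auto simp: space_finms)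
  have R0: "0 \<le> R i \<omega>" if "i \<in> {1..n}" for i
    using R_lower[of i \<omega>] u_pos \<omega> that by auto
  have p01: "0 < p x \<and> p x \<le> 1" if x: "x \<in> ?S" for x
  proof -
    obtain i where i: "i \<in> {1..n}" "measure (M i \<omega>) {x} = 1"
      using x by (auto simp: feat_def)
    have "R i \<omega> * measure (M i \<omega>) {x} \<le> (\<Sum>i=1..n. R i \<omega> * measure (M i \<omega>) {x})"
      using i R0 by (intro member_le_sum) auto
    then have 1: "\<beta> < (\<Sum>i=1..n. R i \<omega> * measure (M i \<omega>) {x})"
      using i u R_lower[of i \<omega>] \<omega> by simp
    have 2: "(\<Sum>i=1..n. R i \<omega> * measure (M i \<omega>) {x}) \<le> (\<Sum>i=1..n. R i \<omega>)"
      using Mx R0 by (intro sum_mono mult_left_le) auto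
    show ?thesis
      unfolding p_def using 1 2 c by (auto simp: divide_simps)
  qed
  have \<nu>: "\<nu> = measure_of UNIV (sets borel) (\<lambda>A. ennreal ((\<Sum>x\<in>?S \<inter> A. p x) + ?\<theta> * measure m A))"
    unfolding \<nu>_def ibp_nu_def p_def Rsum_def ..
  note * = atomic_plus_diffuse[OF m_prob m_sets m_diffuse finite_feat[OF \<omega>, of n], of p ?\<theta>, folded \<nu>]
  have \<theta>: "0 \<le> ?\<theta>" using Lambda_pos[OF \<omega>, of n] by simp
  show at: "atoms_of \<nu> = ?S"
    using p01 \<theta> by (intro *(1)) auto
  then show "finite (atoms_of \<nu>)"
    using finite_feat[OF \<omega>] by simp
  show "measure \<nu> {x} \<le> 1" for x
  proof (cases "x \<in> ?S")
    case True
    then have "measure \<nu> {x} = p x"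
      using p01 \<theta> by (intro *(2)) auto
    then show ?thesis using p01[OF True] by simp
  next
    case False
    then have "measure \<nu> {x} = 0"
      using at by (auto simp: atoms_of_def)
    then show ?thesis by simp
  qed
  show "diffuse_part \<nu> A = ?\<theta> * measure m A" if "A \<in> sets borel" for A
    using p01 \<theta> that by (intro *(3)) auto
qed

lemma
  assumes \<omega>: "\<omega> \<in> space P" and simple: "\<forall>i\<in>{1..n}. simple_pm (M i \<omega>)"
  defines "\<nu> \<equiv> ibp_nu m \<alpha> \<beta> c M R n \<omega>"
  shows prob_space_law_n: "prob_space (BeP_law \<nu>)"
    and sets_law_n: "sets (BeP_law \<nu>) = sets finms"
    and law_n_simple: "measure (BeP_law \<nu>) {\<mu>\<in>space finms. simple_pm \<mu>} = 1"
    and law_n_off_feat: "A \<in> sets borel \<Longrightarrow> A \<inter> feat M n \<omega> = {} \<Longrightarrow>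
      measure (BeP_law \<nu>) {\<mu>\<in>space finms. measure \<mu> A = real k}
      = poisson_prob (Lambda_n \<alpha> \<beta> c (Rsum n \<omega>) * measure m A) k"
proof -
  note nu = nu_n[OF \<omega> simple, folded \<nu>_def]
  show "prob_space (BeP_law \<nu>)" "sets (BeP_law \<nu>) = sets finms"
    "measure (BeP_law \<nu>) {\<mu>\<in>space finms. simple_pm \<mu>} = 1"
    by (rule prob_space_BeP_law[OF m_prob m_sets m_diffuse Lambda_pos[OF \<omega>] nu(2-4)]
        sets_BeP_law[OF m_prob m_sets m_diffuse Lambda_pos[OF \<omega>] nu(2-4)]
        BeP_law_simple[OF m_prob m_sets m_diffuse Lambda_pos[OF \<omega>] nu(2-4)]; assumption)+
  show "measure (BeP_law \<nu>) {\<mu>\<in>space finms. measure \<mu> A = real k}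
      = poisson_prob (Lambda_n \<alpha> \<beta> c (Rsum n \<omega>) * measure m A) k"
    if "A \<in> sets borel" "A \<inter> feat M n \<omega> = {}"
    using that by (intro BeP_law_off_atoms[OF m_prob m_sets m_diffuse Lambda_pos[OF \<omega>] nu(2-4)]) (simp_all add: nu(1))
qed

text \<open>Simplicity propagates along the process. If the past is simple, the conditional law of
  the next measure is a genuine Bernoulli law, concentrated on simple measures, so the conditional
  probability of simplicity is 1 and so is its integral.\<close>

lemma AE_simple: "AE \<omega> in P. \<forall>i\<in>{1..n}. simple_pm (M i \<omega>)"
proof (induction n)
  case 0
  show ?case by simp
next
  case (Suc n)
  let ?A = "{\<mu>\<in>space finms. simple_pm \<mu>} :: 'x measure set"
  have A: "?A \<in> sets finms"
    using sets_finms_simple_pm by (simp add: pred_def)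
  interpret finite_measure_subalgebra P "F n" by unfold_locales (rule subalgebra_F)
  have E: "{\<omega>\<in>space P. M (Suc n) \<omega> \<in> ?A} \<in> sets P"
    using measurable_sets[OF M_measurable A, of "Suc n"] by (simp add: vimage_def Int_def conj_commute)
  have int: "integrable P (indicator {\<omega>\<in>space P. M (Suc n) \<omega> \<in> ?A} :: 'o \<Rightarrow> real)"
    using E by (intro integrable_real_indicator) (simp_all add: less_top[symmetric])
  have "AE \<omega> in P. real_cond_exp P (F n) (indicator {\<omega>\<in>space P. M (Suc n) \<omega> \<in> ?A}) \<omega> = 1"
    using M_cond[OF A, of n] Suc AE_space
  proof eventually_elim
    case (elim \<omega>)
    then show ?case using law_n_simple[OF elim(3,2)] by simp
  qed
  then have "(\<integral>\<omega>. real_cond_exp P (F n) (indicator {\<omega>\<in>space P. M (Suc n) \<omega> \<in> ?A}) \<omega> \<partial>P) = (\<integral>\<omega>. 1 \<partial>P)"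
    by (intro integral_cong_AE) auto
  then have "prob {\<omega>\<in>space P. M (Suc n) \<omega> \<in> ?A} = 1"
    using real_cond_exp_int(2)[OF int] E by (simp add: prob_space)
  then have "AE \<omega> in P. simple_pm (M (Suc n) \<omega>)"
    using E by (subst (asm) prob_eq_1) (auto elim: eventually_mono)
  with Suc show ?case
  proof eventually_elim
    case (elim \<omega>)
    then show ?case by (auto simp: le_Suc_eq)
  qed
qed

section \<open>The number of features that the next measure adds inside B\<close>

definition newc :: "nat \<Rightarrow> 'o \<Rightarrow> nat" where
  "newc n \<omega> = card {x\<in>B. measure (M (Suc n) \<omega>) {x} = 1 \<and> x \<notin> feat M n \<omega>}"

lemma card_feat_Suc:
  assumes \<omega>: "\<omega> \<in> space P"
  shows "card (B \<inter> feat M (Suc n) \<omega>) = card (B \<inter> feat M n \<omega>) + newc n \<omega>"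
proof -
  let ?N = "{x\<in>B. measure (M (Suc n) \<omega>) {x} = 1 \<and> x \<notin> feat M n \<omega>}"
  have "B \<inter> feat M (Suc n) \<omega> = (B \<inter> feat M n \<omega>) \<union> ?N"
    by (auto simp: feat_Suc)
  moreover have "finite ?N"
    using finite_feat[OF \<omega>, of "Suc n"] by (rule rev_finite_subset) (auto simp: feat_Suc)
  moreover have "(B \<inter> feat M n \<omega>) \<inter> ?N = {}" by auto
  ultimately show ?thesis
    using finite_feat[OF \<omega>, of n] by (simp add: card_Un_disjoint newc_def)
qed

lemma card_feat_0: "card (B \<inter> feat M 0 \<omega>) = 0"
  by (simp add: feat_def)

text \<open>Joint measurability in outcome and point: the set of old features is random and has to
  be removed from B under an integral.\<close>

lemma feat_pred: "Measurable.pred (F n \<Otimes>\<^sub>M borel) (\<lambda>p. snd p \<notin> feat M n (fst p))"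
proof -
  have "{p \<in> space (F n \<Otimes>\<^sub>M borel). \<forall>i\<in>{1..n}. measure (M i (fst p)) {snd p} \<noteq> 1} \<in> sets (F n \<Otimes>\<^sub>M borel)"
  proof (rule sets.sets_Collect_finite_All)
    fix i assume "i \<in> {1..n}"
    from measurable_point_mass[OF M_measurable_F[OF this]]
    have [measurable]: "(\<lambda>p. measure (M i (fst p)) {snd p}) \<in> borel_measurable (F n \<Otimes>\<^sub>M borel)"
      unfolding split_beta' .
    show "{p \<in> space (F n \<Otimes>\<^sub>M borel). measure (M i (fst p)) {snd p} \<noteq> 1} \<in> sets (F n \<Otimes>\<^sub>M borel)"
      by measurable
  qed simp
  then show ?thesis
    by (simp add: feat_def pred_def)
qed

lemma sets_feat: "\<omega> \<in> space P \<Longrightarrow> feat M n \<omega> \<in> sets borel"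
  using finite_feat by (simp add: borel_closed finite_imp_closed)

text \<open>The count is the integral over B, against the next measure itself, of the indicator of
  new unit atoms; kernel integration then gives measurability. The floor only converts a real that
  is already a natural number.\<close>

lemma newc_measurable: "newc n \<in> measurable (F (Suc n)) (count_space UNIV)"
proof -
  let ?f = "\<lambda>\<omega> x. indicator B x * (if measure (M (Suc n) \<omega>) {x} = 1 \<and> x \<notin> feat M n \<omega> then 1 else 0) :: ennreal"
  have Mm: "M (Suc n) \<in> measurable (F (Suc n)) finms"
    by (rule M_measurable_F) simp
  have "(\<lambda>\<omega>. \<integral>\<^sup>+x. ?f \<omega> x \<partial>M (Suc n) \<omega>) \<in> borel_measurable (F (Suc n))"
  proof (rule nn_integral_measurable_finite_kernel[OF _ Mm])
    have [measurable]: "(\<lambda>p. measure (M (Suc n) (fst p)) {snd p}) \<in> borel_measurable (F (Suc n) \<Otimes>\<^sub>M borel)"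
      using measurable_point_mass[OF Mm] unfolding split_beta' .
    have id: "(\<lambda>\<omega>. \<omega>) \<in> measurable (F (Suc n)) (F n)"
      by (rule measurable_F_mono[of _ n]) auto
    have [measurable]: "Measurable.pred (F (Suc n) \<Otimes>\<^sub>M borel) (\<lambda>p. snd p \<notin> feat M n (fst p))"
      using measurable_compose[OF measurable_Pair[OF measurable_compose[OF measurable_fst id] measurable_snd] feat_pred]
      by simp
    note [measurable] = B
    show "(\<lambda>(\<omega>, x). ?f \<omega> x) \<in> borel_measurable (F (Suc n) \<Otimes>\<^sub>M borel)"
      unfolding split_beta' by measurable
  qed
  then have "(\<lambda>\<omega>. nat \<lfloor>enn2real (\<integral>\<^sup>+x. ?f \<omega> x \<partial>M (Suc n) \<omega>)\<rfloor>) \<in> measurable (F (Suc n)) (count_space UNIV)"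
    by measurable
  then show ?thesis
  proof (rule measurable_cong[THEN iffD1, rotated])
    fix \<omega> assume "\<omega> \<in> space (F (Suc n))"
    then have \<omega>: "\<omega> \<in> space P" by simp
    let ?N = "{x\<in>B. measure (M (Suc n) \<omega>) {x} = 1 \<and> x \<notin> feat M n \<omega>}"
    have Ms: "finite_measure (M (Suc n) \<omega>)" "sets (M (Suc n) \<omega>) = sets borel"
      using M_in_space[OF _ \<omega>, of "Suc n"] by (auto simp: space_finms)
    have fin: "finite ?N"
      using finite_feat[OF \<omega>, of "Suc n"] by (rule rev_finite_subset) (auto simp: feat_Suc)
    have "(\<integral>\<^sup>+x. ?f \<omega> x \<partial>M (Suc n) \<omega>) = (\<integral>\<^sup>+x. indicator ?N x \<partial>M (Suc n) \<omega>)"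
      by (intro nn_integral_cong) (auto split: split_indicator)
    also have "\<dots> = emeasure (M (Suc n) \<omega>) ?N"
      using fin Ms by (intro nn_integral_indicator) (simp add: borel_closed finite_imp_closed)
    finally have "enn2real (\<integral>\<^sup>+x. ?f \<omega> x \<partial>M (Suc n) \<omega>) = measure (M (Suc n) \<omega>) ?N"
      by (simp add: measure_def)
    also have "\<dots> = (\<Sum>x\<in>?N. measure (M (Suc n) \<omega>) {x})"
      using fin Ms by (intro finite_measure.finite_measure_eq_sum_singleton) auto
    also have "\<dots> = real (newc n \<omega>)"
      by (simp add: newc_def)
    finally show "nat \<lfloor>enn2real (\<integral>\<^sup>+x. ?f \<omega> x \<partial>M (Suc n) \<omega>)\<rfloor> = newc n \<omega>" by simp
  qed
qed

lemma card_feat_measurable: "(\<lambda>\<omega>. card (B \<inter> feat M n \<omega>)) \<in> measurable (F n) (count_space UNIV)"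
proof (induction n)
  case 0
  show ?case by (simp add: card_feat_0)
next
  case (Suc n)
  have [measurable]: "(\<lambda>\<omega>. card (B \<inter> feat M n \<omega>)) \<in> measurable (F (Suc n)) (count_space UNIV)"
    using Suc by (rule measurable_F_mono) simp
  note newc_measurable[measurable]
  have "(\<lambda>\<omega>. card (B \<inter> feat M n \<omega>) + newc n \<omega>) \<in> measurable (F (Suc n)) (count_space UNIV)"
    by measurable
  then show ?case
    by (rule measurable_cong[THEN iffD1, rotated]) (simp add: card_feat_Suc)
qed

text \<open>On s \<ge> 0 both Gamma arguments are positive, away from the poles. The sums of the R
  stay in that half-line, so continuity there is enough.\<close>

lemma rate_measurable: "rate n \<in> borel_measurable (F n)"
proof -
  have "continuous_on {0..} (Lambda_n \<alpha> \<beta> c)"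
  proof (intro continuous_at_imp_continuous_on ballI)
    fix s :: real assume "s \<in> {0..}"
    then have "0 < c + \<beta> + s" "0 < c + 1 + s"
      using c \<beta> by auto
    then have "0 < Gamma (c + \<beta>)" "0 < Gamma (c + 1 + s)" "c + \<beta> + s \<notin> \<int>\<^sub>\<le>\<^sub>0" "c + 1 + s \<notin> \<int>\<^sub>\<le>\<^sub>0"
      using c nonpos_Ints_nonpos[of "c + \<beta> + s"] nonpos_Ints_nonpos[of "c + 1 + s"]
      by (auto intro!: Gamma_real_pos)
    moreover from this have "Gamma (c + \<beta>) * Gamma (c + 1 + s) \<noteq> 0" by simp
    ultimately show "isCont (Lambda_n \<alpha> \<beta> c) s"
      unfolding Lambda_n_def[abs_def] isCont_def by (intro tendsto_intros tendsto_Gamma)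
  qed
  then have [measurable]: "Lambda_n \<alpha> \<beta> c \<in> borel_measurable (restrict_space borel {0..})"
    by (rule borel_measurable_continuous_on_restrict)
  have "Rsum n \<in> measurable (F n) (restrict_space borel {0..})"
    using Rsum_nonneg by (intro measurable_restrict_space2 Rsum_measurable_F) auto
  then show ?thesis
    unfolding rate_def[abs_def] by measurable
qed

text \<open>The event refers to B minus the old features, a set depending on the outcome.
  \<open>?W\<close> collects the pairs of outcome and measure with the right mass there; its section
  at an outcome is an event off the atoms, for which the Bernoulli law is Poisson.\<close>

lemma newc_law:
  assumes H: "H \<in> sets (F n)"
  shows "emeasure P {\<omega>\<in>H. newc n \<omega> = k} = (\<integral>\<^sup>+\<omega>. ennreal (poisson_prob (rate n \<omega>) k) * indicator H \<omega> \<partial>P)"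
proof -
  let ?\<kappa> = "\<lambda>\<omega>. BeP_law (ibp_nu m \<alpha> \<beta> c M R n \<omega>)"
  let ?W = "{p\<in>space (F n \<Otimes>\<^sub>M finms). measure (snd p) (B - feat M n (fst p)) = real k}"
  have HP: "H \<subseteq> space P"
    using sets.sets_into_space[OF H] by simp
  have \<kappa>: "AE \<omega> in P. prob_space (?\<kappa> \<omega>) \<and> sets (?\<kappa> \<omega>) = sets finms"
    using AE_simple[of n] AE_space
  proof eventually_elim
    case (elim \<omega>)
    then show ?case
      using prob_space_law_n[OF elim(2,1)] sets_law_n[OF elim(2,1)] by simp
  qed
  let ?f = "\<lambda>p x. indicator B x * (if x \<notin> feat M n (fst p) then 1 else 0) :: ennreal"
  have "(\<lambda>p. \<integral>\<^sup>+x. ?f p x \<partial>snd p) \<in> borel_measurable (F n \<Otimes>\<^sub>M finms)"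
  proof (rule nn_integral_measurable_finite_kernel[OF _ measurable_snd])
    have [measurable]: "Measurable.pred ((F n \<Otimes>\<^sub>M finms) \<Otimes>\<^sub>M borel) (\<lambda>q. snd q \<notin> feat M n (fst (fst q)))"
      using measurable_compose[OF measurable_Pair[OF measurable_compose[OF measurable_fst measurable_fst] measurable_snd] feat_pred]
      by simp
    note [measurable] = B
    show "(\<lambda>(p, x). ?f p x) \<in> borel_measurable ((F n \<Otimes>\<^sub>M finms) \<Otimes>\<^sub>M borel)"
      unfolding split_beta' by measurable
  qed
  then have "(\<lambda>p. enn2real (\<integral>\<^sup>+x. ?f p x \<partial>snd p)) \<in> borel_measurable (F n \<Otimes>\<^sub>M finms)"
    by measurable
  moreover have "enn2real (\<integral>\<^sup>+x. ?f p x \<partial>snd p) = measure (snd p) (B - feat M n (fst p))"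
    if "p \<in> space (F n \<Otimes>\<^sub>M finms)" for p
  proof -
    have p: "fst p \<in> space P" "sets (snd p) = sets borel"
      using that by (auto simp: space_pair_measure space_finms)
    have "(\<integral>\<^sup>+x. ?f p x \<partial>snd p) = (\<integral>\<^sup>+x. indicator (B - feat M n (fst p)) x \<partial>snd p)"
      by (intro nn_integral_cong) (auto split: split_indicator)
    also have "\<dots> = emeasure (snd p) (B - feat M n (fst p))"
      using p B sets_feat by (intro nn_integral_indicator) auto
    finally show ?thesis by (simp add: measure_def)
  qed
  ultimately have "(\<lambda>p. measure (snd p) (B - feat M n (fst p))) \<in> borel_measurable (F n \<Otimes>\<^sub>M finms)"
    by (rule measurable_cong[THEN iffD1, rotated])
  then have W: "?W \<in> sets (F n \<Otimes>\<^sub>M finms)"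
    by measurable
  obtain g where g: "g \<in> borel_measurable (F n)" and ae: "AE \<omega> in P. emeasure (?\<kappa> \<omega>) (Pair \<omega> -` ?W) = g \<omega>"
    and eq: "emeasure P {\<omega>\<in>H. (\<omega>, M (Suc n) \<omega>) \<in> ?W} = (\<integral>\<^sup>+\<omega>. g \<omega> * indicator H \<omega> \<partial>P)"
    using disintegration_sections[OF prob_space_axioms subalgebra_F M_measurable[of "Suc n"] \<kappa> M_cond W] H by auto
  have geq: "AE \<omega> in P. g \<omega> = ennreal (poisson_prob (rate n \<omega>) k)"
    using ae AE_simple[of n] AE_space
  proof eventually_elim
    case (elim \<omega>)
    interpret K: prob_space "?\<kappa> \<omega>"
      using prob_space_law_n[OF elim(3,2)] .
    have Bm: "B - feat M n \<omega> \<in> sets borel"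
      using B sets_feat[OF elim(3)] by simp
    have "(B - feat M n \<omega>) \<inter> feat M n \<omega> = {}" by auto
    from law_n_off_feat[OF elim(3,2) Bm this]
    have "measure (?\<kappa> \<omega>) {\<mu>\<in>space finms. measure \<mu> (B - feat M n \<omega>) = real k}
        = poisson_prob (Lambda_n \<alpha> \<beta> c (Rsum n \<omega>) * measure m (B - feat M n \<omega>)) k" .
    moreover have "Pair \<omega> -` ?W = {\<mu>\<in>space finms. measure \<mu> (B - feat M n \<omega>) = real k}"
      using elim(3) by (auto simp: space_pair_measure)
    \<comment> \<open>A finite set is m-null, so removing the old features leaves the Poisson mean
      unchanged.\<close>
    moreover have "measure m (B - feat M n \<omega>) = measure m B"
    proof -
      have "measure m (feat M n \<omega>) = (\<Sum>x\<in>feat M n \<omega>. measure m {x})"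
        using finite_feat[OF elim(3)] m_sets by (intro m.finite_measure_eq_sum_singleton) auto
      then have "measure m (feat M n \<omega>) = 0"
        by (simp add: m_diffuse)
      then have "feat M n \<omega> \<in> null_sets m"
        using sets_feat[OF elim(3)] m_sets by (intro null_setsI) (auto simp: m.emeasure_eq_measure)
      then show ?thesis
        using B m_sets by (intro measure_Diff_null_set) auto
    qed
    ultimately show ?case
      using elim(1) by (simp add: K.emeasure_eq_measure rate_def)
  qed
  \<comment> \<open>For a simple measure, the mass of B minus the old features counts the new ones;
    simplicity is needed up to index \<open>Suc n\<close> here.\<close>
  have "emeasure P {\<omega>\<in>H. newc n \<omega> = k} = emeasure P {\<omega>\<in>H. (\<omega>, M (Suc n) \<omega>) \<in> ?W}"
  proof (rule emeasure_eq_AE)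
    show "AE \<omega> in P. \<omega> \<in> {\<omega>\<in>H. newc n \<omega> = k} \<longleftrightarrow> \<omega> \<in> {\<omega>\<in>H. (\<omega>, M (Suc n) \<omega>) \<in> ?W}"
      using AE_simple[of "Suc n"] AE_space
    proof eventually_elim
      case (elim \<omega>)
      have Ms: "finite_measure (M (Suc n) \<omega>)" "sets (M (Suc n) \<omega>) = sets borel" "M (Suc n) \<omega> \<in> space finms"
        using M_in_space[OF _ elim(2), of "Suc n"] by (auto simp: space_finms)
      have "measure (M (Suc n) \<omega>) (B - feat M n \<omega>) = real (card {x\<in>B - feat M n \<omega>. measure (M (Suc n) \<omega>) {x} = 1})"
        using elim(1) B sets_feat[OF elim(2)] by (intro simple_pm_measure_eq_card Ms) auto
      also have "{x\<in>B - feat M n \<omega>. measure (M (Suc n) \<omega>) {x} = 1} = {x\<in>B. measure (M (Suc n) \<omega>) {x} = 1 \<and> x \<notin> feat M n \<omega>}"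
        by auto
      finally have "measure (M (Suc n) \<omega>) (B - feat M n \<omega>) = real (newc n \<omega>)"
        by (simp add: newc_def)
      then show ?case
        using Ms(3) elim(2) by (simp add: space_pair_measure)
    qed
    have [measurable]: "newc n \<in> measurable P (count_space UNIV)"
      using newc_measurable by (rule measurable_F_P)
    have Hev[measurable]: "H \<in> sets P" using H subalgebra_F[of n] by (auto simp: subalgebra_def)
    show "{\<omega>\<in>H. newc n \<omega> = k} \<in> sets P"
      by measurable
    have "(\<lambda>\<omega>. (\<omega>, M (Suc n) \<omega>)) \<in> measurable P (F n \<Otimes>\<^sub>M finms)"
      using measurable_F_P[of "\<lambda>\<omega>. \<omega>" n "F n"] M_measurable[of "Suc n"] by (intro measurable_Pair) auto
    from measurable_sets[OF this W]
    have "H \<inter> ((\<lambda>\<omega>. (\<omega>, M (Suc n) \<omega>)) -` ?W \<inter> space P) \<in> sets P"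
      using Hev by simp
    moreover have "H \<inter> ((\<lambda>\<omega>. (\<omega>, M (Suc n) \<omega>)) -` ?W \<inter> space P) = {\<omega>\<in>H. (\<omega>, M (Suc n) \<omega>) \<in> ?W}"
      using HP by auto
    ultimately show "{\<omega>\<in>H. (\<omega>, M (Suc n) \<omega>) \<in> ?W} \<in> sets P" by simp
  qed
  also have "\<dots> = (\<integral>\<^sup>+\<omega>. ennreal (poisson_prob (rate n \<omega>) k) * indicator H \<omega> \<partial>P)"
    unfolding eq using geq by (intro nn_integral_cong_AE) (auto elim: eventually_mono)
  finally show ?thesis .
qed

end

section \<open>Asymptotics of the compensator\<close>

text \<open>Gautschi's inequality, from the logarithmic convexity of the Gamma function.\<close>

lemma Gamma_quotient_bounds:
  fixes x b :: real
  assumes x: "0 < x" and b: "0 \<le> b" "b < 1"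
  shows "(x + b) powr (b - 1) \<le> Gamma (x + b) / Gamma (x + 1)"
    and "Gamma (x + b) / Gamma (x + 1) \<le> x powr (b - 1)"
proof -
  have cv: "ln (Gamma ((1 - t) * y + t * z)) \<le> (1 - t) * ln (Gamma y) + t * ln (Gamma z)"
    if "0 \<le> t" "t \<le> 1" "0 < y" "0 < z" for t y z :: real
    using convex_onD[OF log_convex_Gamma_real, of t y z] that by simp
  have pos: "0 < Gamma x" "0 < Gamma (x + b)" "0 < Gamma (x + 1)"
    using x b by (auto intro!: Gamma_real_pos)
  have G1: "ln (Gamma (y + 1)) = ln y + ln (Gamma y)" if "0 < y" for y :: real
  proof -
    have "y \<notin> \<int>\<^sub>\<le>\<^sub>0" using that nonpos_Ints_nonpos[of y] by auto
    then have "ln (Gamma (y + 1)) = ln (y * Gamma y)"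
      by (rule arg_cong[OF Gamma_plus1])
    then show ?thesis
      using that Gamma_real_pos[OF that] by (simp only: ln_mult_pos)
  qed
  \<comment> \<open>Convexity is used twice: x + b lies between x and x + 1 with weight b, and x + 1
    lies between x + b and x + b + 1 with weight 1 - b. The functional equation then eliminates the
    third Gamma value.\<close>
  have "(1 - b) * x + b * (x + 1) = x + b" "(1 - (1 - b)) * (x + b) + (1 - b) * (x + b + 1) = x + 1"
    by (simp_all add: algebra_simps)
  then have 1: "ln (Gamma (x + b)) \<le> (1 - b) * ln (Gamma x) + b * ln (Gamma (x + 1))"
    and 2: "ln (Gamma (x + 1)) \<le> b * ln (Gamma (x + b)) + (1 - b) * ln (Gamma (x + b + 1))"
    using cv[of b x "x + 1"] cv[of "1 - b" "x + b" "x + b + 1"] x b by simp_all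
  have q: "Gamma (x + b) / Gamma (x + 1) = exp (ln (Gamma (x + b)) - ln (Gamma (x + 1)))"
    using pos by (simp add: exp_diff)
  have "ln (Gamma (x + b)) - ln (Gamma (x + 1)) \<le> (b - 1) * ln x"
  proof -
    have "ln (Gamma x) = ln (Gamma (x + 1)) - ln x" using G1[OF x] by simp
    then show ?thesis using 1 by (simp only:) (simp add: algebra_simps)
  qed
  then show "Gamma (x + b) / Gamma (x + 1) \<le> x powr (b - 1)"
    unfolding q powr_def using x by simp
  have "(b - 1) * ln (x + b) \<le> ln (Gamma (x + b)) - ln (Gamma (x + 1))"
  proof -
    have "ln (Gamma (x + b + 1)) = ln (x + b) + ln (Gamma (x + b))" using G1[of "x + b"] x b by simp
    then show ?thesis using 2 by (simp only:) (simp add: algebra_simps)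
  qed
  then show "(x + b) powr (b - 1) \<le> Gamma (x + b) / Gamma (x + 1)"
    unfolding q powr_def using x b by simp
qed

text \<open>The derivative of a power with exponent e \<le> 0 is largest in absolute value at the
  left end a.\<close>

lemma powr_lipschitz:
  fixes e a x y :: real
  assumes e: "e \<le> 0" and a: "0 < a" "a \<le> x" "a \<le> y"
  shows "\<bar>x powr e - y powr e\<bar> \<le> \<bar>e\<bar> * a powr (e - 1) * \<bar>x - y\<bar>"
proof -
  have "norm (x powr e - y powr e) \<le> \<bar>e\<bar> * a powr (e - 1) * norm (x - y)"
  proof (rule field_differentiable_bound[where S="{a..}" and f'="\<lambda>x. e * x powr (e - 1)"])
    fix z assume z: "z \<in> {a..}"
    show "((\<lambda>x. x powr e) has_field_derivative e * z powr (e - 1)) (at z within {a..})"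
      using z a by (intro DERIV_subset[OF has_real_derivative_powr]) auto
    have "z powr (e - 1) \<le> a powr (e - 1)"
      using z a e by (intro powr_mono2') auto
    then show "norm (e * z powr (e - 1)) \<le> \<bar>e\<bar> * a powr (e - 1)"
      by (simp add: abs_mult mult_left_mono)
  qed (use a in auto)
  then show ?thesis by simp
qed

text \<open>The derivative of the normalisation at x is \<open>a_rate \<beta>\<close> times x to the
  power \<beta> - 1, both for the logarithm and for the power; this treats \<beta> = 0 and \<beta> >
  0 together.\<close>

definition a_rate :: "real \<Rightarrow> real" where
  "a_rate \<beta> = (if \<beta> = 0 then 1 else \<beta>)"

context
  fixes \<beta> :: real
  assumes \<beta>: "0 \<le> \<beta>" "\<beta> < 1"
begin

lemma a_rate_pos: "0 < a_rate \<beta>" and a_rate_le1: "a_rate \<beta> \<le> 1"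
  using \<beta> by (auto simp: a_rate_def)

lemma powr_le_one: "1 \<le> n \<Longrightarrow> real n powr (\<beta> - 1) \<le> 1"
  using powr_mono2'[of "\<beta> - 1" 1 "real n"] \<beta> by simp

lemma a_seq_diff:
  fixes n :: nat
  assumes n: "1 \<le> n"
  shows "a_rate \<beta> * real (Suc n) powr (\<beta> - 1) \<le> a_seq \<beta> (Suc n) - a_seq \<beta> n"
    and "a_seq \<beta> (Suc n) - a_seq \<beta> n \<le> a_rate \<beta> * real n powr (\<beta> - 1)"
proof -
  define f where "f x = (if \<beta> = 0 then ln x else x powr \<beta>)" for x :: real
  have D: "(f has_real_derivative a_rate \<beta> * x powr (\<beta> - 1)) (at x)" if "0 < x" for x
  proof (cases "\<beta> = 0")
    case True
    then have "f = ln" "a_rate \<beta> * x powr (\<beta> - 1) = 1 / x"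
      using that by (auto simp: f_def a_rate_def powr_minus_divide)
    then show ?thesis using DERIV_ln_divide[OF that] by simp
  next
    case False
    then have "f = (\<lambda>x. x powr \<beta>)" "a_rate \<beta> = \<beta>"
      by (auto simp: f_def a_rate_def)
    then show ?thesis using has_real_derivative_powr[OF that, of \<beta>] by simp
  qed
  obtain z where z: "real n < z" "z < real (Suc n)"
    "f (real (Suc n)) - f (real n) = (real (Suc n) - real n) * (a_rate \<beta> * z powr (\<beta> - 1))"
    using MVT2[of "real n" "real (Suc n)" f "\<lambda>x. a_rate \<beta> * x powr (\<beta> - 1)"] D n by fastforce
  have "a_seq \<beta> k = f (real k)" for k
    by (simp add: f_def a_seq_def)
  then have eq: "a_seq \<beta> (Suc n) - a_seq \<beta> n = a_rate \<beta> * z powr (\<beta> - 1)"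
    using z(3) by (simp only:) simp
  have "real (Suc n) powr (\<beta> - 1) \<le> z powr (\<beta> - 1)" "z powr (\<beta> - 1) \<le> real n powr (\<beta> - 1)"
    using z n \<beta> by (auto intro!: powr_mono2')
  then show "a_rate \<beta> * real (Suc n) powr (\<beta> - 1) \<le> a_seq \<beta> (Suc n) - a_seq \<beta> n"
    "a_seq \<beta> (Suc n) - a_seq \<beta> n \<le> a_rate \<beta> * real n powr (\<beta> - 1)"
    unfolding eq using a_rate_pos by (auto intro!: mult_left_mono)
qed

lemma a_seq_mono:
  assumes "1 \<le> n" "n \<le> k" shows "a_seq \<beta> n \<le> a_seq \<beta> k"
  using assms(2,1)
proof (induction k rule: dec_induct)
  case (step k)
  have "0 \<le> a_rate \<beta> * real (Suc k) powr (\<beta> - 1)"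
    using a_rate_pos by simp
  then show ?case using step a_seq_diff(1)[of k] by simp
qed simp

lemma a_seq_Suc_le: "1 \<le> n \<Longrightarrow> a_seq \<beta> (Suc n) \<le> a_seq \<beta> n + 1"
proof -
  assume n: "1 \<le> n"
  have "real n powr (\<beta> - 1) \<le> 1"
    using n by (rule powr_le_one)
  then have "a_rate \<beta> * real n powr (\<beta> - 1) \<le> 1 * 1"
    using a_rate_pos a_rate_le1 by (intro mult_mono) auto
  then show ?thesis using a_seq_diff(2)[OF n] by simp
qed

lemma a_seq_1: "0 \<le> a_seq \<beta> 1" "a_seq \<beta> 1 \<le> 1"
  by (auto simp: a_seq_def)

lemma a_seq_nonneg: "1 \<le> n \<Longrightarrow> 0 \<le> a_seq \<beta> n"
  using a_seq_mono[of 1 n] a_seq_1 by simp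

lemma a_seq_at_top: "filterlim (a_seq \<beta>) at_top sequentially"
proof (cases "\<beta> = 0")
  case True
  have "filterlim (\<lambda>n. ln (real n)) at_top sequentially"
    by (rule filterlim_compose[OF ln_at_top filterlim_real_sequentially])
  then show ?thesis using True by (simp add: a_seq_def[abs_def])
next
  case False
  have "filterlim (\<lambda>n. real n powr \<beta>) at_top sequentially"
    using False \<beta> by (intro filterlim_compose[OF real_powr_at_top filterlim_real_sequentially]) auto
  then show ?thesis using False by (simp add: a_seq_def[abs_def])
qed

text \<open>Telescoping the mean value estimates. In the upper bound the powers appear shifted by
  one index, which costs the difference of the first and the last power, at most 1.\<close>

lemma sum_powr_bounds:
  fixes n :: nat
  assumes n: "1 \<le> n"
  shows "a_seq \<beta> n - 1 \<le> a_rate \<beta> * (\<Sum>j=1..<n. real j powr (\<beta> - 1))"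
    and "a_rate \<beta> * (\<Sum>j=1..<n. real j powr (\<beta> - 1)) \<le> a_seq \<beta> n + 1"
proof -
  have "a_seq \<beta> n - a_seq \<beta> 1 \<le> a_rate \<beta> * (\<Sum>j=1..<n. real j powr (\<beta> - 1)) \<and>
     a_rate \<beta> * (\<Sum>j=1..<n. real j powr (\<beta> - 1)) \<le> a_seq \<beta> n - a_seq \<beta> 1 + a_rate \<beta> * (1 - real n powr (\<beta> - 1))"
    using n
  proof (induction n rule: dec_induct)
    case base
    then show ?case by simp
  next
    case (step k)
    have "(\<Sum>j=1..<Suc k. real j powr (\<beta> - 1)) = (\<Sum>j=1..<k. real j powr (\<beta> - 1)) + real k powr (\<beta> - 1)"
      using step by simp
    then show ?case
      using step(3) a_seq_diff[OF step(1)] by (simp add: algebra_simps)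
  qed
  moreover have "a_rate \<beta> * (1 - real n powr (\<beta> - 1)) \<le> 1 * 1"
    using a_rate_pos a_rate_le1 powr_le_one[OF n] by (intro mult_mono') auto
  ultimately show "a_seq \<beta> n - 1 \<le> a_rate \<beta> * (\<Sum>j=1..<n. real j powr (\<beta> - 1))"
    "a_rate \<beta> * (\<Sum>j=1..<n. real j powr (\<beta> - 1)) \<le> a_seq \<beta> n + 1"
    using a_seq_1 by auto
qed

text \<open>The weights add up to a quantity of order \<open>a_seq \<beta> n\<close>, which tends to
  infinity, so finitely many terms do not matter.\<close>

lemma weighted_cesaro:
  fixes x :: "nat \<Rightarrow> real"
  assumes x: "x \<longlonglongrightarrow> 0" and x0: "\<And>j. 0 \<le> x j"
  shows "(\<lambda>n. (\<Sum>j=1..<n. real j powr (\<beta> - 1) * x j) / a_seq \<beta> n) \<longlonglongrightarrow> 0"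
proof (rule LIMSEQ_I)
  fix e :: real assume e: "0 < e"
  \<comment> \<open>With this threshold the late terms contribute at most e/4 (a_n + 1), below e a_n
    / 2 once a_n > 1; the early terms, at most K, stay below e a_n / 4.\<close>
  define d where "d = e * a_rate \<beta> / 4"
  have d: "0 < d" using e a_rate_pos by (simp add: d_def)
  obtain N where N: "\<And>j. N \<le> j \<Longrightarrow> x j < d"
    using LIMSEQ_D[OF x d] x0 by fastforce
  define K where "K = (\<Sum>j=1..<N. real j powr (\<beta> - 1) * x j)"
  have K: "0 \<le> K" unfolding K_def using x0 by (intro sum_nonneg) auto
  have "eventually (\<lambda>n. max 1 (4 * K / e) < a_seq \<beta> n) sequentially"
    using a_seq_at_top unfolding filterlim_at_top_dense by blast
  then have "eventually (\<lambda>n. norm ((\<Sum>j=1..<n. real j powr (\<beta> - 1) * x j) / a_seq \<beta> n - 0) < e) sequentially"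
    using eventually_ge_at_top[of 1]
  proof eventually_elim
    case (elim n)
    have an: "1 < a_seq \<beta> n" "4 * K < e * a_seq \<beta> n"
      using elim e by (auto simp: field_simps)
    have "(\<Sum>j=1..<n. real j powr (\<beta> - 1) * x j) \<le> (\<Sum>j=1..<n. (if j < N then real j powr (\<beta> - 1) * x j else 0) + real j powr (\<beta> - 1) * d)"
    proof (rule sum_mono)
      fix j assume "j \<in> {1..<n}"
      show "real j powr (\<beta> - 1) * x j \<le> (if j < N then real j powr (\<beta> - 1) * x j else 0) + real j powr (\<beta> - 1) * d"
        using N[of j] d mult_left_mono[of "x j" d "real j powr (\<beta> - 1)"] by (cases "j < N") auto
    qed
    also have "\<dots> = (\<Sum>j=1..<n. if j < N then real j powr (\<beta> - 1) * x j else 0) + d * (\<Sum>j=1..<n. real j powr (\<beta> - 1))"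
      by (simp add: sum.distrib sum_distrib_left mult.commute)
    also have "(\<Sum>j=1..<n. if j < N then real j powr (\<beta> - 1) * x j else 0) \<le> K"
    proof -
      have "(\<Sum>j=1..<n. if j < N then real j powr (\<beta> - 1) * x j else 0) = (\<Sum>j\<in>{j\<in>{1..<n}. j < N}. real j powr (\<beta> - 1) * x j)"
        by (rule sum.inter_filter[symmetric]) simp
      also have "\<dots> \<le> K"
        unfolding K_def using x0 by (intro sum_mono2) auto
      finally show ?thesis .
    qed
    also have "d * (\<Sum>j=1..<n. real j powr (\<beta> - 1)) = e / 4 * (a_rate \<beta> * (\<Sum>j=1..<n. real j powr (\<beta> - 1)))"
      by (simp add: d_def)
    also have "\<dots> \<le> e / 4 * (a_seq \<beta> n + 1)"
      using sum_powr_bounds(2)[OF elim(2)] e by (intro mult_left_mono) auto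
    also have "K + e / 4 * (a_seq \<beta> n + 1) < e * a_seq \<beta> n"
    proof -
      have "e * 1 < e * a_seq \<beta> n" using an e by simp
      moreover have "e / 4 * (a_seq \<beta> n + 1) = e * a_seq \<beta> n / 4 + e / 4"
        by (simp add: algebra_simps)
      ultimately show ?thesis using an e by linarith
    qed
    finally have "(\<Sum>j=1..<n. real j powr (\<beta> - 1) * x j) < e * a_seq \<beta> n" by simp
    moreover have "0 \<le> (\<Sum>j=1..<n. real j powr (\<beta> - 1) * x j)"
      using x0 by (intro sum_nonneg) auto
    ultimately show ?case
      using an by (simp add: divide_simps)
  qed
  then show "\<exists>no. \<forall>n\<ge>no. norm ((\<Sum>j=1..<n. real j powr (\<beta> - 1) * x j) / a_seq \<beta> n - 0) < e"
    by (simp add: eventually_sequentially)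
qed

text \<open>A monotone sequence is controlled by its values at the first times when the normalisation
  reaches the squares.\<close>

definition square_time :: "nat \<Rightarrow> nat" where
  "square_time k = (LEAST n. 1 \<le> n \<and> (real k)\<^sup>2 \<le> a_seq \<beta> n)"

text \<open>Increments of the normalisation are at most 1 and its first value is at most 1, so the
  square is overshot by at most 1 when it is first reached.\<close>

lemma square_time:
  shows "1 \<le> square_time k" "(real k)\<^sup>2 \<le> a_seq \<beta> (square_time k)"
    "a_seq \<beta> (square_time k) \<le> (real k)\<^sup>2 + 1"
    "1 \<le> n \<Longrightarrow> (real k)\<^sup>2 \<le> a_seq \<beta> n \<Longrightarrow> square_time k \<le> n"
    "1 \<le> n \<Longrightarrow> a_seq \<beta> n < (real k)\<^sup>2 \<Longrightarrow> n \<le> square_time k"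
proof -
  have "eventually (\<lambda>n. (real k)\<^sup>2 \<le> a_seq \<beta> n) sequentially"
    using a_seq_at_top by (simp add: filterlim_at_top)
  then obtain N where "\<And>n. N \<le> n \<Longrightarrow> (real k)\<^sup>2 \<le> a_seq \<beta> n"
    by (auto simp: eventually_sequentially)
  then have "1 \<le> max 1 N \<and> (real k)\<^sup>2 \<le> a_seq \<beta> (max 1 N)" by simp
  then have *: "1 \<le> square_time k \<and> (real k)\<^sup>2 \<le> a_seq \<beta> (square_time k)"
    unfolding square_time_def by (rule LeastI)
  then show 1: "1 \<le> square_time k" "(real k)\<^sup>2 \<le> a_seq \<beta> (square_time k)" by auto
  show "square_time k \<le> n" if "1 \<le> n" "(real k)\<^sup>2 \<le> a_seq \<beta> n"
    unfolding square_time_def using that by (intro Least_le) simp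
  show "n \<le> square_time k" if "1 \<le> n" "a_seq \<beta> n < (real k)\<^sup>2"
  proof (rule ccontr)
    assume "\<not> n \<le> square_time k"
    then have "a_seq \<beta> (square_time k) \<le> a_seq \<beta> n"
      using 1 by (intro a_seq_mono) auto
    then show False using 1 that by simp
  qed
  show "a_seq \<beta> (square_time k) \<le> (real k)\<^sup>2 + 1"
  proof (cases "square_time k = 1")
    case True
    then show ?thesis
      using a_seq_1(2) zero_le_power2[of "real k"] unfolding True by linarith
  next
    case False
    then obtain q where q: "square_time k = Suc q" "1 \<le> q"
      using 1(1) by (cases "square_time k") auto
    have "\<not> (1 \<le> q \<and> (real k)\<^sup>2 \<le> a_seq \<beta> q)"
      using not_less_Least[of q "\<lambda>n. 1 \<le> n \<and> (real k)\<^sup>2 \<le> a_seq \<beta> n"] q unfolding square_time_def by simp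
    then show ?thesis
      using q a_seq_Suc_le[OF q(2)] by simp
  qed
qed

text \<open>If a_n lies between consecutive squares, monotonicity places L n between its values at
  the two corresponding times. Consecutive squares have ratio tending to 1, so both bounds have the
  same limit.\<close>

lemma monotone_interpolation:
  fixes L :: "nat \<Rightarrow> real"
  assumes L: "mono L" "\<And>n. 0 \<le> L n"
    and lim: "(\<lambda>k. L (square_time k) / a_seq \<beta> (square_time k)) \<longlonglongrightarrow> l"
  shows "(\<lambda>n. L n / a_seq \<beta> n) \<longlonglongrightarrow> l"
proof -
  let ?t = square_time and ?a = "a_seq \<beta>"
  define k where "k n = nat \<lfloor>sqrt (?a n)\<rfloor>" for n
  have k: "(real (k n))\<^sup>2 \<le> ?a n" "?a n < (real (Suc (k n)))\<^sup>2" if "1 \<le> n" for n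
  proof -
    have a: "0 \<le> ?a n" using a_seq_nonneg[OF that] .
    have le: "real (k n) \<le> sqrt (?a n)" "sqrt (?a n) < real (Suc (k n))"
      unfolding k_def using a by (auto simp: of_nat_nat) linarith
    have "(real (k n))\<^sup>2 \<le> (sqrt (?a n))\<^sup>2"
      using le by (intro power_mono) auto
    moreover have "(sqrt (?a n))\<^sup>2 < (real (Suc (k n)))\<^sup>2"
      using le(2) real_sqrt_ge_zero[OF a] by (rule power_strict_mono) simp
    ultimately show "(real (k n))\<^sup>2 \<le> ?a n" "?a n < (real (Suc (k n)))\<^sup>2"
      using a by auto
  qed
  have ktop: "filterlim k at_top sequentially"
  proof -
    have "filterlim (\<lambda>n. sqrt (?a n)) at_top sequentially"
      by (rule filterlim_compose[OF sqrt_at_top a_seq_at_top])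
    then have "filterlim (\<lambda>n. \<lfloor>sqrt (?a n)\<rfloor>) at_top sequentially"
      by (rule filterlim_compose[OF filterlim_floor_sequentially])
    then show ?thesis
      unfolding k_def by (rule filterlim_compose[OF filterlim_nat_sequentially])
  qed
  have asym: "(\<lambda>k. ?a (?t k) / (real (Suc k))\<^sup>2) \<longlonglongrightarrow> 1"
  proof (rule tendsto_sandwich[OF always_eventually always_eventually])
    show "(\<lambda>k. (real k)\<^sup>2 / (real (Suc k))\<^sup>2) \<longlonglongrightarrow> 1" by real_asymp
    show "(\<lambda>k. ((real k)\<^sup>2 + 1) / (real (Suc k))\<^sup>2) \<longlonglongrightarrow> 1" by real_asymp
  qed (auto intro!: divide_right_mono square_time)
  have asym': "(\<lambda>k. ?a (?t (Suc k)) / (real k)\<^sup>2) \<longlonglongrightarrow> 1"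
  proof (rule tendsto_sandwich[OF always_eventually always_eventually])
    show "(\<lambda>k. (real (Suc k))\<^sup>2 / (real k)\<^sup>2) \<longlonglongrightarrow> 1" by real_asymp
    show "(\<lambda>k. ((real (Suc k))\<^sup>2 + 1) / (real k)\<^sup>2) \<longlonglongrightarrow> 1" by real_asymp
  qed (auto intro!: divide_right_mono square_time simp del: of_nat_Suc)
  have lo: "(\<lambda>k. L (?t k) / (real (Suc k))\<^sup>2) \<longlonglongrightarrow> l"
  proof -
    have "(\<lambda>k. (L (?t k) / ?a (?t k)) * (?a (?t k) / (real (Suc k))\<^sup>2)) \<longlonglongrightarrow> l * 1"
      by (intro tendsto_mult lim asym)
    moreover have "eventually (\<lambda>k. (L (?t k) / ?a (?t k)) * (?a (?t k) / (real (Suc k))\<^sup>2) = L (?t k) / (real (Suc k))\<^sup>2) sequentially"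
      using eventually_gt_at_top[of 0]
    proof eventually_elim
      case (elim k)
      then have "0 < (real k)\<^sup>2" by simp
      then have "?a (?t k) \<noteq> 0" using square_time(2)[of k] by linarith
      then show ?case by simp
    qed
    ultimately show ?thesis using Lim_transform_eventually by force
  qed
  have hi: "(\<lambda>k. L (?t (Suc k)) / (real k)\<^sup>2) \<longlonglongrightarrow> l"
  proof -
    have "(\<lambda>k. (L (?t (Suc k)) / ?a (?t (Suc k))) * (?a (?t (Suc k)) / (real k)\<^sup>2)) \<longlonglongrightarrow> l * 1"
      by (intro tendsto_mult LIMSEQ_Suc[OF lim] asym')
    moreover have "(\<lambda>k. (L (?t (Suc k)) / ?a (?t (Suc k))) * (?a (?t (Suc k)) / (real k)\<^sup>2)) = (\<lambda>k. L (?t (Suc k)) / (real k)\<^sup>2)"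
    proof
      fix k
      have "0 < (real (Suc k))\<^sup>2" by simp
      then have "?a (?t (Suc k)) \<noteq> 0" using square_time(2)[of "Suc k"] by linarith
      then show "(L (?t (Suc k)) / ?a (?t (Suc k))) * (?a (?t (Suc k)) / (real k)\<^sup>2) = L (?t (Suc k)) / (real k)\<^sup>2"
        by simp
    qed
    ultimately show ?thesis by (simp only: mult_1_right)
  qed
  show ?thesis
  proof (rule tendsto_sandwich)
    show "(\<lambda>n. L (?t (k n)) / (real (Suc (k n)))\<^sup>2) \<longlonglongrightarrow> l"
      by (rule filterlim_compose[OF lo ktop])
    show "(\<lambda>n. L (?t (Suc (k n))) / (real (k n))\<^sup>2) \<longlonglongrightarrow> l"
      by (rule filterlim_compose[OF hi ktop])
    have k1: "eventually (\<lambda>n. 1 \<le> k n) sequentially"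
      using ktop by (simp add: filterlim_at_top)
    show "eventually (\<lambda>n. L (?t (k n)) / (real (Suc (k n)))\<^sup>2 \<le> L n / ?a n) sequentially"
      using k1 eventually_ge_at_top[of 1]
    proof eventually_elim
      case (elim n)
      have "1 \<le> (real (k n))\<^sup>2" using elim(1) by simp
      then have "0 < ?a n" using k(1)[OF elim(2)] by linarith
      then show ?case
        using k[OF elim(2)] L square_time(4)[OF elim(2), of "k n"]
        by (intro frac_le monoD[OF L(1)]) auto
    qed
    show "eventually (\<lambda>n. L n / ?a n \<le> L (?t (Suc (k n))) / (real (k n))\<^sup>2) sequentially"
      using k1 eventually_ge_at_top[of 1]
    proof eventually_elim
      case (elim n)
      have "1 \<le> (real (k n))\<^sup>2" using elim(1) by simp
      then show ?case
        using k[OF elim(2)] L square_time(5)[OF elim(2), of "Suc (k n)"] elim(1)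
        by (intro frac_le monoD[OF L(1)]) auto
    qed
  qed
qed

section \<open>Approximation of the increments of the compensator\<close>

context
  fixes \<alpha> c u r :: real
  assumes \<alpha>: "0 < \<alpha>" and c: "- \<beta> < c" and u: "\<beta> < u" and r: "u \<le> r"
begin

text \<open>The constant in the asymptotics: for large s, \<open>Lambda_n\<close> behaves like
  \<open>KL\<close> times s to the power \<beta> - 1.\<close>

definition "KL = \<alpha> * Gamma (c + 1) / Gamma (c + \<beta>)"

lemma KL_pos: "0 < KL"
  unfolding KL_def using \<alpha> c \<beta> by (intro divide_pos_pos mult_pos_pos Gamma_real_pos) auto

lemma Lambda_n_eq: "Lambda_n \<alpha> \<beta> c s = KL * (Gamma (s + c + \<beta>) / Gamma (s + c + 1))"
  by (simp add: Lambda_n_def KL_def add_ac)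

text \<open>Origin of \<lambda>(\<beta>): the increments are close to \<open>KL\<close> times (r j)
  to the power \<beta> - 1, and the sum of j to the power \<beta> - 1 is close to a_n divided by
  \<open>a_rate \<beta>\<close>. For \<beta> = 0 the Gamma quotient in \<open>KL\<close> is
  c.\<close>

lemma lam_const_eq: "lam_const \<alpha> \<beta> c r * a_rate \<beta> = KL * r powr (\<beta> - 1)"
proof (cases "\<beta> = 0")
  case True
  have "0 < Gamma c" "c \<notin> \<int>\<^sub>\<le>\<^sub>0"
    using c True nonpos_Ints_nonpos[of c] by (auto intro!: Gamma_real_pos)
  then have "KL = \<alpha> * c"
    unfolding KL_def using True by (simp add: Gamma_plus1)
  moreover have "r powr (- 1) = 1 / r"
    using r u \<beta> by (simp add: powr_minus_divide)
  ultimately show ?thesis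
    using True by (simp add: lam_const_def a_rate_def)
next
  case False
  have "r powr (\<beta> - 1) = 1 / r powr (1 - \<beta>)"
    using powr_minus_divide[of r "1 - \<beta>"] by simp
  then show ?thesis
    using False by (simp add: lam_const_def a_rate_def KL_def)
qed

text \<open>As c may be negative, s + c is compared with s from below: s + c \<ge> s - \<beta> \<ge>
  (1 - \<beta>/u) s whenever s \<ge> u. The strict bound u > \<beta> makes the factor
  positive.\<close>

definition "shrink = 1 - \<beta> / u"

lemma u0: "0 < u" using u \<beta> by simp

lemma shrink: "0 < shrink" "shrink \<le> 1"
  using u u0 \<beta> by (auto simp: shrink_def)

lemma shrink_le: "u \<le> s \<Longrightarrow> shrink * s \<le> s + c" "u \<le> s \<Longrightarrow> shrink * s \<le> s" "u \<le> s \<Longrightarrow> shrink * s \<le> s + c + \<beta>"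
proof -
  assume s: "u \<le> s"
  have "\<beta> * u \<le> \<beta> * s" using s \<beta> by (intro mult_left_mono) auto
  then have "\<beta> \<le> \<beta> / u * s" using u0 by (simp add: field_simps)
  then show 1: "shrink * s \<le> s + c"
    using c by (simp add: shrink_def algebra_simps)
  then show "shrink * s \<le> s + c + \<beta>" using \<beta> by simp
  show "shrink * s \<le> s"
    using shrink s u0 by (simp add: mult_left_le_one_le)
qed

lemma Lambda_n_upper:
  fixes j :: nat
  assumes j: "1 \<le> j" and s: "real j * u \<le> s"
  shows "Lambda_n \<alpha> \<beta> c s \<le> KL * (shrink * u) powr (\<beta> - 1) * real j powr (\<beta> - 1)"
proof -
  have "1 * u \<le> real j * u" using j u0 by (intro mult_right_mono) auto
  then have us: "u \<le> s" using s by linarith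
  have "0 < shrink * s" using shrink us u0 by simp
  then have x: "0 < s + c" using shrink_le(1)[OF us] by linarith
  have "Gamma (s + c + \<beta>) / Gamma (s + c + 1) \<le> (s + c) powr (\<beta> - 1)"
    using Gamma_quotient_bounds(2)[OF x \<beta>] .
  also have "\<dots> \<le> (shrink * (real j * u)) powr (\<beta> - 1)"
  proof (rule powr_mono2')
    show "shrink * (real j * u) \<le> s + c"
      using shrink_le(1)[OF us] mult_left_mono[OF s, of shrink] shrink by linarith
    show "0 < shrink * (real j * u)" using shrink u0 j by simp
  qed (use \<beta> in simp)
  also have "\<dots> = (shrink * u) powr (\<beta> - 1) * real j powr (\<beta> - 1)"
    using shrink u0 by (simp add: powr_mult[symmetric] mult_ac)
  finally show ?thesis
    unfolding Lambda_n_eq using mult_left_mono[of _ _ KL] KL_pos by (simp only: mult.assoc less_imp_le)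
qed

text \<open>Two errors arise. Replacing the Gamma quotient by a power of s is a bounded shift of the
  argument, by c or c + \<beta>, and costs a summable term of order j to the power \<beta> - 2.
  Replacing s/j by r is a Lipschitz estimate on the half-line from u and keeps the deviation of the
  average as a factor.\<close>

lemma Lambda_n_approx:
  fixes j :: nat
  assumes j: "1 \<le> j" and s: "real j * u \<le> s"
  shows "\<bar>Lambda_n \<alpha> \<beta> c s - KL * r powr (\<beta> - 1) * real j powr (\<beta> - 1)\<bar>
    \<le> KL * (\<bar>c\<bar> + 1) * (shrink * u) powr (\<beta> - 2) * real j powr (\<beta> - 2)
      + KL * u powr (\<beta> - 2) * (real j powr (\<beta> - 1) * \<bar>s / real j - r\<bar>)"
proof -
  have "1 * u \<le> real j * u" using j u0 by (intro mult_right_mono) auto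
  then have us: "u \<le> s" using s by linarith
  have ss: "0 < shrink * s" using shrink us u0 by simp
  have x: "0 < s + c" using shrink_le(1)[OF us] ss by linarith
  let ?g = "Gamma (s + c + \<beta>) / Gamma (s + c + 1)"
  \<comment> \<open>The shifts used are c and c + \<beta>, both at most |c| + 1 in absolute value as
    0 \<le> \<beta> < 1.\<close>
  have lip: "\<bar>(s + d) powr (\<beta> - 1) - s powr (\<beta> - 1)\<bar> \<le> (\<bar>c\<bar> + 1) * (shrink * s) powr (\<beta> - 2)"
    if "shrink * s \<le> s + d" "\<bar>d\<bar> \<le> \<bar>c\<bar> + 1" for d
  proof -
    have "\<bar>(s + d) powr (\<beta> - 1) - s powr (\<beta> - 1)\<bar> \<le> \<bar>\<beta> - 1\<bar> * (shrink * s) powr (\<beta> - 1 - 1) * \<bar>s + d - s\<bar>"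
      using \<beta> ss that shrink_le(2)[OF us] by (intro powr_lipschitz) auto
    also have "\<dots> \<le> 1 * (shrink * s) powr (\<beta> - 1 - 1) * (\<bar>c\<bar> + 1)"
      using \<beta> that by (intro mult_mono) auto
    finally show ?thesis by (simp add: mult.commute)
  qed
  have 1: "\<bar>(s + c) powr (\<beta> - 1) - s powr (\<beta> - 1)\<bar> \<le> (\<bar>c\<bar> + 1) * (shrink * s) powr (\<beta> - 2)"
    using shrink_le(1)[OF us] by (intro lip) auto
  have 2: "\<bar>(s + (c + \<beta>)) powr (\<beta> - 1) - s powr (\<beta> - 1)\<bar> \<le> (\<bar>c\<bar> + 1) * (shrink * s) powr (\<beta> - 2)"
    using shrink_le(3)[OF us] \<beta> by (intro lip) auto
  have g1: "\<bar>?g - s powr (\<beta> - 1)\<bar> \<le> (\<bar>c\<bar> + 1) * (shrink * s) powr (\<beta> - 2)"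
    using Gamma_quotient_bounds[OF x \<beta>] 1 2 by (simp add: add.assoc)
  also have "\<dots> \<le> (\<bar>c\<bar> + 1) * (shrink * (real j * u)) powr (\<beta> - 2)"
    using s shrink u0 j \<beta> by (intro mult_left_mono powr_mono2') auto
  also have "(shrink * (real j * u)) powr (\<beta> - 2) = (shrink * u) powr (\<beta> - 2) * real j powr (\<beta> - 2)"
    using shrink u0 by (simp add: powr_mult[symmetric] mult_ac)
  finally have g1: "\<bar>?g - s powr (\<beta> - 1)\<bar> \<le> (\<bar>c\<bar> + 1) * ((shrink * u) powr (\<beta> - 2) * real j powr (\<beta> - 2))" .
  have j0: "0 < real j" using j by simp
  have sj: "u \<le> s / real j" using s j0 by (simp add: field_simps)
  have "s powr (\<beta> - 1) = real j powr (\<beta> - 1) * (s / real j) powr (\<beta> - 1)"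
    using j0 us u0 by (simp add: powr_mult[symmetric])
  then have "\<bar>s powr (\<beta> - 1) - r powr (\<beta> - 1) * real j powr (\<beta> - 1)\<bar>
      = real j powr (\<beta> - 1) * \<bar>(s / real j) powr (\<beta> - 1) - r powr (\<beta> - 1)\<bar>"
  proof -
    assume *: "s powr (\<beta> - 1) = real j powr (\<beta> - 1) * (s / real j) powr (\<beta> - 1)"
    have "s powr (\<beta> - 1) - r powr (\<beta> - 1) * real j powr (\<beta> - 1)
        = real j powr (\<beta> - 1) * ((s / real j) powr (\<beta> - 1) - r powr (\<beta> - 1))"
      unfolding * by (simp only: right_diff_distrib mult.commute)
    then show ?thesis by (simp add: abs_mult)
  qed
  also have "\<dots> \<le> real j powr (\<beta> - 1) * (1 * u powr (\<beta> - 1 - 1) * \<bar>s / real j - r\<bar>)"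
  proof (rule mult_left_mono)
    have "\<bar>(s / real j) powr (\<beta> - 1) - r powr (\<beta> - 1)\<bar> \<le> \<bar>\<beta> - 1\<bar> * u powr (\<beta> - 1 - 1) * \<bar>s / real j - r\<bar>"
      using \<beta> u0 sj r by (intro powr_lipschitz) auto
    also have "\<dots> \<le> 1 * u powr (\<beta> - 1 - 1) * \<bar>s / real j - r\<bar>"
      using \<beta> by (intro mult_right_mono) auto
    finally show "\<bar>(s / real j) powr (\<beta> - 1) - r powr (\<beta> - 1)\<bar> \<le> 1 * u powr (\<beta> - 1 - 1) * \<bar>s / real j - r\<bar>" .
  qed simp
  finally have g2: "\<bar>s powr (\<beta> - 1) - r powr (\<beta> - 1) * real j powr (\<beta> - 1)\<bar>
      \<le> u powr (\<beta> - 2) * (real j powr (\<beta> - 1) * \<bar>s / real j - r\<bar>)"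
    by (simp add: mult_ac)
  have "\<bar>?g - r powr (\<beta> - 1) * real j powr (\<beta> - 1)\<bar>
      \<le> (\<bar>c\<bar> + 1) * ((shrink * u) powr (\<beta> - 2) * real j powr (\<beta> - 2)) + u powr (\<beta> - 2) * (real j powr (\<beta> - 1) * \<bar>s / real j - r\<bar>)"
    using g1 g2 by linarith
  then have "KL * \<bar>?g - r powr (\<beta> - 1) * real j powr (\<beta> - 1)\<bar>
      \<le> KL * ((\<bar>c\<bar> + 1) * ((shrink * u) powr (\<beta> - 2) * real j powr (\<beta> - 2)) + u powr (\<beta> - 2) * (real j powr (\<beta> - 1) * \<bar>s / real j - r\<bar>))"
    using KL_pos by (intro mult_left_mono) auto
  moreover have "\<bar>Lambda_n \<alpha> \<beta> c s - KL * r powr (\<beta> - 1) * real j powr (\<beta> - 1)\<bar> = KL * \<bar>?g - r powr (\<beta> - 1) * real j powr (\<beta> - 1)\<bar>"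
  proof -
    have "Lambda_n \<alpha> \<beta> c s - KL * r powr (\<beta> - 1) * real j powr (\<beta> - 1) = KL * (?g - r powr (\<beta> - 1) * real j powr (\<beta> - 1))"
      unfolding Lambda_n_eq by (simp only: right_diff_distrib mult.assoc)
    then show ?thesis using KL_pos by (simp only: abs_mult abs_of_pos)
  qed
  ultimately show ?thesis
    by (simp add: algebra_simps)
qed

lemma Lambda_n_0: "Lambda_n \<alpha> \<beta> c 0 = \<alpha>"
proof -
  have "0 < Gamma (c + \<beta>)" "0 < Gamma (c + 1)"
    using c \<beta> by (auto intro!: Gamma_real_pos)
  then show ?thesis by (simp add: Lambda_n_def)
qed

text \<open>The constants are uniform over all admissible sequences of partial sums. Hence one
  deterministic inequality serves the almost sure limit as well as the estimate in mean.\<close>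

lemma sum_Lambda_approx:
  obtains C1 C2 where "0 \<le> C1" "0 \<le> C2" "\<And>(s :: nat \<Rightarrow> real) n. s 0 = 0 \<Longrightarrow> (\<And>j. real j * u \<le> s j) \<Longrightarrow> 1 \<le> n \<Longrightarrow>
     \<bar>(\<Sum>j<n. Lambda_n \<alpha> \<beta> c (s j)) - lam_const \<alpha> \<beta> c r * a_seq \<beta> n\<bar>
       \<le> C1 + C2 * (\<Sum>j=1..<n. real j powr (\<beta> - 1) * \<bar>s j / real j - r\<bar>)"
proof -
  have lam0: "0 \<le> lam_const \<alpha> \<beta> c r"
  proof -
    have "0 \<le> lam_const \<alpha> \<beta> c r * a_rate \<beta>"
      unfolding lam_const_eq using KL_pos by simp
    then show ?thesis using a_rate_pos by (simp add: zero_le_mult_iff)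
  qed
  define C where "C = KL * (\<bar>c\<bar> + 1) * (shrink * u) powr (\<beta> - 2)"
  define C2 where "C2 = KL * u powr (\<beta> - 2)"
  have C0: "0 \<le> C" "0 \<le> C2" unfolding C_def C2_def using KL_pos by auto
  have su: "summable (\<lambda>j. real j powr (\<beta> - 2))"
    using \<beta> by (subst summable_real_powr_iff) auto
  define Z where "Z = (\<Sum>j. real j powr (\<beta> - 2))"
  have Z0: "0 \<le> Z" unfolding Z_def by (intro suminf_nonneg su) auto
  show thesis
  \<comment> \<open>The first constant collects the term j = 0, which is \<alpha>, the summable
    errors, and \<open>lam_const\<close> times the distance, at most 1, between the rescaled sum of
    powers and a_n.\<close>
  proof (rule that[of "\<alpha> + C * Z + lam_const \<alpha> \<beta> c r" C2])
    show "0 \<le> \<alpha> + C * Z + lam_const \<alpha> \<beta> c r" using \<alpha> C0 Z0 lam0 by simp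
    show "0 \<le> C2" by fact
    fix s :: "nat \<Rightarrow> real" and n :: nat assume s: "s 0 = 0" "\<And>j. real j * u \<le> s j" and n: "1 \<le> n"
    let ?\<rho> = "KL * r powr (\<beta> - 1)"
    have "{..<n} = insert 0 {1..<n}" using n by auto
    then have 1: "(\<Sum>j<n. Lambda_n \<alpha> \<beta> c (s j)) = \<alpha> + (\<Sum>j=1..<n. Lambda_n \<alpha> \<beta> c (s j))"
      using s Lambda_n_0 by simp
    have "\<bar>(\<Sum>j=1..<n. Lambda_n \<alpha> \<beta> c (s j)) - ?\<rho> * (\<Sum>j=1..<n. real j powr (\<beta> - 1))\<bar>
        = \<bar>\<Sum>j=1..<n. (Lambda_n \<alpha> \<beta> c (s j) - ?\<rho> * real j powr (\<beta> - 1))\<bar>"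
      by (simp add: sum_subtractf sum_distrib_left)
    also have "\<dots> \<le> (\<Sum>j=1..<n. \<bar>Lambda_n \<alpha> \<beta> c (s j) - ?\<rho> * real j powr (\<beta> - 1)\<bar>)"
      by (rule sum_abs)
    also have "\<dots> \<le> (\<Sum>j=1..<n. C * real j powr (\<beta> - 2) + C2 * (real j powr (\<beta> - 1) * \<bar>s j / real j - r\<bar>))"
      unfolding C_def C2_def using s by (intro sum_mono Lambda_n_approx) auto
    also have "\<dots> = C * (\<Sum>j=1..<n. real j powr (\<beta> - 2)) + C2 * (\<Sum>j=1..<n. real j powr (\<beta> - 1) * \<bar>s j / real j - r\<bar>)"
      by (simp add: sum.distrib sum_distrib_left)
    also have "(\<Sum>j=1..<n. real j powr (\<beta> - 2)) \<le> Z"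
      unfolding Z_def by (intro sum_le_suminf su) auto
    finally have 2: "\<bar>(\<Sum>j=1..<n. Lambda_n \<alpha> \<beta> c (s j)) - ?\<rho> * (\<Sum>j=1..<n. real j powr (\<beta> - 1))\<bar>
        \<le> C * Z + C2 * (\<Sum>j=1..<n. real j powr (\<beta> - 1) * \<bar>s j / real j - r\<bar>)"
      using C0 by (simp add: mult_left_mono)
    have "\<bar>a_rate \<beta> * (\<Sum>j=1..<n. real j powr (\<beta> - 1)) - a_seq \<beta> n\<bar> \<le> 1"
      using sum_powr_bounds[OF n] by linarith
    then have "lam_const \<alpha> \<beta> c r * \<bar>a_rate \<beta> * (\<Sum>j=1..<n. real j powr (\<beta> - 1)) - a_seq \<beta> n\<bar> \<le> lam_const \<alpha> \<beta> c r * 1"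
      using lam0 by (rule mult_left_mono)
    moreover have "lam_const \<alpha> \<beta> c r * \<bar>a_rate \<beta> * (\<Sum>j=1..<n. real j powr (\<beta> - 1)) - a_seq \<beta> n\<bar>
        = \<bar>?\<rho> * (\<Sum>j=1..<n. real j powr (\<beta> - 1)) - lam_const \<alpha> \<beta> c r * a_seq \<beta> n\<bar>"
      using lam0 unfolding lam_const_eq[symmetric]
      by (subst abs_of_nonneg[OF lam0, symmetric], subst abs_mult[symmetric]) (simp add: algebra_simps)
    ultimately show "\<bar>(\<Sum>j<n. Lambda_n \<alpha> \<beta> c (s j)) - lam_const \<alpha> \<beta> c r * a_seq \<beta> n\<bar>
       \<le> (\<alpha> + C * Z + lam_const \<alpha> \<beta> c r) + C2 * (\<Sum>j=1..<n. real j powr (\<beta> - 1) * \<bar>s j / real j - r\<bar>)"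
      using 1 2 \<alpha> by linarith
  qed
qed

end

end

lemma sum_Lambda_upper:
  fixes \<alpha> \<beta> c u :: real
  assumes \<beta>: "0 \<le> \<beta>" "\<beta> < 1" and \<alpha>: "0 < \<alpha>" and c: "- \<beta> < c" and u: "\<beta> < u"
  obtains C where "0 < C" "\<And>(s :: nat \<Rightarrow> real) n. s 0 = 0 \<Longrightarrow> (\<And>j. real j * u \<le> s j) \<Longrightarrow> 1 \<le> n \<Longrightarrow>
     (\<Sum>j<n. Lambda_n \<alpha> \<beta> c (s j)) \<le> C * (a_seq \<beta> n + 1)"
proof -
  \<comment> \<open>The upper bound does not involve r; the context is instantiated at r =
    u.\<close>
  note ctx = \<beta> \<alpha> c u order_refl[of u]
  define K where "K = KL \<beta> \<alpha> c * (shrink \<beta> u * u) powr (\<beta> - 1)"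
  have K: "0 \<le> K" unfolding K_def using KL_pos[OF ctx] by simp
  note ar = a_rate_pos[OF \<beta>]
  show thesis
  proof (rule that[of "\<alpha> + K / a_rate \<beta>"])
    show "0 < \<alpha> + K / a_rate \<beta>" using \<alpha> K ar by (simp add: add_pos_nonneg)
    fix s :: "nat \<Rightarrow> real" and n :: nat assume s: "s 0 = 0" "\<And>j. real j * u \<le> s j" and n: "1 \<le> n"
    have "{..<n} = insert 0 {1..<n}" using n by auto
    then have "(\<Sum>j<n. Lambda_n \<alpha> \<beta> c (s j)) = \<alpha> + (\<Sum>j=1..<n. Lambda_n \<alpha> \<beta> c (s j))"
      using s Lambda_n_0[OF ctx] by simp
    also have "(\<Sum>j=1..<n. Lambda_n \<alpha> \<beta> c (s j)) \<le> (\<Sum>j=1..<n. K * real j powr (\<beta> - 1))"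
      unfolding K_def using s by (intro sum_mono Lambda_n_upper[OF ctx]) auto
    also have "\<dots> = K / a_rate \<beta> * (a_rate \<beta> * (\<Sum>j=1..<n. real j powr (\<beta> - 1)))"
      using ar by (simp add: sum_distrib_left)
    also have "\<dots> \<le> K / a_rate \<beta> * (a_seq \<beta> n + 1)"
      using sum_powr_bounds(2)[OF \<beta> n] K ar by (intro mult_left_mono) auto
    finally have "(\<Sum>j<n. Lambda_n \<alpha> \<beta> c (s j)) \<le> \<alpha> + K / a_rate \<beta> * (a_seq \<beta> n + 1)"
      by simp
    moreover have "\<alpha> \<le> \<alpha> * (a_seq \<beta> n + 1)"
      using a_seq_nonneg[OF \<beta> n] \<alpha> by simp
    ultimately show "(\<Sum>j<n. Lambda_n \<alpha> \<beta> c (s j)) \<le> (\<alpha> + K / a_rate \<beta>) * (a_seq \<beta> n + 1)"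
      unfolding distrib_right by linarith
  qed
qed

section \<open>The strong law\<close>

lemma exp_le_quadratic:
  fixes x :: real assumes "\<bar>x\<bar> \<le> 1" shows "exp x \<le> 1 + x + x\<^sup>2"
proof (cases "0 \<le> x")
  case True
  then show ?thesis using assms exp_bound[of x] by simp
next
  case False
  define t where "t = - x"
  have t: "0 < t" "t \<le> 1" using False assms by (auto simp: t_def)
  \<comment> \<open>For negative arguments exp (- t) \<le> 1/(1 + t), and this identity bounds the
    fraction by the quadratic.\<close>
  have "(1 + t) * (1 - t + t\<^sup>2) = 1 + t ^ 3"
    by (simp add: algebra_simps power2_eq_square power3_eq_cube)
  then have "1 \<le> (1 + t) * (1 - t + t\<^sup>2)" using t by simp
  then have "1 / (1 + t) \<le> 1 - t + t\<^sup>2" using t by (simp add: field_simps)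
  moreover have "exp (- t) \<le> 1 / (1 + t)"
    using exp_ge_add_one_self[of t] t by (simp add: exp_minus field_simps)
  ultimately show ?thesis by (simp add: t_def)
qed

lemma poisson_exp_moment: "(\<lambda>k. exp (\<theta> * real k) * poisson_prob x k) sums exp (x * (exp \<theta> - 1))"
proof -
  have "(\<lambda>k. (x * exp \<theta>) ^ k / fact k * exp (- x)) sums (exp (x * exp \<theta>) * exp (- x))"
    using exp_converges[of "x * exp \<theta>"] by (intro sums_mult2) (simp add: divide_inverse mult.commute scaleR_conv_of_real)
  moreover have "exp (x * exp \<theta>) * exp (- x) = exp (x * (exp \<theta> - 1))"
    by (simp add: exp_add[symmetric] algebra_simps)
  moreover have "(\<lambda>k. (x * exp \<theta>) ^ k / fact k * exp (- x)) = (\<lambda>k. exp (\<theta> * real k) * poisson_prob x k)"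
    by (simp add: power_mult_distrib exp_of_nat_mult[symmetric] mult_ac)
  ultimately show ?thesis by simp
qed

lemma poisson_prob_nonneg: "0 \<le> x \<Longrightarrow> 0 \<le> poisson_prob x k"
  by simp

section \<open>The exponential martingale and deviation bounds\<close>

context ibp
begin

definition cnt :: "nat \<Rightarrow> 'o \<Rightarrow> real" where
  "cnt n \<omega> = real (card (B \<inter> feat M n \<omega>))"

definition comp :: "nat \<Rightarrow> 'o \<Rightarrow> real" where
  "comp n \<omega> = (\<Sum>j<n. rate j \<omega>)"

lemma cnt_0: "cnt 0 \<omega> = 0"
  by (simp add: cnt_def card_feat_0)

lemma cnt_Suc: "\<omega> \<in> space P \<Longrightarrow> cnt (Suc n) \<omega> = cnt n \<omega> + real (newc n \<omega>)"
  by (simp add: cnt_def card_feat_Suc)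

lemma cnt_mono: "\<omega> \<in> space P \<Longrightarrow> mono (\<lambda>n. cnt n \<omega>)"
  by (intro mono_iff_le_Suc[THEN iffD2] allI) (simp add: cnt_Suc)

lemma cnt_measurable_F: "cnt n \<in> borel_measurable (F n)"
  unfolding cnt_def[abs_def] by (intro measurable_compose[OF card_feat_measurable]) simp

text \<open>Predictability: the sum up to index n + 1, exclusive, uses only rates known at time n.
  It can therefore be moved into the past-measurable factor before the step from n to n + 1.\<close>

lemma comp_measurable_F: "comp (Suc n) \<in> borel_measurable (F n)"
  unfolding comp_def[abs_def] by (intro borel_measurable_sum measurable_F_mono[OF rate_measurable]) auto

lemma comp_measurable: "comp n \<in> borel_measurable P"
  unfolding comp_def[abs_def] by (intro borel_measurable_sum measurable_F_P[OF rate_measurable])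

lemma cnt_measurable: "cnt n \<in> borel_measurable P"
  by (rule measurable_F_P[OF cnt_measurable_F])

lemma comp_nonneg: "\<omega> \<in> space P \<Longrightarrow> 0 \<le> comp n \<omega>"
  unfolding comp_def by (intro sum_nonneg rate_nonneg)

lemma comp_eq: "comp n \<omega> = measure m B * (\<Sum>j<n. Lambda_n \<alpha> \<beta> c (Rsum j \<omega>))"
  by (simp add: comp_def rate_def sum_distrib_left mult.commute)

text \<open>A deterministic bound, valid for every outcome. It rests on the lower bound u for the
  weights and keeps exponentials of the compensator bounded at each fixed time.\<close>

lemma comp_upper:
  obtains C where "0 < C" "\<And>n \<omega>. 1 \<le> n \<Longrightarrow> \<omega> \<in> space P \<Longrightarrow> comp n \<omega> \<le> C * (a_seq \<beta> n + 1)"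
proof -
  obtain C where C: "0 < C" "\<And>(s :: nat \<Rightarrow> real) n. s 0 = 0 \<Longrightarrow> (\<And>j. real j * u \<le> s j) \<Longrightarrow> 1 \<le> n \<Longrightarrow>
     (\<Sum>j<n. Lambda_n \<alpha> \<beta> c (s j)) \<le> C * (a_seq \<beta> n + 1)"
    using sum_Lambda_upper[OF \<beta> \<alpha> c u] by blast
  show thesis
  proof (rule that[OF C(1)])
    fix n \<omega> assume n: "1 \<le> (n::nat)" and \<omega>: "\<omega> \<in> space P"
    have "(\<Sum>j<n. Lambda_n \<alpha> \<beta> c (Rsum j \<omega>)) \<le> C * (a_seq \<beta> n + 1)"
      using Rsum_lower[OF \<omega>] by (intro C(2) n) (auto simp: Rsum_def)
    moreover have "0 \<le> C * (a_seq \<beta> n + 1)"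
      using a_seq_nonneg[OF \<beta> n] C(1) by simp
    moreover have "measure m B \<le> 1"
      using m_prob by (rule prob_space.prob_le_1)
    moreover have "0 \<le> (\<Sum>j<n. Lambda_n \<alpha> \<beta> c (Rsum j \<omega>))"
      using Lambda_pos[OF \<omega>] by (intro sum_nonneg) (auto intro: less_imp_le)
    ultimately have "measure m B * (\<Sum>j<n. Lambda_n \<alpha> \<beta> c (Rsum j \<omega>)) \<le> 1 * (C * (a_seq \<beta> n + 1))"
      by (intro mult_mono) auto
    then show "comp n \<omega> \<le> C * (a_seq \<beta> n + 1)"
      by (simp add: comp_eq)
  qed
qed

lemma newc_event: "{\<omega>\<in>space P. newc n \<omega> = k} \<in> sets P"
proof -
  have [measurable]: "newc n \<in> measurable P (count_space UNIV)"
    using newc_measurable by (rule measurable_F_P)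
  show ?thesis by measurable
qed

lemma poisson_prob_rate_measurable: "(\<lambda>\<omega>. poisson_prob (rate n \<omega>) k) \<in> borel_measurable (F n)"
  using rate_measurable[of n] by measurable

text \<open>Extends the conditional Poisson law from events of the past to past-measurable weights:
  each Poisson probability is a version of the conditional probability of the corresponding event.
  The function h is arbitrary since only countably many values occur.\<close>

lemma nn_integral_newc:
  assumes G: "G \<in> borel_measurable (F n)"
  shows "(\<integral>\<^sup>+\<omega>. G \<omega> * h (newc n \<omega>) \<partial>P) = (\<integral>\<^sup>+\<omega>. G \<omega> * (\<Sum>k. h k * ennreal (poisson_prob (rate n \<omega>) k)) \<partial>P)"
proof -
  interpret finite_measure_subalgebra P "F n" by unfold_locales (rule subalgebra_F)
  have [measurable]: "G \<in> borel_measurable P" using G by (rule measurable_F_P)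
  define pp where "pp k \<omega> = ennreal (poisson_prob (rate n \<omega>) k)" for k \<omega>
  have ppF: "pp k \<in> borel_measurable (F n)" for k
    unfolding pp_def[abs_def] using poisson_prob_rate_measurable by (rule measurable_compose) simp
  have [measurable]: "pp k \<in> borel_measurable P" for k
    using ppF by (rule measurable_F_P)
  have [measurable]: "{\<omega>\<in>space P. newc n \<omega> = k} \<in> sets P" for k by (rule newc_event)
  have one: "(\<integral>\<^sup>+\<omega>. G \<omega> * indicator {\<omega>\<in>space P. newc n \<omega> = k} \<omega> \<partial>P)
      = (\<integral>\<^sup>+\<omega>. G \<omega> * pp k \<omega> \<partial>P)" for k
  proof -
    have "AE \<omega> in P. pp k \<omega> = nn_cond_exp P (F n) (indicator {\<omega>\<in>space P. newc n \<omega> = k}) \<omega>"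
    proof (rule nn_cond_exp_charact)
      fix A assume A: "A \<in> sets (F n)"
      have AP: "A \<in> sets P" using A subalgebra_F[of n] by (auto simp: subalgebra_def)
      have "(\<integral>\<^sup>+\<omega>\<in>A. indicator {\<omega>\<in>space P. newc n \<omega> = k} \<omega> \<partial>P) = (\<integral>\<^sup>+\<omega>. indicator {\<omega>\<in>A. newc n \<omega> = k} \<omega> \<partial>P)"
        using sets.sets_into_space[OF AP] by (intro nn_integral_cong) (auto split: split_indicator)
      also have "\<dots> = emeasure P {\<omega>\<in>A. newc n \<omega> = k}"
      proof -
        have "{\<omega>\<in>A. newc n \<omega> = k} = A \<inter> {\<omega>\<in>space P. newc n \<omega> = k}"
          using sets.sets_into_space[OF AP] by auto
        then show ?thesis using AP newc_event by simp
      qed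
      finally show "(\<integral>\<^sup>+\<omega>\<in>A. indicator {\<omega>\<in>space P. newc n \<omega> = k} \<omega> \<partial>P) = (\<integral>\<^sup>+\<omega>\<in>A. pp k \<omega> \<partial>P)"
        unfolding newc_law[OF A] pp_def .
    qed (use ppF newc_event in auto)
    then have "(\<integral>\<^sup>+\<omega>. G \<omega> * pp k \<omega> \<partial>P)
        = (\<integral>\<^sup>+\<omega>. G \<omega> * nn_cond_exp P (F n) (indicator {\<omega>\<in>space P. newc n \<omega> = k}) \<omega> \<partial>P)"
      by (intro nn_integral_cong_AE) (auto elim: eventually_mono)
    also have "\<dots> = (\<integral>\<^sup>+\<omega>. G \<omega> * indicator {\<omega>\<in>space P. newc n \<omega> = k} \<omega> \<partial>P)"
      using newc_event by (intro nn_cond_exp_intg G) auto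
    finally show ?thesis ..
  qed
  have "(\<integral>\<^sup>+\<omega>. G \<omega> * h (newc n \<omega>) \<partial>P) = (\<integral>\<^sup>+\<omega>. (\<Sum>k. h k * (G \<omega> * indicator {\<omega>\<in>space P. newc n \<omega> = k} \<omega>)) \<partial>P)"
  proof (rule nn_integral_cong)
    fix \<omega> assume "\<omega> \<in> space P"
    then have "(\<lambda>k. h k * (G \<omega> * indicator {\<omega>\<in>space P. newc n \<omega> = k} \<omega>)) = (\<lambda>k. if k = newc n \<omega> then G \<omega> * h (newc n \<omega>) else 0)"
      by (auto simp: fun_eq_iff mult.commute split: split_indicator)
    then show "G \<omega> * h (newc n \<omega>) = (\<Sum>k. h k * (G \<omega> * indicator {\<omega>\<in>space P. newc n \<omega> = k} \<omega>))"
      using sums_unique[OF sums_If_finite[of "\<lambda>k. k = newc n \<omega>" "\<lambda>k. G \<omega> * h (newc n \<omega>)"]] by simp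
  qed
  also have "\<dots> = (\<Sum>k. h k * (\<integral>\<^sup>+\<omega>. G \<omega> * indicator {\<omega>\<in>space P. newc n \<omega> = k} \<omega> \<partial>P))"
    by (simp add: nn_integral_suminf nn_integral_cmult)
  also have "\<dots> = (\<Sum>k. h k * (\<integral>\<^sup>+\<omega>. G \<omega> * pp k \<omega> \<partial>P))"
    by (simp only: one)
  also have "\<dots> = (\<integral>\<^sup>+\<omega>. (\<Sum>k. h k * (G \<omega> * pp k \<omega>)) \<partial>P)"
    by (simp add: nn_integral_suminf nn_integral_cmult)
  also have "\<dots> = (\<integral>\<^sup>+\<omega>. G \<omega> * (\<Sum>k. h k * pp k \<omega>) \<partial>P)"
    by (intro nn_integral_cong) (simp only: ennreal_suminf_cmult[symmetric] mult.left_commute)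
  finally show ?thesis unfolding pp_def .
qed

text \<open>The factor with \<open>comp (Suc n)\<close> is measurable at time n, and the Poisson
  generating function of the remaining increment cancels exactly the last summand of the
  compensator. In \<open>ennreal\<close> no integrability has to be checked.\<close>

lemma exp_martingale: "(\<integral>\<^sup>+\<omega>. ennreal (exp (\<theta> * cnt n \<omega> - comp n \<omega> * (exp \<theta> - 1))) \<partial>P) = 1"
proof (induction n)
  case 0
  show ?case by (simp add: cnt_0 comp_def emeasure_space_1)
next
  case (Suc n)
  define G where "G \<omega> = ennreal (exp (\<theta> * cnt n \<omega> - comp (Suc n) \<omega> * (exp \<theta> - 1)))" for \<omega>
  have G: "G \<in> borel_measurable (F n)"
    unfolding G_def[abs_def] using cnt_measurable_F[of n] comp_measurable_F[of n] by measurable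
  have "(\<integral>\<^sup>+\<omega>. ennreal (exp (\<theta> * cnt (Suc n) \<omega> - comp (Suc n) \<omega> * (exp \<theta> - 1))) \<partial>P)
      = (\<integral>\<^sup>+\<omega>. G \<omega> * ennreal (exp (\<theta> * real (newc n \<omega>))) \<partial>P)"
    unfolding G_def by (intro nn_integral_cong)
      (simp add: cnt_Suc ennreal_mult[symmetric] exp_add[symmetric] algebra_simps)
  also have "\<dots> = (\<integral>\<^sup>+\<omega>. G \<omega> * (\<Sum>k. ennreal (exp (\<theta> * real k)) * ennreal (poisson_prob (rate n \<omega>) k)) \<partial>P)"
    by (rule nn_integral_newc[OF G])
  also have "\<dots> = (\<integral>\<^sup>+\<omega>. ennreal (exp (\<theta> * cnt n \<omega> - comp n \<omega> * (exp \<theta> - 1))) \<partial>P)"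
  proof (rule nn_integral_cong)
    fix \<omega> assume \<omega>: "\<omega> \<in> space P"
    note s = poisson_exp_moment[of \<theta> "rate n \<omega>"]
    have "(\<Sum>k. ennreal (exp (\<theta> * real k)) * ennreal (poisson_prob (rate n \<omega>) k))
        = (\<Sum>k. ennreal (exp (\<theta> * real k) * poisson_prob (rate n \<omega>) k))"
      using rate_nonneg[OF \<omega>] by (simp add: ennreal_mult[symmetric])
    also have "\<dots> = ennreal (exp (rate n \<omega> * (exp \<theta> - 1)))"
      using rate_nonneg[OF \<omega>] s by (subst suminf_ennreal2) (auto simp: sums_iff)
    finally show "G \<omega> * (\<Sum>k. ennreal (exp (\<theta> * real k)) * ennreal (poisson_prob (rate n \<omega>) k))
        = ennreal (exp (\<theta> * cnt n \<omega> - comp n \<omega> * (exp \<theta> - 1)))"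
      unfolding G_def comp_def
      by (simp only: ennreal_mult[symmetric] exp_ge_zero exp_add[symmetric]) (simp add: algebra_simps)
  qed
  finally show ?case using Suc by simp
qed

text \<open>Markov's inequality for the exponential martingale, whose mean is 1. Any event on which
  the exponent is at least t is allowed, and \<theta> may have either sign, so both tails are
  covered.\<close>

lemma exp_tail:
  assumes "\<And>\<omega>. \<omega> \<in> space P \<Longrightarrow> E \<omega> \<Longrightarrow> t \<le> \<theta> * cnt n \<omega> - comp n \<omega> * (exp \<theta> - 1)"
    and E: "{\<omega>\<in>space P. E \<omega>} \<in> sets P"
  shows "prob {\<omega>\<in>space P. E \<omega>} \<le> exp (- t)"
proof -
  let ?U = "\<lambda>\<omega>. ennreal (exp (\<theta> * cnt n \<omega> - comp n \<omega> * (exp \<theta> - 1)))"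
  have U[measurable]: "?U \<in> borel_measurable P"
    using cnt_measurable[of n] comp_measurable[of n] by measurable
  have "emeasure P {\<omega>\<in>space P. E \<omega>} \<le> emeasure P {\<omega>\<in>space P. 1 \<le> ennreal (exp (- t)) * ?U \<omega>}"
  proof (rule emeasure_mono)
    show "{\<omega>\<in>space P. E \<omega>} \<subseteq> {\<omega>\<in>space P. 1 \<le> ennreal (exp (- t)) * ?U \<omega>}"
    proof safe
      fix \<omega> assume "\<omega> \<in> space P" "E \<omega>"
      then have "0 \<le> - t + (\<theta> * cnt n \<omega> - comp n \<omega> * (exp \<theta> - 1))"
        using assms(1)[of \<omega>] by simp
      then have "1 \<le> exp (- t) * exp (\<theta> * cnt n \<omega> - comp n \<omega> * (exp \<theta> - 1))"
        by (simp only: exp_add[symmetric] one_le_exp_iff)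
      then show "1 \<le> ennreal (exp (- t)) * ?U \<omega>"
        by (simp only: ennreal_mult[symmetric] exp_ge_zero) (simp only: ennreal_1[symmetric] ennreal_leI)
    qed
  qed measurable
  also have "\<dots> \<le> ennreal (exp (- t)) * (\<integral>\<^sup>+\<omega>. ?U \<omega> * indicator (space P) \<omega> \<partial>P)"
    by (rule nn_integral_Markov_inequality) auto
  also have "(\<integral>\<^sup>+\<omega>. ?U \<omega> * indicator (space P) \<omega> \<partial>P) = (\<integral>\<^sup>+\<omega>. ?U \<omega> \<partial>P)"
    by (intro nn_integral_cong) simp
  finally show ?thesis
    unfolding exp_martingale by (simp add: emeasure_eq_measure)
qed

lemma deviation_bound:
  assumes e: "0 < e"
  obtains \<kappa> where "0 < \<kappa>" "\<And>n. 1 \<le> n \<Longrightarrow> 1 \<le> a_seq \<beta> n \<Longrightarrow>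
    prob {\<omega>\<in>space P. e * a_seq \<beta> n \<le> \<bar>cnt n \<omega> - comp n \<omega>\<bar>} \<le> 2 * exp (- \<kappa> * a_seq \<beta> n)"
proof -
  obtain C where C: "0 < C" "\<And>n \<omega>. 1 \<le> n \<Longrightarrow> \<omega> \<in> space P \<Longrightarrow> comp n \<omega> \<le> C * (a_seq \<beta> n + 1)"
    using comp_upper by blast
  \<comment> \<open>Chosen so that the quadratic error \<theta>^2 comp, at most 2 C \<theta>^2 a_n,
    eats at most half of the gain \<theta> e a_n; the other half is \<kappa> a_n. The cap 1 is for
    the quadratic bound on the exponential.\<close>
  define \<theta> where "\<theta> = min 1 (e / (4 * C))"
  have \<theta>: "0 < \<theta>" "\<theta> \<le> 1" "4 * C * \<theta> \<le> e"
    using e C(1) by (auto simp: \<theta>_def min_def field_simps)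
  define \<kappa> where "\<kappa> = \<theta> * e / 2"
  have \<kappa>: "0 < \<kappa>" using \<theta> e by (simp add: \<kappa>_def)
  show thesis
  proof (rule that[OF \<kappa>])
    fix n assume n: "1 \<le> n" and an: "1 \<le> a_seq \<beta> n"
    let ?a = "a_seq \<beta> n"
    have cb: "comp n \<omega> * \<theta>\<^sup>2 \<le> \<theta> * e * ?a - \<kappa> * ?a" if "\<omega> \<in> space P" for \<omega>
    proof -
      have "comp n \<omega> \<le> C * (2 * ?a)"
        using C(2)[OF n that] mult_left_mono[of "?a + 1" "2 * ?a" C] C(1) an by linarith
      then have "comp n \<omega> * \<theta>\<^sup>2 \<le> C * (2 * ?a) * \<theta>\<^sup>2"
        by (rule mult_right_mono) simp
      also have "\<dots> = (4 * C * \<theta>) * (\<theta> * ?a / 2)"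
        by (simp add: power2_eq_square)
      also have "\<dots> \<le> e * (\<theta> * ?a / 2)"
        using \<theta> an by (intro mult_right_mono) auto
      also have "\<dots> = \<theta> * e * ?a - \<kappa> * ?a"
        by (simp add: \<kappa>_def algebra_simps)
      finally show ?thesis .
    qed
    have [measurable]: "cnt n \<in> borel_measurable P" "comp n \<in> borel_measurable P"
      by (rule cnt_measurable comp_measurable)+
    have up: "prob {\<omega>\<in>space P. e * ?a \<le> cnt n \<omega> - comp n \<omega>} \<le> exp (- (\<kappa> * ?a))"
    proof (rule exp_tail[where \<theta>=\<theta> and n=n])
      fix \<omega> assume \<omega>: "\<omega> \<in> space P" and h: "e * ?a \<le> cnt n \<omega> - comp n \<omega>"
      have "comp n \<omega> * exp \<theta> \<le> comp n \<omega> * (1 + \<theta> + \<theta>\<^sup>2)"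
        using exp_le_quadratic[of \<theta>] \<theta> comp_nonneg[OF \<omega>] by (intro mult_left_mono) auto
      moreover have "\<theta> * (e * ?a) \<le> \<theta> * (cnt n \<omega> - comp n \<omega>)"
        using h \<theta> by (intro mult_left_mono) auto
      ultimately show "\<kappa> * ?a \<le> \<theta> * cnt n \<omega> - comp n \<omega> * (exp \<theta> - 1)"
        using cb[OF \<omega>] by (simp add: algebra_simps)
    qed measurable
    have lo: "prob {\<omega>\<in>space P. e * ?a \<le> comp n \<omega> - cnt n \<omega>} \<le> exp (- (\<kappa> * ?a))"
    proof (rule exp_tail[where \<theta>="- \<theta>" and n=n])
      fix \<omega> assume \<omega>: "\<omega> \<in> space P" and h: "e * ?a \<le> comp n \<omega> - cnt n \<omega>"
      have "comp n \<omega> * exp (- \<theta>) \<le> comp n \<omega> * (1 - \<theta> + \<theta>\<^sup>2)"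
        using exp_le_quadratic[of "- \<theta>"] \<theta> comp_nonneg[OF \<omega>] by (intro mult_left_mono) auto
      moreover have "\<theta> * (e * ?a) \<le> \<theta> * (comp n \<omega> - cnt n \<omega>)"
        using h \<theta> by (intro mult_left_mono) auto
      ultimately show "\<kappa> * ?a \<le> - \<theta> * cnt n \<omega> - comp n \<omega> * (exp (- \<theta>) - 1)"
        using cb[OF \<omega>] by (simp add: algebra_simps)
    qed measurable
    have "prob {\<omega>\<in>space P. e * ?a \<le> \<bar>cnt n \<omega> - comp n \<omega>\<bar>}
        \<le> prob ({\<omega>\<in>space P. e * ?a \<le> cnt n \<omega> - comp n \<omega>} \<union> {\<omega>\<in>space P. e * ?a \<le> comp n \<omega> - cnt n \<omega>})"
      by (intro finite_measure_mono) auto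
    also have "\<dots> \<le> prob {\<omega>\<in>space P. e * ?a \<le> cnt n \<omega> - comp n \<omega>} + prob {\<omega>\<in>space P. e * ?a \<le> comp n \<omega> - cnt n \<omega>}"
      by (intro measure_Un_le) auto
    finally show "prob {\<omega>\<in>space P. e * ?a \<le> \<bar>cnt n \<omega> - comp n \<omega>\<bar>} \<le> 2 * exp (- \<kappa> * ?a)"
      using up lo by simp
  qed
qed

text \<open>At the square times exp (- \<kappa> a_n) is at most exp (- \<kappa> k), since k^2 \<ge>
  k, and the geometric series makes Borel-Cantelli applicable. Along all n the bound need not be
  summable when \<beta> = 0: there it is of order n to the power - \<kappa>.\<close>

lemma AE_deviation_square_time:
  assumes e: "0 < e"
  shows "AE \<omega> in P. eventually (\<lambda>k. \<bar>cnt (square_time \<beta> k) \<omega> - comp (square_time \<beta> k) \<omega>\<bar>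
    < e * a_seq \<beta> (square_time \<beta> k)) sequentially"
proof -
  obtain \<kappa> where \<kappa>: "0 < \<kappa>" "\<And>n. 1 \<le> n \<Longrightarrow> 1 \<le> a_seq \<beta> n \<Longrightarrow>
    prob {\<omega>\<in>space P. e * a_seq \<beta> n \<le> \<bar>cnt n \<omega> - comp n \<omega>\<bar>} \<le> 2 * exp (- \<kappa> * a_seq \<beta> n)"
    using deviation_bound[OF e] by blast
  let ?t = "square_time \<beta>"
  note st = square_time[OF \<beta>]
  let ?A = "\<lambda>k. {\<omega>\<in>space P. e * a_seq \<beta> (?t k) \<le> \<bar>cnt (?t k) \<omega> - comp (?t k) \<omega>\<bar>}"
  have [measurable]: "cnt n \<in> borel_measurable P" "comp n \<in> borel_measurable P" for n
    by (rule cnt_measurable comp_measurable)+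
  have A: "?A k \<in> sets P" for k by measurable
  have "summable (\<lambda>k. prob (?A k))"
  proof (rule summable_comparison_test_ev)
    show "summable (\<lambda>k. 2 * exp (- \<kappa>) ^ k)"
      using \<kappa>(1) by (intro summable_mult summable_geometric) simp
    show "eventually (\<lambda>k. norm (prob (?A k)) \<le> 2 * exp (- \<kappa>) ^ k) sequentially"
      using eventually_ge_at_top[of 1]
    proof eventually_elim
      case (elim k)
      have k: "real k \<le> (real k)\<^sup>2" using elim by (simp add: power2_eq_square)
      then have ak: "real k \<le> a_seq \<beta> (?t k)" using st(2)[of k] by linarith
      have "prob (?A k) \<le> 2 * exp (- \<kappa> * a_seq \<beta> (?t k))"
        using st(1)[of k] ak elim by (intro \<kappa>(2)) auto
      also have "\<dots> \<le> 2 * exp (real k * - \<kappa>)"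
        using ak \<kappa>(1) by (simp add: mult.commute)
      also have "\<dots> = 2 * exp (- \<kappa>) ^ k"
        by (simp only: exp_of_nat_mult)
      finally show ?case by simp
    qed
  qed
  from borel_cantelli_AE1[OF A _ this]
  have "AE \<omega> in P. eventually (\<lambda>k. \<omega> \<in> space P - ?A k) sequentially"
    by (simp add: less_top[symmetric])
  then show ?thesis
    by eventually_elim (auto elim!: eventually_mono)
qed

section \<open>Almost sure limits of the compensator and of the count\<close>

context
  fixes r :: real
  assumes Rbar: "AE \<omega> in P. (\<lambda>n. Rsum n \<omega> / real n) \<longlonglongrightarrow> r"
begin

text \<open>The averages are at least u for every outcome and so is their limit; under a probability
  measure an almost sure statement about the constant r holds outright.\<close>

lemma r_lower: "u \<le> r"
proof -
  have "AE \<omega> in P. u \<le> r"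
    using Rbar AE_space
  proof eventually_elim
    case (elim \<omega>)
    show ?case
    proof (rule tendsto_lowerbound[OF elim(1)])
      show "eventually (\<lambda>n. u \<le> Rsum n \<omega> / real n) sequentially"
        using eventually_gt_at_top[of 0]
      proof eventually_elim
        case (elim n)
        then show ?case using Rsum_lower[OF \<open>\<omega> \<in> space P\<close>, of n] by (simp add: field_simps)
      qed
    qed simp
  qed
  then show ?thesis by simp
qed

definition "lim_const = measure m B * lam_const \<alpha> \<beta> c r"

lemma comp_approx:
  obtains C1 C2 where "0 \<le> C1" "0 \<le> C2" "\<And>n \<omega>. 1 \<le> n \<Longrightarrow> \<omega> \<in> space P \<Longrightarrow>
    \<bar>comp n \<omega> - lim_const * a_seq \<beta> n\<bar> \<le> C1 + C2 * (\<Sum>j=1..<n. real j powr (\<beta> - 1) * \<bar>Rsum j \<omega> / real j - r\<bar>)"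
proof -
  obtain C1 C2 where C: "0 \<le> C1" "0 \<le> C2" "\<And>(s :: nat \<Rightarrow> real) n. s 0 = 0 \<Longrightarrow> (\<And>j. real j * u \<le> s j) \<Longrightarrow> 1 \<le> n \<Longrightarrow>
     \<bar>(\<Sum>j<n. Lambda_n \<alpha> \<beta> c (s j)) - lam_const \<alpha> \<beta> c r * a_seq \<beta> n\<bar>
       \<le> C1 + C2 * (\<Sum>j=1..<n. real j powr (\<beta> - 1) * \<bar>s j / real j - r\<bar>)"
    using sum_Lambda_approx[OF \<beta> \<alpha> c u r_lower] by blast
  show thesis
  proof (rule that[OF C(1,2)])
    fix n \<omega> assume n: "1 \<le> (n::nat)" and \<omega>: "\<omega> \<in> space P"
    let ?D = "(\<Sum>j<n. Lambda_n \<alpha> \<beta> c (Rsum j \<omega>)) - lam_const \<alpha> \<beta> c r * a_seq \<beta> n"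
    have D: "\<bar>?D\<bar> \<le> C1 + C2 * (\<Sum>j=1..<n. real j powr (\<beta> - 1) * \<bar>Rsum j \<omega> / real j - r\<bar>)"
      using Rsum_lower[OF \<omega>] by (intro C(3) n) (auto simp: Rsum_def)
    have "comp n \<omega> - lim_const * a_seq \<beta> n = measure m B * ?D"
      by (simp add: comp_eq lim_const_def algebra_simps)
    then have "\<bar>comp n \<omega> - lim_const * a_seq \<beta> n\<bar> = measure m B * \<bar>?D\<bar>"
      by (simp add: abs_mult)
    also have "\<dots> \<le> 1 * \<bar>?D\<bar>"
      using prob_space.prob_le_1[OF m_prob] by (intro mult_right_mono) auto
    finally show "\<bar>comp n \<omega> - lim_const * a_seq \<beta> n\<bar> \<le> C1 + C2 * (\<Sum>j=1..<n. real j powr (\<beta> - 1) * \<bar>Rsum j \<omega> / real j - r\<bar>)"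
      using D by simp
  qed
qed

text \<open>Dividing the approximation by a_n leaves a weighted Cesaro mean of deviations that tend
  to 0 for almost every outcome.\<close>

lemma comp_limit: "AE \<omega> in P. (\<lambda>n. comp n \<omega> / a_seq \<beta> n) \<longlonglongrightarrow> lim_const"
proof -
  obtain C1 C2 where C: "0 \<le> C1" "0 \<le> C2" "\<And>n \<omega>. 1 \<le> n \<Longrightarrow> \<omega> \<in> space P \<Longrightarrow>
    \<bar>comp n \<omega> - lim_const * a_seq \<beta> n\<bar> \<le> C1 + C2 * (\<Sum>j=1..<n. real j powr (\<beta> - 1) * \<bar>Rsum j \<omega> / real j - r\<bar>)"
    using comp_approx by blast
  have inv: "(\<lambda>n. C1 / a_seq \<beta> n) \<longlonglongrightarrow> 0"
    by (intro tendsto_divide_0[OF tendsto_const] filterlim_at_top_imp_at_infinity a_seq_at_top[OF \<beta>])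
  show ?thesis
    using Rbar AE_space
  proof eventually_elim
    case (elim \<omega>)
    let ?x = "\<lambda>j. \<bar>Rsum j \<omega> / real j - r\<bar>"
    have "?x \<longlonglongrightarrow> 0"
      using elim(1) by (simp add: tendsto_rabs_zero_iff LIM_zero)
    then have w: "(\<lambda>n. (\<Sum>j=1..<n. real j powr (\<beta> - 1) * ?x j) / a_seq \<beta> n) \<longlonglongrightarrow> 0"
      by (intro weighted_cesaro[OF \<beta>]) auto
    have "(\<lambda>n. comp n \<omega> / a_seq \<beta> n - lim_const) \<longlonglongrightarrow> 0"
    proof (rule Lim_null_comparison)
      have "(\<lambda>n. C1 / a_seq \<beta> n + C2 * ((\<Sum>j=1..<n. real j powr (\<beta> - 1) * ?x j) / a_seq \<beta> n)) \<longlonglongrightarrow> 0 + C2 * 0"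
        by (intro tendsto_intros inv w)
      then show "(\<lambda>n. C1 / a_seq \<beta> n + C2 * ((\<Sum>j=1..<n. real j powr (\<beta> - 1) * ?x j) / a_seq \<beta> n)) \<longlonglongrightarrow> 0"
        by simp
      have "eventually (\<lambda>n. 0 < a_seq \<beta> n) sequentially"
        using a_seq_at_top[OF \<beta>] unfolding filterlim_at_top_dense by blast
      then show "eventually (\<lambda>n. norm (comp n \<omega> / a_seq \<beta> n - lim_const)
          \<le> C1 / a_seq \<beta> n + C2 * ((\<Sum>j=1..<n. real j powr (\<beta> - 1) * ?x j) / a_seq \<beta> n)) sequentially"
        using eventually_ge_at_top[of 1]
      proof eventually_elim
        case (elim n)
        have "comp n \<omega> / a_seq \<beta> n - lim_const = (comp n \<omega> - lim_const * a_seq \<beta> n) / a_seq \<beta> n"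
          using elim by (simp add: field_simps)
        then have "norm (comp n \<omega> / a_seq \<beta> n - lim_const) = \<bar>comp n \<omega> - lim_const * a_seq \<beta> n\<bar> / a_seq \<beta> n"
          using elim by simp
        also have "\<dots> \<le> (C1 + C2 * (\<Sum>j=1..<n. real j powr (\<beta> - 1) * ?x j)) / a_seq \<beta> n"
          using elim \<open>\<omega> \<in> space P\<close> by (intro divide_right_mono C(3)) auto
        finally show ?case by (simp add: add_divide_distrib)
      qed
    qed
    then show ?case by (rule LIM_zero_cancel)
  qed
qed

theorem strong_law: "AE \<omega> in P. (\<lambda>n. cnt n \<omega> / a_seq \<beta> n) \<longlonglongrightarrow> lim_const"
proof -
  let ?t = "square_time \<beta>" and ?a = "a_seq \<beta>"
  note st = square_time[OF \<beta>]
  \<comment> \<open>Precisions 1/(i + 1) keep the exceptional sets countable in number.\<close>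
  have "AE \<omega> in P. \<forall>i::nat. eventually (\<lambda>k. \<bar>cnt (?t k) \<omega> - comp (?t k) \<omega>\<bar> < 1 / real (Suc i) * ?a (?t k)) sequentially"
    unfolding AE_all_countable by (intro allI AE_deviation_square_time) simp
  then show ?thesis
    using comp_limit AE_space
  proof eventually_elim
    case (elim \<omega>)
    have ttop: "filterlim ?t at_top sequentially"
      unfolding filterlim_at_top
    proof
      fix Z
      have "eventually (\<lambda>k. sqrt (\<bar>?a (max 1 Z)\<bar>) < real k) sequentially"
        using filterlim_real_sequentially unfolding filterlim_at_top_dense by blast
      then show "eventually (\<lambda>k. Z \<le> ?t k) sequentially"
      proof eventually_elim
        case (elim k)
        have "?a (max 1 Z) \<le> (sqrt \<bar>?a (max 1 Z)\<bar>)\<^sup>2" by simp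
        also have "\<dots> < (real k)\<^sup>2" using elim by (intro power_strict_mono) auto
        finally have "max 1 Z \<le> ?t k" by (intro st(5)) auto
        then show ?case by simp
      qed
    qed
    have "(\<lambda>k. (cnt (?t k) \<omega> - comp (?t k) \<omega>) / ?a (?t k)) \<longlonglongrightarrow> 0"
    proof (rule LIMSEQ_I)
      fix e :: real assume "0 < e"
      then obtain i where i: "1 / real (Suc i) < e"
        using reals_Archimedean by (metis inverse_eq_divide)
      have "eventually (\<lambda>k. norm ((cnt (?t k) \<omega> - comp (?t k) \<omega>) / ?a (?t k) - 0) < e) sequentially"
        using spec[OF elim(1), of i] eventually_ge_at_top[of 1]
      proof eventually_elim
        case (elim k)
        have "1 \<le> (real k)\<^sup>2" using elim(2) by simp
        then have pos: "0 < ?a (?t k)" using st(2)[of k] by linarith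
        then have "\<bar>cnt (?t k) \<omega> - comp (?t k) \<omega>\<bar> / ?a (?t k) < 1 / real (Suc i)"
          using elim(1) by (simp add: pos_divide_less_eq)
        then show ?case using i pos by simp
      qed
      then show "\<exists>no. \<forall>k\<ge>no. norm ((cnt (?t k) \<omega> - comp (?t k) \<omega>) / ?a (?t k) - 0) < e"
        by (simp add: eventually_sequentially)
    qed
    moreover have "(\<lambda>k. comp (?t k) \<omega> / ?a (?t k)) \<longlonglongrightarrow> lim_const"
      by (rule filterlim_compose[OF elim(2) ttop])
    ultimately have "(\<lambda>k. (cnt (?t k) \<omega> - comp (?t k) \<omega>) / ?a (?t k) + comp (?t k) \<omega> / ?a (?t k)) \<longlonglongrightarrow> 0 + lim_const"
      by (rule tendsto_add)
    then have "(\<lambda>k. cnt (?t k) \<omega> / ?a (?t k)) \<longlonglongrightarrow> lim_const"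
      by (simp add: diff_divide_distrib)
    then show ?case
      by (intro monotone_interpolation[OF \<beta> cnt_mono[OF elim(3)]]) (auto simp: cnt_def)
  qed
qed

end

end

section \<open>Mixing limits and stable convergence\<close>

text \<open>Weak convergence of Y n to the constant y, tested against g. For bounded Y n the
  admissible g form a linear space closed in mean, which is why the property is stated for one g at
  a time.\<close>

definition mixing_lim :: "'o measure \<Rightarrow> (nat \<Rightarrow> 'o \<Rightarrow> real) \<Rightarrow> real \<Rightarrow> ('o \<Rightarrow> real) \<Rightarrow> bool" where
  "mixing_lim P Y y g \<longleftrightarrow> integrable P g \<and> (\<lambda>n. \<integral>\<omega>. Y n \<omega> * g \<omega> \<partial>P) \<longlonglongrightarrow> y * (\<integral>\<omega>. g \<omega> \<partial>P)"

context
  fixes P :: "'o measure" and Y :: "nat \<Rightarrow> 'o \<Rightarrow> real" and y :: real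
  assumes prob: "prob_space P"
    and Y: "\<And>n. Y n \<in> borel_measurable P" and Y1: "\<And>n \<omega>. \<bar>Y n \<omega>\<bar> \<le> 1"
begin

interpretation prob_space P by (rule prob)

lemma integrable_Y_mult: "integrable P g \<Longrightarrow> integrable P (\<lambda>\<omega>. Y n \<omega> * g \<omega>)"
proof (rule Bochner_Integration.integrable_bound)
  assume g: "integrable P g"
  show "integrable P (\<lambda>\<omega>. \<bar>g \<omega>\<bar>)" using g by simp
  show "(\<lambda>\<omega>. Y n \<omega> * g \<omega>) \<in> borel_measurable P"
    using Y g by (intro borel_measurable_times) auto
  show "AE \<omega> in P. norm (Y n \<omega> * g \<omega>) \<le> norm \<bar>g \<omega>\<bar>"
    using mult_right_mono[OF Y1] by (intro AE_I2) (simp add: abs_mult)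
qed

lemma mixing_lim_add: "mixing_lim P Y y f \<Longrightarrow> mixing_lim P Y y g \<Longrightarrow> mixing_lim P Y y (\<lambda>\<omega>. f \<omega> + g \<omega>)"
  unfolding mixing_lim_def
  by (auto simp: distrib_left integrable_Y_mult intro!: tendsto_add)

lemma mixing_lim_cmult: "mixing_lim P Y y f \<Longrightarrow> mixing_lim P Y y (\<lambda>\<omega>. a * f \<omega>)"
  unfolding mixing_lim_def
  by (auto simp: mult.left_commute[of _ a] intro!: tendsto_mult_left)

lemma mixing_lim_L1:
  assumes s: "\<And>i. mixing_lim P Y y (s i)" and f: "integrable P f"
    and lim: "(\<lambda>i. \<integral>\<omega>. \<bar>s i \<omega> - f \<omega>\<bar> \<partial>P) \<longlonglongrightarrow> 0"
  shows "mixing_lim P Y y f"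
  unfolding mixing_lim_def
proof (intro conjI f LIMSEQ_I)
  fix e :: real assume e: "0 < e"
  \<comment> \<open>Replacing f by \<open>s i\<close> changes the two integrals by at most (1 + |y|)
    times their distance in mean; K leaves half of e for the limit along n.\<close>
  define K where "K = 2 * (1 + \<bar>y\<bar>)"
  have K: "0 < K" by (simp add: K_def add_pos_nonneg)
  have eK: "0 < e / K" using e K by simp
  obtain i where i: "(\<integral>\<omega>. \<bar>s i \<omega> - f \<omega>\<bar> \<partial>P) < e / K"
    using LIMSEQ_D[OF lim eK] by fastforce
  have si: "integrable P (s i)" and sl: "(\<lambda>n. \<integral>\<omega>. Y n \<omega> * s i \<omega> \<partial>P) \<longlonglongrightarrow> y * (\<integral>\<omega>. s i \<omega> \<partial>P)"
    using s[of i] by (auto simp: mixing_lim_def)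
  let ?d = "\<integral>\<omega>. \<bar>s i \<omega> - f \<omega>\<bar> \<partial>P"
  obtain N where N: "\<And>n. N \<le> n \<Longrightarrow> \<bar>(\<integral>\<omega>. Y n \<omega> * s i \<omega> \<partial>P) - y * (\<integral>\<omega>. s i \<omega> \<partial>P)\<bar> < e / 2"
    using LIMSEQ_D[OF sl, of "e / 2"] e by auto
  show "\<exists>no. \<forall>n\<ge>no. norm ((\<integral>\<omega>. Y n \<omega> * f \<omega> \<partial>P) - y * (\<integral>\<omega>. f \<omega> \<partial>P)) < e"
  proof (intro exI[of _ N] allI impI)
    fix n assume n: "N \<le> n"
    have sf: "integrable P (\<lambda>\<omega>. s i \<omega> - f \<omega>)" using si f by simp
    have "(\<integral>\<omega>. Y n \<omega> * s i \<omega> \<partial>P) - (\<integral>\<omega>. Y n \<omega> * f \<omega> \<partial>P) = (\<integral>\<omega>. Y n \<omega> * (s i \<omega> - f \<omega>) \<partial>P)"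
      using si f by (simp add: right_diff_distrib integrable_Y_mult)
    also have "\<bar>\<dots>\<bar> \<le> (\<integral>\<omega>. \<bar>Y n \<omega> * (s i \<omega> - f \<omega>)\<bar> \<partial>P)"
      by (rule integral_abs_bound)
    also have "\<dots> \<le> ?d"
    proof (intro integral_mono integrable_abs integrable_Y_mult sf)
      show "\<bar>Y n \<omega> * (s i \<omega> - f \<omega>)\<bar> \<le> \<bar>s i \<omega> - f \<omega>\<bar>" for \<omega>
        using mult_right_mono[OF Y1, of "\<bar>s i \<omega> - f \<omega>\<bar>" n \<omega>] by (simp add: abs_mult)
    qed
    finally have 1: "\<bar>(\<integral>\<omega>. Y n \<omega> * s i \<omega> \<partial>P) - (\<integral>\<omega>. Y n \<omega> * f \<omega> \<partial>P)\<bar> \<le> ?d" .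
    have "(\<integral>\<omega>. s i \<omega> \<partial>P) - (\<integral>\<omega>. f \<omega> \<partial>P) = (\<integral>\<omega>. s i \<omega> - f \<omega> \<partial>P)"
      using si f by simp
    also have "\<bar>\<dots>\<bar> \<le> ?d" by (rule integral_abs_bound)
    finally have "\<bar>y\<bar> * \<bar>(\<integral>\<omega>. s i \<omega> \<partial>P) - (\<integral>\<omega>. f \<omega> \<partial>P)\<bar> \<le> \<bar>y\<bar> * ?d"
      by (rule mult_left_mono) simp
    then have 2: "\<bar>y * (\<integral>\<omega>. s i \<omega> \<partial>P) - y * (\<integral>\<omega>. f \<omega> \<partial>P)\<bar> \<le> \<bar>y\<bar> * ?d"
      by (simp only: abs_mult[symmetric] right_diff_distrib)
    have "(1 + \<bar>y\<bar>) * ?d < e / 2"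
      using i K by (simp add: K_def field_simps)
    then have "?d + \<bar>y\<bar> * ?d < e / 2" by (simp add: algebra_simps)
    then show "norm ((\<integral>\<omega>. Y n \<omega> * f \<omega> \<partial>P) - y * (\<integral>\<omega>. f \<omega> \<partial>P)) < e"
      unfolding real_norm_def using 1 2 N[OF n] by linarith
  qed
qed

lemma mixing_lim_dominated:
  assumes s: "\<And>i. mixing_lim P Y y (s i)" and g: "integrable P g"
    and lim: "\<And>\<omega>. \<omega> \<in> space P \<Longrightarrow> (\<lambda>i. s i \<omega>) \<longlonglongrightarrow> f \<omega>"
    and dom: "\<And>i \<omega>. \<omega> \<in> space P \<Longrightarrow> \<bar>s i \<omega>\<bar> \<le> g \<omega>"
  shows "mixing_lim P Y y f"
proof (rule mixing_lim_L1[OF s])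
  have si: "integrable P (s i)" for i using s by (auto simp: mixing_lim_def)
  have sm: "s i \<in> borel_measurable P" for i using si by auto
  have fm: "f \<in> borel_measurable P"
    using sm lim by (rule borel_measurable_LIMSEQ_real[rotated]) auto
  have fg: "\<bar>f \<omega>\<bar> \<le> g \<omega>" if "\<omega> \<in> space P" for \<omega>
    using dom[OF that] by (intro LIMSEQ_le_const2[OF tendsto_rabs[OF lim[OF that]]]) auto
  show f: "integrable P f"
    using g fm by (rule Bochner_Integration.integrable_bound) (use fg in \<open>auto intro!: AE_I2 intro: order_trans[OF _ abs_ge_self]\<close>)
  have "(\<lambda>i. \<integral>\<omega>. \<bar>s i \<omega> - f \<omega>\<bar> \<partial>P) \<longlonglongrightarrow> (\<integral>\<omega>. 0 \<partial>P)"
  proof (rule integral_dominated_convergence[where w="\<lambda>\<omega>. 2 * g \<omega>"])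
    show "AE \<omega> in P. (\<lambda>i. \<bar>s i \<omega> - f \<omega>\<bar>) \<longlonglongrightarrow> 0"
      using lim by (intro AE_I2) (simp add: tendsto_rabs_zero_iff LIM_zero)
    show "AE \<omega> in P. norm \<bar>s i \<omega> - f \<omega>\<bar> \<le> 2 * g \<omega>" for i
    proof (rule AE_I2)
      fix \<omega> assume "\<omega> \<in> space P"
      then show "norm \<bar>s i \<omega> - f \<omega>\<bar> \<le> 2 * g \<omega>"
        using dom[of \<omega> i] fg[of \<omega>] by simp
    qed
  qed (use sm fm g in auto)
  then show "(\<lambda>i. \<integral>\<omega>. \<bar>s i \<omega> - f \<omega>\<bar> \<partial>P) \<longlonglongrightarrow> 0" by simp
qed

text \<open>A Dynkin argument passes from the union of the filtration to the sigma-field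
  \<open>G\<close> it generates, and dominated approximation to all G-measurable integrable
  functions. An arbitrary event has the same integral against each Y n as its conditional
  probability given \<open>G\<close>, because Y n is G-measurable.\<close>

lemma mixing_lim_extend:
  assumes sub: "\<And>k. subalgebra P (Fk k)" and mono: "\<And>i k. i \<le> k \<Longrightarrow> sets (Fk i) \<subseteq> sets (Fk (k::nat))"
    and YF: "\<And>n. Y n \<in> borel_measurable (Fk n)"
    and base: "\<And>k H. H \<in> sets (Fk k) \<Longrightarrow> mixing_lim P Y y (indicator H)"
    and H: "H \<in> sets P"
  shows "(\<lambda>n. \<integral>\<omega>. Y n \<omega> * indicator H \<omega> \<partial>P) \<longlonglongrightarrow> y * prob H"
proof -
  define E where "E = (\<Union>k. sets (Fk k))"
  define G where "G = sigma (space P) E"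
  have spF: "space (Fk k) = space P" and setsF: "sets (Fk k) \<subseteq> sets P" for k
    using sub[of k] by (auto simp: subalgebra_def)
  have E: "E \<subseteq> Pow (space P)" "E \<subseteq> sets P"
    unfolding E_def using setsF sets.sets_into_space by blast+
  have setsG: "sets G = sigma_sets (space P) E" and spG: "space G = space P"
    unfolding G_def using E(1) by (auto simp: space_measure_of_conv)
  have subG: "subalgebra P G"
    unfolding subalgebra_def setsG spG using sets.sigma_sets_subset[OF E(2)] by simp
  have FG: "sets (Fk k) \<subseteq> sets G" for k
    unfolding setsG E_def by (auto intro: sigma_sets.Basic)
  have stable: "Int_stable E"
  proof (rule Int_stableI)
    fix a b assume "a \<in> E" "b \<in> E"
    then obtain i k where "a \<in> sets (Fk i)" "b \<in> sets (Fk k)" by (auto simp: E_def)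
    then have "a \<in> sets (Fk (max i k))" "b \<in> sets (Fk (max i k))"
      using mono[of i "max i k"] mono[of k "max i k"] by auto
    then show "a \<inter> b \<in> E" unfolding E_def by blast
  qed
  have ind: "mixing_lim P Y y (indicator A)" if "A \<in> sets G" for A
    using that unfolding setsG
  proof (induction rule: sigma_sets_induct_disjoint[OF stable E(1), consumes 1, case_names basic empty compl union])
    case (basic A)
    then show ?case using base by (auto simp: E_def)
  next
    case empty
    show ?case by (rule base[of "{}" 0]) simp
  next
    case (compl A)
    have top: "mixing_lim P Y y (indicator (space P))"
      using base[of "space P" 0] sets.top[of "Fk 0"] spF by simp
    have AP: "A \<in> sets P" using compl(1) subG by (auto simp: subalgebra_def setsG)
    have "mixing_lim P Y y (\<lambda>\<omega>. indicator (space P) \<omega> + - 1 * indicator A \<omega>)"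
      by (intro mixing_lim_add mixing_lim_cmult top compl(2))
    also have "(\<lambda>\<omega>. indicator (space P) \<omega> + - 1 * indicator A \<omega> :: real) = indicator (space P - A)"
      using sets.sets_into_space[OF AP] by (auto simp: fun_eq_iff split: split_indicator)
    finally show ?case .
  next
    case (union A)
    have AP: "A i \<in> sets P" for i using union(2) subG by (auto simp: subalgebra_def setsG)
    have s: "mixing_lim P Y y (\<lambda>\<omega>. \<Sum>i<n. indicator (A i) \<omega>)" for n
    proof (induction n)
      case 0
      show ?case by (simp add: mixing_lim_def)
    next
      case (Suc n)
      show ?case using mixing_lim_add[OF Suc union(3)[of n]] by simp
    qed
    have eq: "(\<Sum>i<n. indicator (A i) \<omega>) = (indicator (\<Union>i<n. A i) \<omega> :: real)" for n \<omega>
      using union(1) by (subst indicator_UN_disjoint) (auto simp: disjoint_family_on_def)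
    show ?case
    proof (rule mixing_lim_dominated[OF s])
      show "integrable P (\<lambda>_. 1 :: real)" by simp
      fix \<omega>
      show "(\<lambda>n. \<Sum>i<n. indicator (A i) \<omega>) \<longlonglongrightarrow> (indicator (\<Union>i. A i) \<omega> :: real)"
        unfolding eq by (rule LIMSEQ_indicator_UN)
      show "\<bar>\<Sum>i<n. indicator (A i) \<omega>\<bar> \<le> (1 :: real)" for n
        unfolding eq by (simp add: indicator_def)
    qed
  qed
  \<comment> \<open>Integrability over the restricted measure includes measurability with respect to
    \<open>G\<close>, so the induction ranges over exactly the G-measurable integrable
    functions.\<close>
  let ?R = "restr_to_subalg P G"
  have fn: "mixing_lim P Y y g" if "integrable ?R g" for g
    using that
  proof (induction rule: integrable_induct)
    case (base A c)
    have "A \<in> sets G" using base by (simp add: sets_restr_to_subalg[OF subG])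
    from mixing_lim_cmult[OF ind[OF this], of c] show ?case by (simp add: mult.commute)
  next
    case (add f g)
    show ?case by (rule mixing_lim_add[OF add.IH])
  next
    case (lim f s)
    show ?case
    proof (rule mixing_lim_dominated[OF lim.IH])
      show "integrable P (\<lambda>\<omega>. 2 * \<bar>f \<omega>\<bar>)"
        using integrable_from_subalg[OF subG lim.hyps(4)] by simp
      fix \<omega> assume "\<omega> \<in> space P"
      then have \<omega>: "\<omega> \<in> space ?R" by (simp add: space_restr_to_subalg)
      show "(\<lambda>i. s i \<omega>) \<longlonglongrightarrow> f \<omega>" by (rule lim.hyps(2)[OF \<omega>])
      show "\<bar>s i \<omega>\<bar> \<le> 2 * \<bar>f \<omega>\<bar>" for i using lim.hyps(3)[OF \<omega>, of i] by simp
    qed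
  qed
  interpret finite_measure_subalgebra P G by unfold_locales (rule subG)
  have int: "integrable P (indicator H :: 'o \<Rightarrow> real)"
    using H by (intro integrable_real_indicator) (simp_all add: less_top[symmetric])
  define g where "g = real_cond_exp P G (indicator H)"
  have g: "integrable P g" "(\<integral>\<omega>. g \<omega> \<partial>P) = prob H"
    unfolding g_def using real_cond_exp_int[OF int] H by simp_all
  have "integrable ?R g"
    by (rule integrable_in_subalg[OF subG _ g(1)]) (simp add: g_def)
  from fn[OF this] have "(\<lambda>n. \<integral>\<omega>. Y n \<omega> * g \<omega> \<partial>P) \<longlonglongrightarrow> y * prob H"
    using g by (simp add: mixing_lim_def)
  moreover have "(\<integral>\<omega>. Y n \<omega> * g \<omega> \<partial>P) = (\<integral>\<omega>. Y n \<omega> * indicator H \<omega> \<partial>P)" for n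
    unfolding g_def
  proof (rule real_cond_exp_intg(2))
    show "integrable P (\<lambda>\<omega>. Y n \<omega> * indicator H \<omega>)" by (rule integrable_Y_mult[OF int])
    show "Y n \<in> borel_measurable G"
      using YF[of n] FG[of n] spF[of n] spG by (auto simp: measurable_def)
    show "indicator H \<in> borel_measurable P" using H by simp
  qed
  ultimately show ?thesis by simp
qed

end

text \<open>The case a = 0, a point mass at 0, does occur: the limit variance vanishes when m(B) =
  0. For a > 0 the density is rescaled to the standard normal one.\<close>

lemma
  assumes a: "0 \<le> a"
  shows real_distribution_gauss0: "real_distribution (gauss0 a)"
    and char_gauss0: "char (gauss0 a) t = complex_of_real (exp (- (t\<^sup>2 * a) / 2))"
proof -
  show "real_distribution (gauss0 a)"
  proof (cases "a = 0")
    case True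
    then show ?thesis
      by (auto simp: gauss0_def real_distribution_def real_distribution_axioms_def intro!: prob_space_return)
  next
    case False
    then show ?thesis
      using a prob_space_normal_density[of "sqrt a" 0]
      by (auto simp: gauss0_def real_distribution_def real_distribution_axioms_def)
  qed
  show "char (gauss0 a) t = complex_of_real (exp (- (t\<^sup>2 * a) / 2))"
  proof (cases "a = 0")
    case True
    then show ?thesis by (simp add: gauss0_def char_def integral_return)
  next
    case False
    let ?s = "sqrt a"
    have s: "0 < ?s" using a False by simp
    have nd: "normal_density 0 ?s (?s * x) * ?s = std_normal_density x" for x
      using s a False by (simp add: normal_density_def real_sqrt_mult power_mult_distrib)
    have "char (gauss0 a) t = (\<integral>x. normal_density 0 ?s x *\<^sub>R iexp (t * x) \<partial>lborel)"
      unfolding char_def gauss0_def using False by (simp add: integral_density)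
    also have "\<dots> = \<bar>?s\<bar> *\<^sub>R (\<integral>x. normal_density 0 ?s (0 + ?s * x) *\<^sub>R iexp (t * (0 + ?s * x)) \<partial>lborel)"
      using s by (intro lborel_integral_real_affine) simp
    also have "\<dots> = (\<integral>x. std_normal_density x *\<^sub>R iexp ((t * ?s) * x) \<partial>lborel)"
      unfolding nd[symmetric] using s by (simp add: mult_ac scaleR_conv_of_real)
    also have "\<dots> = char std_normal_distribution (t * ?s)"
      unfolding char_def by (simp add: integral_density)
    also have "\<dots> = complex_of_real (exp (- (t\<^sup>2 * a) / 2))"
      using a by (simp add: char_std_normal_distribution power_mult_distrib)
    finally show ?thesis .
  qed
qed

text \<open>For a constant limit kernel, stable convergence is convergence in law under each
  conditional probability given H. The hypothesis is convergence of the corresponding characteristic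
  functions, multiplied by the probability of H.\<close>

lemma stably_to_constI:
  fixes P :: "'o measure" and Z :: "nat \<Rightarrow> 'o \<Rightarrow> real"
  assumes "prob_space P" and Z: "\<And>n. Z n \<in> borel_measurable P" and K: "real_distribution K"
    and conv: "\<And>t H. H \<in> sets P \<Longrightarrow>
      (\<lambda>n. \<integral>\<omega>. iexp (t * Z n \<omega>) * indicator H \<omega> \<partial>P) \<longlonglongrightarrow> char K t * measure P H"
  shows "stably_to P Z (\<lambda>_. K)"
  unfolding stably_to_def
proof (intro ballI impI allI)
  interpret prob_space P by fact
  fix H and f :: "real \<Rightarrow> real"
  assume H: "H \<in> sets P" and pos: "0 < measure P H" and f: "continuous_on UNIV f" "bounded (range f)"
  define PH where "PH = density P (\<lambda>\<omega>. ennreal (indicator H \<omega> / prob H))"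
  have [measurable]: "Z n \<in> borel_measurable P" for n by (rule Z)
  note [measurable] = H
  have int: "(\<integral>\<omega>. g \<omega> \<partial>PH) = (\<integral>\<omega>. indicator H \<omega> *\<^sub>R g \<omega> \<partial>P) /\<^sub>R prob H"
    if g: "g \<in> borel_measurable P" for g :: "'o \<Rightarrow> 'b::{banach, second_countable_topology}"
  proof -
    have "(\<integral>\<omega>. g \<omega> \<partial>PH) = (\<integral>\<omega>. (indicator H \<omega> / prob H) *\<^sub>R g \<omega> \<partial>P)"
      unfolding PH_def using g pos by (intro integral_density) auto
    also have "\<dots> = (\<integral>\<omega>. inverse (prob H) *\<^sub>R (indicator H \<omega> *\<^sub>R g \<omega>) \<partial>P)"
      by (simp add: divide_inverse mult.commute)
    finally show ?thesis by (simp only: integral_scaleR_right)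
  qed
  have PH: "prob_space PH"
  proof
    have "emeasure PH (space PH) = (\<integral>\<^sup>+\<omega>. ennreal (indicator H \<omega> / prob H) \<partial>P)"
      unfolding PH_def by (subst emeasure_density) (auto intro!: nn_integral_cong)
    also have "\<dots> = (\<integral>\<^sup>+\<omega>. ennreal (1 / prob H) * indicator H \<omega> \<partial>P)"
      by (intro nn_integral_cong) (auto split: split_indicator)
    also have "\<dots> = 1"
      using pos by (subst nn_integral_cmult_indicator) (auto simp: emeasure_eq_measure ennreal_mult[symmetric])
    finally show "emeasure PH (space PH) = 1" .
  qed
  have ZH: "Z n \<in> borel_measurable PH" for n
    unfolding PH_def using Z by simp
  let ?D = "\<lambda>n. distr PH borel (Z n)"
  have D: "real_distribution (?D n)" for n
    using PH ZH by (intro prob_space.real_distribution_distr)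
  have "weak_conv_m ?D K"
  proof (rule levy_continuity[OF D K])
    fix t
    have "char (?D n) t = (\<integral>\<omega>. iexp (t * Z n \<omega>) * indicator H \<omega> \<partial>P) / prob H" for n
    proof -
      have "char (?D n) t = (\<integral>\<omega>. iexp (t * Z n \<omega>) \<partial>PH)"
        unfolding char_def by (rule integral_distr[OF ZH]) simp
      also have "\<dots> = (\<integral>\<omega>. indicator H \<omega> *\<^sub>R iexp (t * Z n \<omega>) \<partial>P) /\<^sub>R prob H"
        by (rule int) measurable
      also have "(\<integral>\<omega>. indicator H \<omega> *\<^sub>R iexp (t * Z n \<omega>) \<partial>P) = (\<integral>\<omega>. iexp (t * Z n \<omega>) * indicator H \<omega> \<partial>P)"
        by (intro Bochner_Integration.integral_cong) (auto split: split_indicator)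
      finally show ?thesis by (simp add: scaleR_conv_of_real divide_inverse mult.commute)
    qed
    moreover have "(\<lambda>n. (\<integral>\<omega>. iexp (t * Z n \<omega>) * indicator H \<omega> \<partial>P) / prob H) \<longlonglongrightarrow> char K t * prob H / prob H"
      using pos by (intro tendsto_divide conv[OF H] tendsto_const) auto
    ultimately show "(\<lambda>n. char (?D n) t) \<longlonglongrightarrow> char K t"
      using pos by simp
  qed
  moreover obtain b where "\<And>x. \<bar>f x\<bar> \<le> b"
    using f(2) by (auto simp: bounded_iff)
  moreover have "isCont f x" for x
    using f(1) by (simp add: continuous_on_eq_continuous_at)
  ultimately have "(\<lambda>n. \<integral>x. f x \<partial>?D n) \<longlonglongrightarrow> (\<integral>x. f x \<partial>K)"
    using D K by (intro weak_conv_imp_integral_bdd_continuous_conv[where B=b]) auto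
  moreover have "(\<integral>x. f x \<partial>?D n) = (\<integral>\<omega>. f (Z n \<omega>) * indicator H \<omega> \<partial>P) / prob H" for n
  proof -
    have fm: "f \<in> borel_measurable borel" using f(1) by (rule borel_measurable_continuous_onI)
    then have "(\<integral>x. f x \<partial>?D n) = (\<integral>\<omega>. f (Z n \<omega>) \<partial>PH)"
      by (intro integral_distr[OF ZH])
    also have "\<dots> = (\<integral>\<omega>. indicator H \<omega> *\<^sub>R f (Z n \<omega>) \<partial>P) /\<^sub>R prob H"
      using fm by (intro int measurable_compose[OF Z])
    finally show ?thesis by (simp add: divide_inverse mult.commute)
  qed
  ultimately show "(\<lambda>n. (\<integral>\<omega>. f (Z n \<omega>) * indicator H \<omega> \<partial>P) / prob H)
      \<longlonglongrightarrow> (\<integral>\<omega>. (\<integral>x. f x \<partial>K) * indicator H \<omega> \<partial>P) / prob H"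
    using pos H by simp
qed

section \<open>The central limit theorem\<close>

lemma poisson_char_moment:
  "(\<lambda>k. iexp (s * real k) * complex_of_real (poisson_prob x k)) sums exp (complex_of_real x * (iexp s - 1))"
proof -
  let ?z = "complex_of_real x * iexp s"
  have "(\<lambda>k. ?z ^ k / fact k * exp (- complex_of_real x)) sums (exp ?z * exp (- complex_of_real x))"
    using exp_converges[of ?z] by (intro sums_mult2) (simp add: scaleR_conv_of_real divide_inverse mult.commute)
  moreover have "exp ?z * exp (- complex_of_real x) = exp (complex_of_real x * (iexp s - 1))"
    by (simp add: exp_add[symmetric] algebra_simps)
  moreover have "?z ^ k / fact k * exp (- complex_of_real x) = iexp (s * real k) * complex_of_real (poisson_prob x k)" for k
  proof -
    have "iexp (s * real k) = iexp s ^ k"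
      by (simp add: exp_of_nat_mult[symmetric] mult_ac)
    then show ?thesis
      by (simp add: power_mult_distrib exp_of_real[symmetric] mult_ac)
  qed
  ultimately show ?thesis by simp
qed

lemma iexp_second_order: "cmod (iexp x - 1 - \<i> * complex_of_real x) \<le> x\<^sup>2 / 2"
  using iexp_approx1[of x 1] by (simp add: power2_eq_square[symmetric] numeral_2_eq_2[symmetric] diff_diff_eq)

lemma iexp_third_order: "cmod (iexp x - 1 - \<i> * complex_of_real x + complex_of_real (x\<^sup>2 / 2)) \<le> \<bar>x\<bar> ^ 3 / 6"
proof -
  have "(\<Sum>k\<le>2. (\<i> * complex_of_real x) ^ k / fact k) = 1 + \<i> * complex_of_real x - complex_of_real (x\<^sup>2 / 2)"
    by (simp add: numeral_2_eq_2 power2_eq_square algebra_simps)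
  then have "cmod (iexp x - 1 - \<i> * complex_of_real x + complex_of_real (x\<^sup>2 / 2)) = cmod (iexp x - (\<Sum>k\<le>2. (\<i> * complex_of_real x) ^ k / fact k))"
    by (simp only:) (simp add: algebra_simps)
  also have "\<dots> \<le> \<bar>x\<bar> ^ Suc 2 / fact (Suc 2)" by (rule iexp_approx1)
  finally show ?thesis by (simp add: fact_numeral eval_nat_numeral)
qed

lemma iexp_first_order: "cmod (iexp x - 1) \<le> \<bar>x\<bar>"
  using iexp_approx1[of x 0] by simp

section \<open>The conditional characteristic function of the count\<close>

context ibp
begin

definition pr :: "nat \<Rightarrow> nat \<Rightarrow> 'o \<Rightarrow> real" where
  "pr n k \<omega> = poisson_prob (rate n \<omega>) k"

lemma pr_measurable_F: "pr n k \<in> borel_measurable (F n)"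
  unfolding pr_def[abs_def] by (rule poisson_prob_rate_measurable)

lemma pr_nonneg: "\<omega> \<in> space P \<Longrightarrow> 0 \<le> pr n k \<omega>"
  unfolding pr_def by (intro poisson_prob_nonneg rate_nonneg)

lemma sum_pr_le_1:
  assumes "\<omega> \<in> space P" shows "(\<Sum>k<N. pr n k \<omega>) \<le> 1"
proof -
  have s: "(\<lambda>k. pr n k \<omega>) sums 1" unfolding pr_def by (rule poisson_sums)
  have "(\<Sum>k<N. pr n k \<omega>) \<le> (\<Sum>k. pr n k \<omega>)"
    using pr_nonneg[OF assms] by (intro sum_le_suminf sums_summable[OF s]) auto
  then show ?thesis using sums_unique[OF s] by simp
qed

lemma pr_le_1:
  assumes "\<omega> \<in> space P" shows "pr n k \<omega> \<le> 1"
proof -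
  have "0 \<le> (\<Sum>j<k. pr n j \<omega>)" using pr_nonneg[OF assms] by (intro sum_nonneg)
  then show ?thesis using sum_pr_le_1[OF assms, of n "Suc k"] by simp
qed

lemma integral_newc_nonneg:
  assumes g: "g \<in> borel_measurable (F n)" and g0: "\<And>\<omega>. 0 \<le> g \<omega>"
  shows "(\<integral>\<omega>. g \<omega> * indicator {\<omega>\<in>space P. newc n \<omega> = k} \<omega> \<partial>P) = (\<integral>\<omega>. g \<omega> * pr n k \<omega> \<partial>P)"
proof -
  have gP: "g \<in> borel_measurable P" using g by (rule measurable_F_P)
  have pP: "pr n k \<in> borel_measurable P"
    using pr_measurable_F by (rule measurable_F_P)
  have "(\<integral>\<^sup>+\<omega>. ennreal (g \<omega> * indicator {\<omega>\<in>space P. newc n \<omega> = k} \<omega>) \<partial>P)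
      = (\<integral>\<^sup>+\<omega>. ennreal (g \<omega>) * indicator {k} (newc n \<omega>) \<partial>P)"
    by (intro nn_integral_cong) (auto split: split_indicator)
  also have "\<dots> = (\<integral>\<^sup>+\<omega>. ennreal (g \<omega>) * (\<Sum>j. indicator {k} j * ennreal (pr n j \<omega>)) \<partial>P)"
    unfolding pr_def by (rule nn_integral_newc) (use g in measurable)
  also have "\<dots> = (\<integral>\<^sup>+\<omega>. ennreal (g \<omega> * pr n k \<omega>) \<partial>P)"
  proof (rule nn_integral_cong)
    fix \<omega>
    have "(\<lambda>j. indicator {k} j * ennreal (pr n j \<omega>)) = (\<lambda>j. if j = k then ennreal (pr n k \<omega>) else 0)"
      by (auto simp: fun_eq_iff split: split_indicator)
    then have "(\<Sum>j. indicator {k} j * ennreal (pr n j \<omega>)) = ennreal (pr n k \<omega>)"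
      using sums_unique[OF sums_If_finite[of "\<lambda>j. j = k" "\<lambda>j. ennreal (pr n k \<omega>)"]] by simp
    then show "ennreal (g \<omega>) * (\<Sum>j. indicator {k} j * ennreal (pr n j \<omega>)) = ennreal (g \<omega> * pr n k \<omega>)"
      using g0 by (simp only: ennreal_mult')
  qed
  finally have eq: "(\<integral>\<^sup>+\<omega>. ennreal (g \<omega> * indicator {\<omega>\<in>space P. newc n \<omega> = k} \<omega>) \<partial>P)
      = (\<integral>\<^sup>+\<omega>. ennreal (g \<omega> * pr n k \<omega>) \<partial>P)" .
  have "(\<integral>\<omega>. g \<omega> * indicator {\<omega>\<in>space P. newc n \<omega> = k} \<omega> \<partial>P)
      = enn2real (\<integral>\<^sup>+\<omega>. ennreal (g \<omega> * indicator {\<omega>\<in>space P. newc n \<omega> = k} \<omega>) \<partial>P)"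
    using gP newc_event g0 by (intro integral_eq_nn_integral borel_measurable_times) auto
  also have "\<dots> = (\<integral>\<omega>. g \<omega> * pr n k \<omega> \<partial>P)"
    unfolding eq using gP pP g0 pr_nonneg
    by (intro integral_eq_nn_integral[symmetric] borel_measurable_times AE_I2 mult_nonneg_nonneg) auto
  finally show ?thesis .
qed

text \<open>Adding the bound K makes the weight non-negative; the constant itself is covered by the
  non-negative case, so it can be subtracted again.\<close>

lemma integral_newc_real:
  assumes g: "g \<in> borel_measurable (F n)" and K: "\<And>\<omega>. \<bar>g \<omega>\<bar> \<le> K"
  shows "(\<integral>\<omega>. g \<omega> * indicator {\<omega>\<in>space P. newc n \<omega> = k} \<omega> \<partial>P) = (\<integral>\<omega>. g \<omega> * pr n k \<omega> \<partial>P)"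
proof -
  have gP: "g \<in> borel_measurable P" using g by (rule measurable_F_P)
  have pP: "pr n k \<in> borel_measurable P"
    using pr_measurable_F by (rule measurable_F_P)
  define N where "N = {\<omega>\<in>space P. newc n \<omega> = k}"
  have N: "N \<in> sets P" unfolding N_def by (rule newc_event)
  have K0: "0 \<le> K" using K abs_ge_zero order_trans by blast
  have "(\<integral>\<omega>. (g \<omega> + K) * indicator N \<omega> \<partial>P) = (\<integral>\<omega>. (g \<omega> + K) * pr n k \<omega> \<partial>P)"
    unfolding N_def
  proof (rule integral_newc_nonneg)
    show "(\<lambda>\<omega>. g \<omega> + K) \<in> borel_measurable (F n)" using g by simp
    show "0 \<le> g \<omega> + K" for \<omega> using K[of \<omega>] by linarith
  qed
  moreover have "(\<integral>\<omega>. K * indicator N \<omega> \<partial>P) = (\<integral>\<omega>. K * pr n k \<omega> \<partial>P)"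
    unfolding N_def by (rule integral_newc_nonneg) (use K0 in auto)
  moreover have iN: "integrable P (indicator N :: 'o \<Rightarrow> real)"
    using N by (intro integrable_const_bound[of _ 1]) (auto simp: indicator_def)
  moreover have "integrable P (\<lambda>\<omega>. g \<omega> * indicator N \<omega>)"
    using N gP K by (intro integrable_const_bound[of _ K] AE_I2) (auto simp: indicator_def K0)
  moreover have "integrable P (\<lambda>\<omega>. pr n k \<omega>)"
    using pP pr_le_1 pr_nonneg
    by (intro integrable_const_bound[of _ 1] AE_I2) (simp_all only: real_norm_def abs_of_nonneg)
  moreover have "integrable P (\<lambda>\<omega>. g \<omega> * pr n k \<omega>)"
  proof (rule integrable_const_bound[of _ K])
    show "AE \<omega> in P. norm (g \<omega> * pr n k \<omega>) \<le> K"
    proof (rule AE_I2)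
      fix \<omega> assume \<omega>: "\<omega> \<in> space P"
      have "\<bar>g \<omega>\<bar> * pr n k \<omega> \<le> K * 1"
        using K K0 pr_le_1[OF \<omega>] pr_nonneg[OF \<omega>] by (intro mult_mono) auto
      then show "norm (g \<omega> * pr n k \<omega>) \<le> K"
        using pr_nonneg[OF \<omega>] by (simp only: real_norm_def abs_mult abs_of_nonneg mult_1_right)
    qed
    show "(\<lambda>\<omega>. g \<omega> * pr n k \<omega>) \<in> borel_measurable P"
      using gP pP by (rule borel_measurable_times)
  qed
  ultimately show ?thesis
    unfolding N_def[symmetric] by (simp only: distrib_right Bochner_Integration.integral_add integrable_mult_right)
qed

lemma integral_newc_complex:
  fixes g :: "'o \<Rightarrow> complex"
  assumes g: "g \<in> borel_measurable (F n)" and K: "\<And>\<omega>. cmod (g \<omega>) \<le> K"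
  shows "(\<integral>\<omega>. g \<omega> * indicator {\<omega>\<in>space P. newc n \<omega> = k} \<omega> \<partial>P) = (\<integral>\<omega>. g \<omega> * complex_of_real (pr n k \<omega>) \<partial>P)"
proof -
  have gP: "g \<in> borel_measurable P" using g by (rule measurable_F_P)
  have pP: "pr n k \<in> borel_measurable P"
    using pr_measurable_F by (rule measurable_F_P)
  have K0: "0 \<le> K" using K norm_ge_zero order_trans by blast
  define N where "N = {\<omega>\<in>space P. newc n \<omega> = k}"
  have N: "N \<in> sets P" unfolding N_def by (rule newc_event)
  have ReIm: "\<bar>Re (g \<omega>)\<bar> \<le> K" "\<bar>Im (g \<omega>)\<bar> \<le> K" for \<omega>
    using K[of \<omega>] abs_Re_le_cmod[of "g \<omega>"] abs_Im_le_cmod[of "g \<omega>"] by linarith+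
  have i1: "integrable P (\<lambda>\<omega>. g \<omega> * indicator N \<omega>)"
    using N gP K K0 by (intro integrable_const_bound[of _ K] AE_I2) (auto simp: indicator_def)
  have i2: "integrable P (\<lambda>\<omega>. g \<omega> * complex_of_real (pr n k \<omega>))"
  proof (rule integrable_const_bound[of _ K])
    show "AE \<omega> in P. norm (g \<omega> * complex_of_real (pr n k \<omega>)) \<le> K"
    proof (rule AE_I2)
      fix \<omega> assume \<omega>: "\<omega> \<in> space P"
      have "cmod (g \<omega>) * pr n k \<omega> \<le> K * 1"
        using K K0 pr_le_1[OF \<omega>] pr_nonneg[OF \<omega>] by (intro mult_mono) auto
      then show "norm (g \<omega> * complex_of_real (pr n k \<omega>)) \<le> K"
        using pr_nonneg[OF \<omega>] by (simp only: norm_mult norm_of_real abs_of_nonneg mult_1_right)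
    qed
    show "(\<lambda>\<omega>. g \<omega> * complex_of_real (pr n k \<omega>)) \<in> borel_measurable P"
      using gP pP by (intro borel_measurable_times measurable_compose[OF pP]) simp_all
  qed
  have Rm: "(\<lambda>\<omega>. Re (g \<omega>)) \<in> borel_measurable (F n)" "(\<lambda>\<omega>. Im (g \<omega>)) \<in> borel_measurable (F n)"
    using g by measurable
  have ReI: "Re (g \<omega> * indicator N \<omega>) = Re (g \<omega>) * indicator N \<omega>" "Im (g \<omega> * indicator N \<omega>) = Im (g \<omega>) * indicator N \<omega>" for \<omega>
    by (auto split: split_indicator)
  have ReP: "Re (g \<omega> * complex_of_real y) = Re (g \<omega>) * y" "Im (g \<omega> * complex_of_real y) = Im (g \<omega>) * y" for \<omega> y
    by simp_all
  have "(\<integral>\<omega>. g \<omega> * indicator N \<omega> \<partial>P) = (\<integral>\<omega>. g \<omega> * complex_of_real (pr n k \<omega>) \<partial>P)"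
  proof (rule complex_eqI)
    show "Re (\<integral>\<omega>. g \<omega> * indicator N \<omega> \<partial>P) = Re (\<integral>\<omega>. g \<omega> * complex_of_real (pr n k \<omega>) \<partial>P)"
      unfolding integral_Re[OF i1, symmetric] integral_Re[OF i2, symmetric] ReI ReP unfolding N_def
      by (rule integral_newc_real[OF Rm(1) ReIm(1)])
    show "Im (\<integral>\<omega>. g \<omega> * indicator N \<omega> \<partial>P) = Im (\<integral>\<omega>. g \<omega> * complex_of_real (pr n k \<omega>) \<partial>P)"
      unfolding integral_Im[OF i1, symmetric] integral_Im[OF i2, symmetric] ReI ReP unfolding N_def
      by (rule integral_newc_real[OF Rm(2) ReIm(2)])
  qed
  then show ?thesis unfolding N_def .
qed

text \<open>Expands over the values k of the new count. Partial sums are dominated by the constant K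
  on both sides: at most one indicator is non-zero, and the Poisson probabilities sum to at most
  1.\<close>

lemma integral_newc_iexp:
  fixes g :: "'o \<Rightarrow> complex"
  assumes g: "g \<in> borel_measurable (F n)" and K: "\<And>\<omega>. cmod (g \<omega>) \<le> K"
  shows "(\<integral>\<omega>. g \<omega> * iexp (s * real (newc n \<omega>)) \<partial>P) = (\<integral>\<omega>. g \<omega> * exp (complex_of_real (rate n \<omega>) * (iexp s - 1)) \<partial>P)"
proof -
  define N where "N k = {\<omega>\<in>space P. newc n \<omega> = k}" for k
  define p where "p k \<omega> = complex_of_real (pr n k \<omega>)" for k \<omega>
  have gP[measurable]: "g \<in> borel_measurable P" using g by (rule measurable_F_P)
  have [measurable]: "N k \<in> sets P" for k unfolding N_def by (rule newc_event)
  have pP[measurable]: "p k \<in> borel_measurable P" for k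
    unfolding p_def[abs_def] using measurable_F_P[OF pr_measurable_F[of n k]]
    by (rule measurable_compose) simp
  have rP[measurable]: "rate n \<in> borel_measurable P" by (rule measurable_F_P[OF rate_measurable])
  have nP[measurable]: "newc n \<in> measurable P (count_space UNIV)"
    using newc_measurable by (rule measurable_F_P)
  have K0: "0 \<le> K" using K norm_ge_zero order_trans by blast
  have p0: "cmod (p k \<omega>) = pr n k \<omega>" if "\<omega> \<in> space P" for k \<omega>
    unfolding p_def norm_of_real using pr_nonneg[OF that] by (rule abs_of_nonneg)
  have gN: "integrable P (\<lambda>\<omega>. g \<omega> * (iexp (s * real k) * indicator (N k) \<omega>))" for k
    using K K0 by (intro integrable_const_bound[of _ K] AE_I2) (auto simp: indicator_def norm_mult)
  have gp: "integrable P (\<lambda>\<omega>. g \<omega> * (iexp (s * real k) * p k \<omega>))" for k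
  proof (rule integrable_const_bound[of _ K])
    show "AE \<omega> in P. norm (g \<omega> * (iexp (s * real k) * p k \<omega>)) \<le> K"
    proof (rule AE_I2)
      fix \<omega> assume \<omega>: "\<omega> \<in> space P"
      have "cmod (g \<omega>) * cmod (p k \<omega>) \<le> K * 1"
        using K K0 pr_le_1[OF \<omega>] pr_nonneg[OF \<omega>] by (intro mult_mono) (simp_all only: p0[OF \<omega>] norm_ge_zero)
      then show "norm (g \<omega> * (iexp (s * real k) * p k \<omega>)) \<le> K"
        by (simp add: norm_mult)
    qed
  qed measurable
  let ?A = "\<lambda>J \<omega>. \<Sum>k<J. g \<omega> * (iexp (s * real k) * indicator (N k) \<omega>)"
  let ?B = "\<lambda>J \<omega>. \<Sum>k<J. g \<omega> * (iexp (s * real k) * p k \<omega>)"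
  have AB: "(\<integral>\<omega>. ?A J \<omega> \<partial>P) = (\<integral>\<omega>. ?B J \<omega> \<partial>P)" for J
  proof -
    have "(\<integral>\<omega>. g \<omega> * (iexp (s * real k) * indicator (N k) \<omega>) \<partial>P) = (\<integral>\<omega>. g \<omega> * (iexp (s * real k) * p k \<omega>) \<partial>P)" for k
    proof -
      have "(\<integral>\<omega>. iexp (s * real k) * (g \<omega> * indicator (N k) \<omega>) \<partial>P) = (\<integral>\<omega>. iexp (s * real k) * (g \<omega> * p k \<omega>) \<partial>P)"
        unfolding N_def p_def using integral_newc_complex[OF g K, of k] by (simp only: integral_mult_right_zero)
      then show ?thesis by (simp only: mult.left_commute)
    qed
    then show ?thesis using gN gp by simp
  qed
  have A: "(\<lambda>J. \<integral>\<omega>. ?A J \<omega> \<partial>P) \<longlonglongrightarrow> (\<integral>\<omega>. g \<omega> * iexp (s * real (newc n \<omega>)) \<partial>P)"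
  proof (rule integral_dominated_convergence[where w="\<lambda>_. K"])
    have eq: "?A J \<omega> = (if newc n \<omega> < J then g \<omega> * iexp (s * real (newc n \<omega>)) else 0)" if "\<omega> \<in> space P" for J \<omega>
    proof -
      have "?A J \<omega> = (\<Sum>k<J. if k = newc n \<omega> then g \<omega> * iexp (s * real (newc n \<omega>)) else 0)"
        using that by (intro sum.cong) (auto simp: N_def)
      then show ?thesis by simp
    qed
    show "AE \<omega> in P. (\<lambda>J. ?A J \<omega>) \<longlonglongrightarrow> g \<omega> * iexp (s * real (newc n \<omega>))"
    proof (rule AE_I2)
      fix \<omega> assume \<omega>: "\<omega> \<in> space P"
      have "eventually (\<lambda>J. ?A J \<omega> = g \<omega> * iexp (s * real (newc n \<omega>))) sequentially"
        using eventually_gt_at_top[of "newc n \<omega>"] by eventually_elim (simp only: eq[OF \<omega>] if_True)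
      then show "(\<lambda>J. ?A J \<omega>) \<longlonglongrightarrow> g \<omega> * iexp (s * real (newc n \<omega>))"
        by (rule tendsto_eventually)
    qed
    show "AE \<omega> in P. norm (?A J \<omega>) \<le> K" for J
    proof (rule AE_I2)
      fix \<omega> assume "\<omega> \<in> space P"
      show "norm (?A J \<omega>) \<le> K"
        unfolding eq[OF \<open>\<omega> \<in> space P\<close>] using K K0 by (simp add: norm_mult)
    qed
  qed measurable
  have B: "(\<lambda>J. \<integral>\<omega>. ?B J \<omega> \<partial>P) \<longlonglongrightarrow> (\<integral>\<omega>. g \<omega> * exp (complex_of_real (rate n \<omega>) * (iexp s - 1)) \<partial>P)"
  proof (rule integral_dominated_convergence[where w="\<lambda>_. K"])
    show "AE \<omega> in P. (\<lambda>J. ?B J \<omega>) \<longlonglongrightarrow> g \<omega> * exp (complex_of_real (rate n \<omega>) * (iexp s - 1))"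
    proof (rule AE_I2)
      fix \<omega>
      show "(\<lambda>J. ?B J \<omega>) \<longlonglongrightarrow> g \<omega> * exp (complex_of_real (rate n \<omega>) * (iexp s - 1))"
        using sums_mult[OF poisson_char_moment[of s "rate n \<omega>"], of "g \<omega>"] by (simp only: sums_def p_def pr_def)
    qed
    show "AE \<omega> in P. norm (?B J \<omega>) \<le> K" for J
    proof (rule AE_I2)
      fix \<omega> assume \<omega>: "\<omega> \<in> space P"
      have "norm (?B J \<omega>) \<le> (\<Sum>k<J. cmod (g \<omega>) * pr n k \<omega>)"
        by (rule order_trans[OF norm_sum]) (intro sum_mono, simp only: norm_mult p0[OF \<omega>] norm_exp_i_times mult_1_left)
      also have "\<dots> = cmod (g \<omega>) * (\<Sum>k<J. pr n k \<omega>)"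
        by (simp only: sum_distrib_left)
      also have "\<dots> \<le> K * 1"
        using K K0 sum_pr_le_1[OF \<omega>] pr_nonneg[OF \<omega>]
        by (intro mult_mono sum_nonneg) auto
      finally show "norm (?B J \<omega>) \<le> K" by simp
    qed
  qed measurable
  show ?thesis
    using LIMSEQ_unique[OF A] B unfolding AB by blast
qed

text \<open>The exponential martingale at the imaginary argument i s. Its modulus is exp (comp (1 -
  cos s)), bounded for fixed n because the compensator is.\<close>

definition U :: "real \<Rightarrow> nat \<Rightarrow> 'o \<Rightarrow> complex" where
  "U s n \<omega> = exp (\<i> * complex_of_real (s * cnt n \<omega>) - complex_of_real (comp n \<omega>) * (iexp s - 1))"

lemma norm_exp_comp_le:
  assumes "\<omega> \<in> space P"
  shows "cmod (exp (\<i> * complex_of_real x - complex_of_real (comp n \<omega>) * (iexp s - 1))) \<le> exp (2 * comp n \<omega>)"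
proof -
  have "1 - cos s \<le> 2" using cos_ge_minus_one[of s] by linarith
  then have "comp n \<omega> * (1 - cos s) \<le> comp n \<omega> * 2"
    using comp_nonneg[OF assms] by (rule mult_left_mono)
  then show ?thesis
    by (simp add: norm_exp_eq_Re Re_exp Im_exp algebra_simps)
qed

lemma U_measurable: "U s n \<in> borel_measurable P"
  unfolding U_def[abs_def] using cnt_measurable[of n] comp_measurable[of n] by measurable

lemma comp_bounded:
  obtains C where "\<And>\<omega>. \<omega> \<in> space P \<Longrightarrow> comp n \<omega> \<le> C"
proof (cases "n = 0")
  case True
  then show thesis by (intro that[of 0]) (simp add: comp_def)
next
  case False
  obtain C where "\<And>n \<omega>. 1 \<le> n \<Longrightarrow> \<omega> \<in> space P \<Longrightarrow> comp n \<omega> \<le> C * (a_seq \<beta> n + 1)"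
    using comp_upper by blast
  then show thesis using False by (intro that[of "C * (a_seq \<beta> n + 1)"]) simp
qed

lemma U_step:
  assumes H: "H \<in> sets (F n)"
  shows "(\<integral>\<omega>. indicator H \<omega> * U s (Suc n) \<omega> \<partial>P) = (\<integral>\<omega>. indicator H \<omega> * U s n \<omega> \<partial>P)"
proof -
  obtain C where C: "\<And>\<omega>. \<omega> \<in> space P \<Longrightarrow> comp (Suc n) \<omega> \<le> C"
    using comp_bounded by blast
  have HP: "H \<subseteq> space P" using sets.sets_into_space[OF H] by simp
  \<comment> \<open>All of the next value of \<open>U\<close> except the new count is known at time
    n, since the compensator is predictable.\<close>
  define g where "g \<omega> = indicator H \<omega> * exp (\<i> * complex_of_real (s * cnt n \<omega>) - complex_of_real (comp (Suc n) \<omega>) * (iexp s - 1))" for \<omega>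
  have g: "g \<in> borel_measurable (F n)"
    unfolding g_def[abs_def] using cnt_measurable_F[of n] comp_measurable_F[of n] H by measurable
  have gK: "cmod (g \<omega>) \<le> exp (2 * C)" for \<omega>
  proof (cases "\<omega> \<in> H")
    case True
    then have "\<omega> \<in> space P" using HP by auto
    then show ?thesis
      using True norm_exp_comp_le[of \<omega> "s * cnt n \<omega>" "Suc n" s] C[of \<omega>]
      unfolding g_def by (simp add: order_trans[OF _ iffD2[OF exp_le_cancel_iff]])
  qed (simp add: g_def)
  have "(\<integral>\<omega>. indicator H \<omega> * U s (Suc n) \<omega> \<partial>P) = (\<integral>\<omega>. g \<omega> * iexp (s * real (newc n \<omega>)) \<partial>P)"
  proof (rule Bochner_Integration.integral_cong[OF refl])
    fix \<omega> assume \<omega>: "\<omega> \<in> space P"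
    show "indicator H \<omega> * U s (Suc n) \<omega> = g \<omega> * iexp (s * real (newc n \<omega>))"
      unfolding U_def g_def cnt_Suc[OF \<omega>] mult.assoc exp_add[symmetric] by (simp add: algebra_simps)
  qed
  also have "\<dots> = (\<integral>\<omega>. g \<omega> * exp (complex_of_real (rate n \<omega>) * (iexp s - 1)) \<partial>P)"
    by (rule integral_newc_iexp[OF g gK])
  also have "\<dots> = (\<integral>\<omega>. indicator H \<omega> * U s n \<omega> \<partial>P)"
    unfolding U_def g_def comp_def mult.assoc exp_add[symmetric] by (simp add: algebra_simps)
  finally show ?thesis .
qed

lemma U_martingale:
  assumes "k \<le> n" and H: "H \<in> sets (F k)"
  shows "(\<integral>\<omega>. indicator H \<omega> * U s n \<omega> \<partial>P) = (\<integral>\<omega>. indicator H \<omega> * U s k \<omega> \<partial>P)"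
  using assms(1)
proof (induction n rule: dec_induct)
  case (step n)
  have "H \<in> sets (F n)" using H F_mono[OF step(1)] by blast
  from U_step[OF this] show ?case using step by simp
qed simp

end

section \<open>The normalised error and its Gaussian limit\<close>

context ibp
begin

context
  fixes r :: real
  assumes Rbar: "AE \<omega> in P. (\<lambda>n. Rsum n \<omega> / real n) \<longlonglongrightarrow> r"
    and Rint: "\<And>j. 1 \<le> j \<Longrightarrow> integrable P (\<lambda>\<omega>. \<bar>Rsum j \<omega> / real j - r\<bar>)"
    and Rrate: "(\<lambda>n. (\<Sum>j=1..n. real j powr (\<beta> - 1) * (\<integral>\<omega>. \<bar>Rsum j \<omega> / real j - r\<bar> \<partial>P)) / sqrt (a_seq \<beta> n)) \<longlonglongrightarrow> 0"
begin

abbreviation "a \<equiv> a_seq \<beta>"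
abbreviation "lc \<equiv> lim_const r"

lemma lim_const_nonneg: "0 \<le> lc"
proof -
  have "0 \<le> lam_const \<alpha> \<beta> c r * a_rate \<beta>"
    unfolding lam_const_eq[OF \<beta> \<alpha> c u r_lower[OF Rbar]] using KL_pos[OF \<beta> \<alpha> c u r_lower[OF Rbar]] by simp
  then have "0 \<le> lam_const \<alpha> \<beta> c r"
    using a_rate_pos[OF \<beta>] by (simp add: zero_le_mult_iff)
  then show ?thesis
    unfolding lim_const_def[OF Rbar] by simp
qed

lemma a_ge_1: "eventually (\<lambda>n. 1 \<le> n \<and> 1 \<le> a n) sequentially"
  using a_seq_at_top[OF \<beta>] by (intro eventually_conj eventually_ge_at_top) (simp add: filterlim_at_top)

lemma sqrt_a_at_top: "filterlim (\<lambda>n. sqrt (a n)) at_top sequentially"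
  by (rule filterlim_compose[OF sqrt_at_top a_seq_at_top[OF \<beta>]])

text \<open>Here the rate condition enters. The constant C1 of the approximation is negligible after
  division by the square root, and the sum over j < n is enlarged to j \<le> n to match the
  hypothesis.\<close>

lemma comp_L1: "(\<lambda>n. (\<integral>\<omega>. \<bar>comp n \<omega> - lc * a n\<bar> \<partial>P) / sqrt (a n)) \<longlonglongrightarrow> 0"
proof -
  obtain C1 C2 where C: "0 \<le> C1" "0 \<le> C2" "\<And>n \<omega>. 1 \<le> n \<Longrightarrow> \<omega> \<in> space P \<Longrightarrow>
    \<bar>comp n \<omega> - lc * a n\<bar> \<le> C1 + C2 * (\<Sum>j=1..<n. real j powr (\<beta> - 1) * \<bar>Rsum j \<omega> / real j - r\<bar>)"
    using comp_approx[OF Rbar] by blast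
  let ?S = "\<lambda>n. \<Sum>j=1..n. real j powr (\<beta> - 1) * (\<integral>\<omega>. \<bar>Rsum j \<omega> / real j - r\<bar> \<partial>P)"
  have "(\<lambda>n. C1 / sqrt (a n) + C2 * (?S n / sqrt (a n))) \<longlonglongrightarrow> 0 + C2 * 0"
    by (intro tendsto_add tendsto_mult tendsto_const Rrate
        tendsto_divide_0[OF tendsto_const filterlim_at_top_imp_at_infinity[OF sqrt_a_at_top]])
  then have lim: "(\<lambda>n. C1 / sqrt (a n) + C2 * (?S n / sqrt (a n))) \<longlonglongrightarrow> 0" by simp
  show ?thesis
  proof (rule Lim_null_comparison[OF _ lim])
    show "eventually (\<lambda>n. norm ((\<integral>\<omega>. \<bar>comp n \<omega> - lc * a n\<bar> \<partial>P) / sqrt (a n)) \<le> C1 / sqrt (a n) + C2 * (?S n / sqrt (a n))) sequentially"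
      using a_ge_1
    proof eventually_elim
      case (elim n)
      let ?T = "\<lambda>\<omega>. \<Sum>j=1..<n. real j powr (\<beta> - 1) * \<bar>Rsum j \<omega> / real j - r\<bar>"
      have iT: "integrable P ?T"
        by (intro Bochner_Integration.integrable_sum integrable_mult_right Rint) simp
      obtain D where D: "\<And>\<omega>. \<omega> \<in> space P \<Longrightarrow> comp n \<omega> \<le> D"
        using comp_bounded by blast
      have ic: "integrable P (comp n)"
        using comp_measurable comp_nonneg D by (intro integrable_const_bound[of _ D] AE_I2) auto
      have "(\<integral>\<omega>. \<bar>comp n \<omega> - lc * a n\<bar> \<partial>P) \<le> (\<integral>\<omega>. C1 + C2 * ?T \<omega> \<partial>P)"
        using ic iT C(3) elim by (intro integral_mono) auto
      also have "\<dots> = C1 + C2 * (\<integral>\<omega>. ?T \<omega> \<partial>P)"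
        using iT by (simp add: prob_space)
      also have "(\<integral>\<omega>. ?T \<omega> \<partial>P) = (\<Sum>j=1..<n. real j powr (\<beta> - 1) * (\<integral>\<omega>. \<bar>Rsum j \<omega> / real j - r\<bar> \<partial>P))"
        using Rint by (subst Bochner_Integration.integral_sum) auto
      also have "\<dots> \<le> ?S n"
        by (intro sum_mono2) auto
      finally have le: "(\<integral>\<omega>. \<bar>comp n \<omega> - lc * a n\<bar> \<partial>P) \<le> C1 + C2 * ?S n"
        using C(2) by (simp add: mult_left_mono)
      have "norm ((\<integral>\<omega>. \<bar>comp n \<omega> - lc * a n\<bar> \<partial>P) / sqrt (a n)) = (\<integral>\<omega>. \<bar>comp n \<omega> - lc * a n\<bar> \<partial>P) / sqrt (a n)"
        using elim by (simp add: integral_nonneg)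
      also have "\<dots> \<le> (C1 + C2 * ?S n) / sqrt (a n)"
        using elim by (intro divide_right_mono le) auto
      finally show ?case by (simp add: add_divide_distrib)
    qed
  qed
qed

definition Z :: "nat \<Rightarrow> 'o \<Rightarrow> real" where
  "Z n \<omega> = sqrt (a n) * (cnt n \<omega> / a n - lc)"

lemma Z_measurable_F: "Z n \<in> borel_measurable (F n)"
  unfolding Z_def[abs_def] using cnt_measurable_F[of n] by measurable

lemma Z_measurable: "Z n \<in> borel_measurable P"
  by (rule measurable_F_P[OF Z_measurable_F])

definition s_n :: "real \<Rightarrow> nat \<Rightarrow> real" where
  "s_n t n = t / sqrt (a n)"

text \<open>One of two corrections in the factorisation of \<open>U\<close> at s = t / sqrt(a_n),
  coming from the linear term of exp (i s) - 1: the distance of the compensator from its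
  deterministic equivalent \<open>lc * a n\<close>, divided by sqrt(a_n) and multiplied by t. It
  tends to 0 in mean.\<close>

definition phase :: "real \<Rightarrow> nat \<Rightarrow> 'o \<Rightarrow> real" where
  "phase t n \<omega> = s_n t n * (lc * a n - comp n \<omega>)"

text \<open>The other correction, from the terms of second and higher order. It produces the factor
  exp (lc t^2 / 2), the reciprocal of the limit characteristic function.\<close>

definition growth :: "real \<Rightarrow> nat \<Rightarrow> 'o \<Rightarrow> complex" where
  "growth t n \<omega> = exp (- complex_of_real (comp n \<omega>) * (iexp (s_n t n) - 1 - \<i> * complex_of_real (s_n t n)))"

lemma s_n_square: "0 < a n \<Longrightarrow> (s_n t n)\<^sup>2 = t\<^sup>2 / a n"
  by (simp add: s_n_def power_divide)

lemma s_n_lim: "s_n t \<longlonglongrightarrow> 0"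
  unfolding s_n_def[abs_def]
  by (intro tendsto_divide_0[OF tendsto_const] filterlim_at_top_imp_at_infinity sqrt_a_at_top)

lemma U_factor:
  assumes "0 < a n"
  shows "U (s_n t n) n \<omega> = iexp (t * Z n \<omega>) * (iexp (phase t n \<omega>) * growth t n \<omega>)"
proof -
  have "sqrt (a n) * (sqrt (a n) / a n) = 1" using assms by simp
  then have "sqrt (a n) / a n = 1 / sqrt (a n)" using assms by (simp add: field_simps)
  moreover have "lc * sqrt (a n) = lc * a n / sqrt (a n)"
    using real_div_sqrt[of "a n"] assms by (simp only: times_divide_eq_right[symmetric] less_imp_le)
  moreover have "t * Z n \<omega> = t * (cnt n \<omega> * (sqrt (a n) / a n) - lc * sqrt (a n))"
    by (simp add: Z_def algebra_simps)
  ultimately have "t * Z n \<omega> = s_n t n * cnt n \<omega> - s_n t n * (lc * a n)"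
    by (simp add: s_n_def algebra_simps)
  then have tz: "t * Z n \<omega> + phase t n \<omega> = s_n t n * cnt n \<omega> - s_n t n * comp n \<omega>"
    by (simp add: phase_def algebra_simps)
  have "iexp (t * Z n \<omega>) * (iexp (phase t n \<omega>) * growth t n \<omega>)
      = exp (\<i> * complex_of_real (t * Z n \<omega> + phase t n \<omega>)
          - complex_of_real (comp n \<omega>) * (iexp (s_n t n) - 1 - \<i> * complex_of_real (s_n t n)))"
    unfolding growth_def exp_add[symmetric] by (simp add: algebra_simps)
  also have "\<dots> = U (s_n t n) n \<omega>"
    unfolding tz U_def by (simp add: algebra_simps)
  finally show ?thesis ..
qed

text \<open>The compensator is at most 2 C a_n once a_n \<ge> 1, and the second-order remainder is
  at most t^2 / (2 a_n): the product is bounded by C t^2, uniformly in n and in the outcome.\<close>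

lemma growth_bound:
  obtains K where "0 \<le> K" "\<And>n \<omega>. 1 \<le> n \<Longrightarrow> 1 \<le> a n \<Longrightarrow> \<omega> \<in> space P \<Longrightarrow> cmod (growth t n \<omega>) \<le> K"
proof -
  obtain C where C: "0 < C" "\<And>n \<omega>. 1 \<le> n \<Longrightarrow> \<omega> \<in> space P \<Longrightarrow> comp n \<omega> \<le> C * (a n + 1)"
    using comp_upper by blast
  show thesis
  proof (rule that[of "exp (C * t\<^sup>2)"])
    fix n \<omega> assume n: "1 \<le> n" "1 \<le> a n" and \<omega>: "\<omega> \<in> space P"
    let ?z = "iexp (s_n t n) - 1 - \<i> * complex_of_real (s_n t n)"
    have "cmod (growth t n \<omega>) \<le> exp (cmod (- complex_of_real (comp n \<omega>) * ?z))"
      unfolding growth_def by (rule norm_exp)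
    also have "cmod (- complex_of_real (comp n \<omega>) * ?z) = comp n \<omega> * cmod ?z"
      using comp_nonneg[OF \<omega>] by (simp add: norm_mult)
    also have "comp n \<omega> * cmod ?z \<le> (C * (2 * a n)) * ((s_n t n)\<^sup>2 / 2)"
    proof (rule mult_mono)
      show "comp n \<omega> \<le> C * (2 * a n)"
        using C(2)[OF n(1) \<omega>] mult_left_mono[of "a n + 1" "2 * a n" C] C(1) n by linarith
      show "cmod ?z \<le> (s_n t n)\<^sup>2 / 2" by (rule iexp_second_order)
    qed (use C(1) n in auto)
    also have "\<dots> = C * t\<^sup>2"
      using n by (subst s_n_square) auto
    finally show "cmod (growth t n \<omega>) \<le> exp (C * t\<^sup>2)" by simp
  qed simp
qed

lemma phase_measurable: "phase t n \<in> borel_measurable P"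
  unfolding phase_def[abs_def] using comp_measurable[of n] by measurable

lemma growth_measurable: "growth t n \<in> borel_measurable P"
  unfolding growth_def[abs_def] using comp_measurable[of n] by measurable

text \<open>The third-order expansion shows that a_n (exp (i s) - 1 - i s) tends to - t^2 / 2, with
  an error of order 1 / sqrt(a_n); the ratio of the compensator to a_n tends to \<open>lc\<close>
  almost surely.\<close>

lemma growth_lim: "AE \<omega> in P. (\<lambda>n. growth t n \<omega>) \<longlonglongrightarrow> complex_of_real (exp (lc * t\<^sup>2 / 2))"
proof -
  let ?z = "\<lambda>n. iexp (s_n t n) - 1 - \<i> * complex_of_real (s_n t n)"
  have "(\<lambda>n. complex_of_real (a n) * ?z n + complex_of_real (t\<^sup>2 / 2)) \<longlonglongrightarrow> 0"
  proof (rule Lim_null_comparison)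
    show "(\<lambda>n. \<bar>t\<bar> ^ 3 / 6 / sqrt (a n)) \<longlonglongrightarrow> 0"
      by (intro tendsto_divide_0[OF tendsto_const] filterlim_at_top_imp_at_infinity sqrt_a_at_top)
    show "eventually (\<lambda>n. norm (complex_of_real (a n) * ?z n + complex_of_real (t\<^sup>2 / 2)) \<le> \<bar>t\<bar> ^ 3 / 6 / sqrt (a n)) sequentially"
      using a_ge_1
    proof eventually_elim
      case (elim n)
      then have an: "0 < a n" by simp
      have "t\<^sup>2 / 2 = a n * ((s_n t n)\<^sup>2 / 2)" using an by (simp add: s_n_square)
      then have "complex_of_real (a n) * ?z n + complex_of_real (t\<^sup>2 / 2) = complex_of_real (a n) * (?z n + complex_of_real ((s_n t n)\<^sup>2 / 2))"
        by (simp only: of_real_mult distrib_left)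
      then have "norm (complex_of_real (a n) * ?z n + complex_of_real (t\<^sup>2 / 2)) = a n * cmod (?z n + complex_of_real ((s_n t n)\<^sup>2 / 2))"
        using an by (simp only: norm_mult norm_of_real abs_of_pos)
      also have "\<dots> \<le> a n * (\<bar>s_n t n\<bar> ^ 3 / 6)"
        using an iexp_third_order[of "s_n t n"] by (intro mult_left_mono) auto
      also have "\<bar>s_n t n\<bar> ^ 3 = \<bar>t\<bar> ^ 3 / (sqrt (a n) * a n)"
        using an by (simp add: s_n_def power_divide power3_eq_cube)
      finally show ?case using an by (simp add: field_simps)
    qed
  qed
  then have z: "(\<lambda>n. complex_of_real (a n) * ?z n) \<longlonglongrightarrow> - complex_of_real (t\<^sup>2 / 2)"
    using tendsto_diff[OF _ tendsto_const[of "complex_of_real (t\<^sup>2 / 2)"]] by force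
  show ?thesis
    using comp_limit[OF Rbar]
  proof eventually_elim
    case (elim \<omega>)
    have "(\<lambda>n. exp (- (complex_of_real (comp n \<omega> / a n) * (complex_of_real (a n) * ?z n)))) \<longlonglongrightarrow> exp (- (complex_of_real lc * - complex_of_real (t\<^sup>2 / 2)))"
      by (intro tendsto_intros z elim)
    moreover have "exp (- (complex_of_real lc * - complex_of_real (t\<^sup>2 / 2))) = complex_of_real (exp (lc * t\<^sup>2 / 2))"
      by (simp add: exp_of_real[symmetric])
    moreover have "eventually (\<lambda>n. exp (- (complex_of_real (comp n \<omega> / a n) * (complex_of_real (a n) * ?z n))) = growth t n \<omega>) sequentially"
      using a_ge_1
    proof eventually_elim
      case (elim n)
      then have "comp n \<omega> / a n * a n = comp n \<omega>" by simp
      then have "complex_of_real (comp n \<omega> / a n) * complex_of_real (a n) = complex_of_real (comp n \<omega>)"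
        by (simp only: of_real_mult[symmetric])
      then show ?case
        unfolding growth_def mult.assoc[symmetric] by (simp only: mult_minus_left)
    qed
    ultimately show ?case
      using Lim_transform_eventually by force
  qed
qed

lemma correction_L1:
  "(\<lambda>n. \<integral>\<omega>. cmod (iexp (phase t n \<omega>) * growth t n \<omega> - complex_of_real (exp (lc * t\<^sup>2 / 2))) \<partial>P) \<longlonglongrightarrow> 0"
proof -
  let ?w = "complex_of_real (exp (lc * t\<^sup>2 / 2))"
  obtain K where K: "0 \<le> K" "\<And>n \<omega>. 1 \<le> n \<Longrightarrow> 1 \<le> a n \<Longrightarrow> \<omega> \<in> space P \<Longrightarrow> cmod (growth t n \<omega>) \<le> K"
    using growth_bound by blast
  have [measurable]: "phase t n \<in> borel_measurable P" "growth t n \<in> borel_measurable P" for n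
    by (rule phase_measurable growth_measurable)+
  \<comment> \<open>The bound on \<open>growth\<close> is available only once a_n \<ge> 1, so
    dominated convergence is applied to the shifted sequence.\<close>
  obtain N where N: "\<And>n. N \<le> n \<Longrightarrow> 1 \<le> n \<and> 1 \<le> a n"
    using a_ge_1 by (auto simp: eventually_sequentially)
  have "(\<lambda>n. \<integral>\<omega>. cmod (growth t (n + N) \<omega> - ?w) \<partial>P) \<longlonglongrightarrow> (\<integral>\<omega>. 0 \<partial>P)"
  proof (rule integral_dominated_convergence[where w="\<lambda>_. K + cmod ?w"])
    show "AE \<omega> in P. (\<lambda>n. cmod (growth t (n + N) \<omega> - ?w)) \<longlonglongrightarrow> 0"
      using growth_lim[of t]
    proof eventually_elim
      case (elim \<omega>)
      from LIMSEQ_ignore_initial_segment[OF elim, of N] show ?case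
        by (simp add: tendsto_norm_zero_iff LIM_zero)
    qed
    show "AE \<omega> in P. norm (cmod (growth t (n + N) \<omega> - ?w)) \<le> K + cmod ?w" for n
    proof (rule AE_I2)
      fix \<omega> assume "\<omega> \<in> space P"
      then have "cmod (growth t (n + N) \<omega>) \<le> K" using N[of "n + N"] by (intro K(2)) auto
      then show "norm (cmod (growth t (n + N) \<omega> - ?w)) \<le> K + cmod ?w"
        using norm_triangle_ineq4[of "growth t (n + N) \<omega>" ?w] by simp
    qed
  qed auto
  then have g: "(\<lambda>n. \<integral>\<omega>. cmod (growth t n \<omega> - ?w) \<partial>P) \<longlonglongrightarrow> 0"
    unfolding Bochner_Integration.integral_zero by (rule LIMSEQ_offset)
  have ph: "(\<lambda>n. K * (\<bar>t\<bar> * ((\<integral>\<omega>. \<bar>comp n \<omega> - lc * a n\<bar> \<partial>P) / sqrt (a n))) + (\<integral>\<omega>. cmod (growth t n \<omega> - ?w) \<partial>P)) \<longlonglongrightarrow> 0"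
  proof -
    have "(\<lambda>n. K * (\<bar>t\<bar> * ((\<integral>\<omega>. \<bar>comp n \<omega> - lc * a n\<bar> \<partial>P) / sqrt (a n))) + (\<integral>\<omega>. cmod (growth t n \<omega> - ?w) \<partial>P)) \<longlonglongrightarrow> K * (\<bar>t\<bar> * 0) + 0"
      by (intro tendsto_intros comp_L1 g)
    then show ?thesis by simp
  qed
  show ?thesis
  proof (rule Lim_null_comparison[OF _ ph])
    show "eventually (\<lambda>n. norm (\<integral>\<omega>. cmod (iexp (phase t n \<omega>) * growth t n \<omega> - ?w) \<partial>P)
        \<le> K * (\<bar>t\<bar> * ((\<integral>\<omega>. \<bar>comp n \<omega> - lc * a n\<bar> \<partial>P) / sqrt (a n))) + (\<integral>\<omega>. cmod (growth t n \<omega> - ?w) \<partial>P)) sequentially"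
      using a_ge_1
    proof eventually_elim
      case (elim n)
      obtain D where D: "\<And>\<omega>. \<omega> \<in> space P \<Longrightarrow> comp n \<omega> \<le> D"
        using comp_bounded by blast
      have ic: "integrable P (comp n)"
        using comp_measurable comp_nonneg D by (intro integrable_const_bound[of _ D] AE_I2) auto
      have ip: "integrable P (\<lambda>\<omega>. \<bar>phase t n \<omega>\<bar>)"
        unfolding phase_def using ic by simp
      have ig: "integrable P (growth t n)"
        using K(2) elim by (intro integrable_const_bound[of _ K] AE_I2) auto
      have ie: "integrable P (\<lambda>\<omega>. iexp (phase t n \<omega>) * growth t n \<omega>)"
        using K(2) elim by (intro integrable_const_bound[of _ K] AE_I2) (auto simp: norm_mult)
      have "(\<integral>\<omega>. cmod (iexp (phase t n \<omega>) * growth t n \<omega> - ?w) \<partial>P) \<le> (\<integral>\<omega>. K * \<bar>phase t n \<omega>\<bar> + cmod (growth t n \<omega> - ?w) \<partial>P)"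
      proof (rule integral_mono)
        show "integrable P (\<lambda>\<omega>. cmod (iexp (phase t n \<omega>) * growth t n \<omega> - ?w))" using ie by simp
        show "integrable P (\<lambda>\<omega>. K * \<bar>phase t n \<omega>\<bar> + cmod (growth t n \<omega> - ?w))" using ip ig by simp
        fix \<omega> assume \<omega>: "\<omega> \<in> space P"
        have "cmod ((iexp (phase t n \<omega>) - 1) * growth t n \<omega>) \<le> \<bar>phase t n \<omega>\<bar> * K"
          unfolding norm_mult using iexp_first_order[of "phase t n \<omega>"] K(2)[of n \<omega>] elim \<omega> by (intro mult_mono) auto
        \<comment> \<open>Replacing the phase factor by 1 costs at most K times the absolute phase,
          which is small in mean; what is left is the distance of \<open>growth\<close> from its
          limit.\<close>
        moreover have eq: "iexp (phase t n \<omega>) * growth t n \<omega> - ?w = (iexp (phase t n \<omega>) - 1) * growth t n \<omega> + (growth t n \<omega> - ?w)"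
          by (simp add: algebra_simps)
        moreover have "cmod ((iexp (phase t n \<omega>) - 1) * growth t n \<omega> + (growth t n \<omega> - ?w))
            \<le> cmod ((iexp (phase t n \<omega>) - 1) * growth t n \<omega>) + cmod (growth t n \<omega> - ?w)"
          by (rule norm_triangle_ineq)
        ultimately show "cmod (iexp (phase t n \<omega>) * growth t n \<omega> - ?w) \<le> K * \<bar>phase t n \<omega>\<bar> + cmod (growth t n \<omega> - ?w)"
          unfolding eq mult.commute[of K] by linarith
      qed
      also have "\<dots> = K * (\<integral>\<omega>. \<bar>phase t n \<omega>\<bar> \<partial>P) + (\<integral>\<omega>. cmod (growth t n \<omega> - ?w) \<partial>P)"
        using ip ig by simp
      also have "(\<integral>\<omega>. \<bar>phase t n \<omega>\<bar> \<partial>P) = \<bar>t\<bar> * ((\<integral>\<omega>. \<bar>comp n \<omega> - lc * a n\<bar> \<partial>P) / sqrt (a n))"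
      proof -
        have "\<bar>phase t n \<omega>\<bar> = \<bar>s_n t n\<bar> * \<bar>comp n \<omega> - lc * a n\<bar>" for \<omega>
          unfolding phase_def abs_mult by (simp only: abs_minus_commute)
        moreover have "\<bar>s_n t n\<bar> = \<bar>t\<bar> / sqrt (a n)"
          unfolding s_n_def using elim by simp
        ultimately show ?thesis by simp
      qed
      finally show ?case by (simp add: integral_nonneg)
    qed
  qed
qed

lemma norm_iexp_indicator: "cmod (iexp x * indicator A \<omega>) \<le> 1"
  by (cases "\<omega> \<in> A") (simp_all add: norm_mult)

text \<open>The past index k stays fixed while n grows. The martingale property replaces
  \<open>U\<close> at time n by its value at time k, and since \<open>s_n\<close> tends to 0, that
  value tends boundedly to 1. The correction factor tends in mean to the constant \<open>?w\<close>,
  which is then divided out.\<close>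

lemma integral_iexp_Z_F:
  assumes H: "H \<in> sets (F k)"
  shows "(\<lambda>n. \<integral>\<omega>. iexp (t * Z n \<omega>) * indicator H \<omega> \<partial>P) \<longlonglongrightarrow> complex_of_real (exp (- (t\<^sup>2 * lc) / 2) * prob H)"
proof -
  let ?w = "complex_of_real (exp (lc * t\<^sup>2 / 2))"
  have HP[measurable]: "H \<in> sets P" using H subalgebra_F[of k] by (auto simp: subalgebra_def)
  have [measurable]: "phase t n \<in> borel_measurable P" "growth t n \<in> borel_measurable P" "Z n \<in> borel_measurable P" for n
    by (rule phase_measurable growth_measurable Z_measurable)+
  obtain K where K: "0 \<le> K" "\<And>n \<omega>. 1 \<le> n \<Longrightarrow> 1 \<le> a n \<Longrightarrow> \<omega> \<in> space P \<Longrightarrow> cmod (growth t n \<omega>) \<le> K"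
    using growth_bound by blast
  have Uk: "(\<lambda>n. \<integral>\<omega>. indicator H \<omega> * U (s_n t n) k \<omega> \<partial>P) \<longlonglongrightarrow> (\<integral>\<omega>. indicator H \<omega> \<partial>P)"
  proof -
    obtain D where D: "\<And>\<omega>. \<omega> \<in> space P \<Longrightarrow> comp k \<omega> \<le> D"
      using comp_bounded by blast
    show ?thesis
    proof (rule integral_dominated_convergence[where w="\<lambda>_. exp (2 * D)"])
      show "AE \<omega> in P. (\<lambda>n. indicator H \<omega> * U (s_n t n) k \<omega>) \<longlonglongrightarrow> indicator H \<omega>"
      proof (rule AE_I2)
        fix \<omega>
        have "(\<lambda>n. indicator H \<omega> * U (s_n t n) k \<omega>) \<longlonglongrightarrow> indicator H \<omega> *
            exp (\<i> * complex_of_real (0 * cnt k \<omega>) - complex_of_real (comp k \<omega>) * (iexp 0 - 1))"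
          unfolding U_def by (intro tendsto_intros s_n_lim)
        then show "(\<lambda>n. indicator H \<omega> * U (s_n t n) k \<omega>) \<longlonglongrightarrow> indicator H \<omega>" by simp
      qed
      show "AE \<omega> in P. norm (indicator H \<omega> * U (s_n t n) k \<omega>) \<le> exp (2 * D)" for n
      proof (rule AE_I2)
        fix \<omega> assume \<omega>: "\<omega> \<in> space P"
        have "norm (U (s_n t n) k \<omega>) \<le> exp (2 * comp k \<omega>)"
          unfolding U_def by (rule norm_exp_comp_le[OF \<omega>])
        also have "\<dots> \<le> exp (2 * D)" using D[OF \<omega>] by simp
        finally show "norm (indicator H \<omega> * U (s_n t n) k \<omega>) \<le> exp (2 * D)"
          by (simp add: indicator_def norm_mult)
      qed
    qed (use U_measurable in auto)
  qed
  have diff: "(\<lambda>n. (\<integral>\<omega>. iexp (t * Z n \<omega>) * indicator H \<omega> \<partial>P) * ?w - (\<integral>\<omega>. indicator H \<omega> * U (s_n t n) k \<omega> \<partial>P)) \<longlonglongrightarrow> 0"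
  proof (rule Lim_null_comparison[OF _ correction_L1[of t]])
    have "eventually (\<lambda>n. k \<le> n \<and> 1 \<le> n \<and> 1 \<le> a n) sequentially"
      by (rule eventually_conj[OF eventually_ge_at_top a_ge_1])
    then show "eventually (\<lambda>n. norm ((\<integral>\<omega>. iexp (t * Z n \<omega>) * indicator H \<omega> \<partial>P) * ?w - (\<integral>\<omega>. indicator H \<omega> * U (s_n t n) k \<omega> \<partial>P))
        \<le> (\<integral>\<omega>. cmod (iexp (phase t n \<omega>) * growth t n \<omega> - ?w) \<partial>P)) sequentially"
    proof eventually_elim
      case (elim n)
      let ?e = "\<lambda>\<omega>. iexp (t * Z n \<omega>) * indicator H \<omega>"
      let ?W = "\<lambda>\<omega>. iexp (phase t n \<omega>) * growth t n \<omega>"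
      have e1: "cmod (?e \<omega>) \<le> 1" for \<omega>
        by (rule norm_iexp_indicator)
      have W1: "cmod (?W \<omega>) \<le> K" if "\<omega> \<in> space P" for \<omega>
        unfolding norm_mult norm_exp_i_times mult_1_left using elim by (intro K(2) that) (elim conjE, assumption)+
      have i1: "integrable P ?e"
        by (rule integrable_const_bound[OF AE_I2[OF e1]]) measurable
      have i3: "integrable P ?W"
        by (rule integrable_const_bound[OF AE_I2[OF W1]]) (assumption, measurable)
      have i2: "integrable P (\<lambda>\<omega>. ?e \<omega> * ?W \<omega>)"
      proof (rule integrable_const_bound[OF AE_I2])
        fix \<omega> assume "\<omega> \<in> space P"
        then have "cmod (?e \<omega>) * cmod (?W \<omega>) \<le> 1 * K"
          by (intro mult_mono e1 W1) simp_all
        then show "norm (?e \<omega> * ?W \<omega>) \<le> K" by (simp only: norm_mult mult_1_left)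
      qed measurable
      have "(\<integral>\<omega>. indicator H \<omega> * U (s_n t n) k \<omega> \<partial>P) = (\<integral>\<omega>. indicator H \<omega> * U (s_n t n) n \<omega> \<partial>P)"
        using elim by (intro U_martingale[symmetric] H) simp
      also have "\<dots> = (\<integral>\<omega>. ?e \<omega> * ?W \<omega> \<partial>P)"
      proof (rule Bochner_Integration.integral_cong[OF refl])
        fix \<omega>
        have "0 < a n" using elim by simp
        have ac: "x * (y * z) = y * x * z" for x y z :: complex by (simp only: ac_simps)
        show "indicator H \<omega> * U (s_n t n) n \<omega> = ?e \<omega> * ?W \<omega>"
          unfolding U_factor[OF \<open>0 < a n\<close>] by (rule ac)
      qed
      finally have eq: "(\<integral>\<omega>. ?e \<omega> \<partial>P) * ?w - (\<integral>\<omega>. indicator H \<omega> * U (s_n t n) k \<omega> \<partial>P) = (\<integral>\<omega>. ?e \<omega> * ?w - ?e \<omega> * ?W \<omega> \<partial>P)"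
        by (simp only: Bochner_Integration.integral_diff[OF integrable_mult_left[OF i1] i2] integral_mult_left_zero)
      have "norm ((\<integral>\<omega>. ?e \<omega> \<partial>P) * ?w - (\<integral>\<omega>. indicator H \<omega> * U (s_n t n) k \<omega> \<partial>P)) \<le> (\<integral>\<omega>. norm (?e \<omega> * ?w - ?e \<omega> * ?W \<omega>) \<partial>P)"
        unfolding eq by (rule integral_norm_bound)
      also have "\<dots> \<le> (\<integral>\<omega>. cmod (?W \<omega> - ?w) \<partial>P)"
      proof (rule integral_mono)
        show "integrable P (\<lambda>\<omega>. norm (?e \<omega> * ?w - ?e \<omega> * ?W \<omega>))"
          by (intro integrable_norm Bochner_Integration.integrable_diff integrable_mult_left i1 i2)
        show "integrable P (\<lambda>\<omega>. cmod (?W \<omega> - ?w))"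
          by (intro integrable_norm Bochner_Integration.integrable_diff i3 integrable_const)
        fix \<omega>
        have "?e \<omega> * ?w - ?e \<omega> * ?W \<omega> = ?e \<omega> * (?w - ?W \<omega>)" by (simp only: right_diff_distrib)
        then have "norm (?e \<omega> * ?w - ?e \<omega> * ?W \<omega>) = cmod (?e \<omega>) * cmod (?w - ?W \<omega>)"
          by (simp only: norm_mult)
        also have "\<dots> \<le> 1 * cmod (?w - ?W \<omega>)"
          by (rule mult_right_mono[OF e1 norm_ge_zero])
        finally show "norm (?e \<omega> * ?w - ?e \<omega> * ?W \<omega>) \<le> cmod (?W \<omega> - ?w)"
          unfolding mult_1_left norm_minus_commute[of ?w "?W \<omega>"] .
      qed
      finally show ?case .
    qed
  qed
  have "(\<lambda>n. ((\<integral>\<omega>. iexp (t * Z n \<omega>) * indicator H \<omega> \<partial>P) * ?w - (\<integral>\<omega>. indicator H \<omega> * U (s_n t n) k \<omega> \<partial>P))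
      + (\<integral>\<omega>. indicator H \<omega> * U (s_n t n) k \<omega> \<partial>P)) \<longlonglongrightarrow> 0 + (\<integral>\<omega>. indicator H \<omega> \<partial>P)"
    by (intro tendsto_add diff Uk)
  moreover have "(\<integral>\<omega>. indicator H \<omega> \<partial>P) = complex_of_real (prob H)"
  proof -
    have "(\<integral>\<omega>. indicator H \<omega> \<partial>P) = (\<integral>\<omega>. complex_of_real (indicator H \<omega>) \<partial>P)"
      by (intro Bochner_Integration.integral_cong) (auto split: split_indicator)
    then show ?thesis by simp
  qed
  ultimately have "(\<lambda>n. (\<integral>\<omega>. iexp (t * Z n \<omega>) * indicator H \<omega> \<partial>P) * ?w) \<longlonglongrightarrow> complex_of_real (prob H)"
    by simp
  then have "(\<lambda>n. (\<integral>\<omega>. iexp (t * Z n \<omega>) * indicator H \<omega> \<partial>P) * ?w / ?w) \<longlonglongrightarrow> complex_of_real (prob H) / ?w"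
    by (intro tendsto_divide tendsto_const) auto
  moreover have "complex_of_real (prob H) / ?w = complex_of_real (exp (- (t\<^sup>2 * lc) / 2) * prob H)"
  proof -
    have "exp (- (t\<^sup>2 * lc) / 2) = inverse (exp (lc * t\<^sup>2 / 2))"
      by (simp add: exp_minus[symmetric] mult.commute)
    then show ?thesis by (simp only: of_real_mult of_real_inverse divide_inverse mult.commute)
  qed
  moreover have "x * ?w / ?w = x" for x by simp
  ultimately show ?thesis by (simp only:)
qed

text \<open>The mixing argument is for real bounded variables, so cosine and sine are treated
  separately; the limit characteristic function is real, hence the value 0 for the sine.\<close>

theorem stable_clt: "stably_to P Z (\<lambda>_. gauss0 lc)"
proof (rule stably_to_constI[OF prob_space_axioms Z_measurable real_distribution_gauss0[OF lim_const_nonneg]])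
  fix t H assume H: "H \<in> sets P"
  let ?y = "exp (- (t\<^sup>2 * lc) / 2)"
  have [measurable]: "Z n \<in> borel_measurable P" for n by (rule Z_measurable)
  have int: "integrable P (\<lambda>\<omega>. iexp (t * Z n \<omega>) * indicator A \<omega>)" if [measurable]: "A \<in> sets P" for A n
  proof (rule integrable_const_bound[of _ 1])
    have "cmod (iexp (t * Z n \<omega>) * indicator A \<omega>) \<le> 1" for \<omega>
      by (rule norm_iexp_indicator)
    then show "AE \<omega> in P. norm (iexp (t * Z n \<omega>) * indicator A \<omega>) \<le> 1" by (intro AE_I2)
  qed measurable
  have Re: "Re (iexp (t * Z n \<omega>) * indicator A \<omega>) = cos (t * Z n \<omega>) * indicator A \<omega>"
    and Im: "Im (iexp (t * Z n \<omega>) * indicator A \<omega>) = sin (t * Z n \<omega>) * indicator A \<omega>" for A n \<omega>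
    by (auto simp: Re_exp Im_exp split: split_indicator)
  have base: "mixing_lim P (\<lambda>n \<omega>. cos (t * Z n \<omega>)) ?y (indicator A) \<and> mixing_lim P (\<lambda>n \<omega>. sin (t * Z n \<omega>)) 0 (indicator A)"
    if A: "A \<in> sets (F k)" for A k
  proof -
    have AP: "A \<in> sets P" using A subalgebra_F[of k] by (auto simp: subalgebra_def)
    have iA: "integrable P (indicator A :: 'o \<Rightarrow> real)"
      using AP by (intro integrable_const_bound[of _ 1] AE_I2) (auto simp: indicator_def)
    show ?thesis
      using tendsto_Re[OF integral_iexp_Z_F[OF A, of t]] tendsto_Im[OF integral_iexp_Z_F[OF A, of t]] iA AP
      unfolding mixing_lim_def integral_Re[OF int[OF AP], symmetric] integral_Im[OF int[OF AP], symmetric] Re Im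
      by simp
  qed
  have ZF: "(\<lambda>\<omega>. cos (t * Z n \<omega>)) \<in> borel_measurable (F n)" "(\<lambda>\<omega>. sin (t * Z n \<omega>)) \<in> borel_measurable (F n)" for n
    using Z_measurable_F[of n] by measurable
  have c: "(\<lambda>n. \<integral>\<omega>. cos (t * Z n \<omega>) * indicator H \<omega> \<partial>P) \<longlonglongrightarrow> ?y * prob H"
    by (rule mixing_lim_extend[OF prob_space_axioms _ _ subalgebra_F F_mono ZF(1) _ H]) (use base in auto)
  have s: "(\<lambda>n. \<integral>\<omega>. sin (t * Z n \<omega>) * indicator H \<omega> \<partial>P) \<longlonglongrightarrow> 0 * prob H"
    by (rule mixing_lim_extend[OF prob_space_axioms _ _ subalgebra_F F_mono ZF(2) _ H]) (use base in auto)
  have "(\<integral>\<omega>. iexp (t * Z n \<omega>) * indicator H \<omega> \<partial>P)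
      = Complex (\<integral>\<omega>. cos (t * Z n \<omega>) * indicator H \<omega> \<partial>P) (\<integral>\<omega>. sin (t * Z n \<omega>) * indicator H \<omega> \<partial>P)" for n
    by (rule complex_eqI) (simp_all only: complex.sel integral_Re[OF int[OF H], symmetric] integral_Im[OF int[OF H], symmetric] Re Im)
  moreover have "Complex (?y * prob H) (0 * prob H) = char (gauss0 lc) t * prob H"
    unfolding char_gauss0[OF lim_const_nonneg] by (simp add: complex_eq_iff)
  ultimately show "(\<lambda>n. \<integral>\<omega>. iexp (t * Z n \<omega>) * indicator H \<omega> \<partial>P) \<longlonglongrightarrow> char (gauss0 lc) t * prob H"
    using tendsto_Complex[OF c s] by simp
qed

end

end

theorem theorem7:
  fixes P :: "'o measure"
    and m :: "'x::{metric_space, second_countable_topology} measure"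
    and M :: "nat \<Rightarrow> 'o \<Rightarrow> 'x measure"
    and R :: "nat \<Rightarrow> 'o \<Rightarrow> real"
    and \<alpha> \<beta> c r :: real
    and B :: "'x set"
  assumes P: "prob_space P"
    and m_prob: "prob_space m" and m_sets: "sets m = sets borel"
    and m_diffuse: "\<forall>x. measure m {x} = 0"
    and \<alpha>: "\<alpha> > 0" and \<beta>: "0 \<le> \<beta>" "\<beta> < 1" and c: "c > - \<beta>"
    and M_rm: "\<forall>n\<ge>1. random_measure P (M n)"
    and R_rv: "\<forall>n\<ge>1. R n \<in> borel_measurable P"
    and R_indep: "\<forall>n\<ge>1. prob_space.indep_set P
                   (sets (sigma (space P) {{\<omega>\<in>space P. R n \<omega> \<in> C} | C. C \<in> sets (borel :: real measure)}))
                   (sets (gen_sigma P M R n (n - 1)))"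
    and R_lower: "\<exists>u. u > max \<beta> 0 \<and> (\<forall>n\<ge>1. \<forall>\<omega>\<in>space P. R n \<omega> \<ge> u)"
    and M_cond: "\<forall>n. \<forall>A\<in>sets (finite_measures (borel :: 'x measure)).
                   AE \<omega> in P. real_cond_exp P (filt P M R n)
                       (indicator {\<omega>\<in>space P. M (Suc n) \<omega> \<in> A}) \<omega>
                     = measure (BeP_law (ibp_nu m \<alpha> \<beta> c M R n \<omega>)) A"
    and B: "B \<in> sets borel"
    and Rbar: "AE \<omega> in P. (\<lambda>n. (\<Sum>i=1..n. R i \<omega>) / real n) \<longlonglongrightarrow> r"
  shows "(AE \<omega> in P. (\<lambda>n. real (card (B \<inter> feat M n \<omega>)) / a_seq \<beta> n)
             \<longlonglongrightarrow> measure m B * lam_const \<alpha> \<beta> c r)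
       \<and> (((\<forall>j\<ge>1. integrable P (\<lambda>\<omega>. \<bar>(\<Sum>i=1..j. R i \<omega>) / real j - r\<bar>)) \<and>
            (\<lambda>n. (\<Sum>j=1..n. real j powr (\<beta> - 1) *
                     (\<integral>\<omega>. \<bar>(\<Sum>i=1..j. R i \<omega>) / real j - r\<bar> \<partial>P)) / sqrt (a_seq \<beta> n))
              \<longlonglongrightarrow> 0)
          \<longrightarrow> stably_to P
                (\<lambda>n \<omega>. sqrt (a_seq \<beta> n) *
                   (real (card (B \<inter> feat M n \<omega>)) / a_seq \<beta> n - measure m B * lam_const \<alpha> \<beta> c r))
                (\<lambda>_. gauss0 (measure m B * lam_const \<alpha> \<beta> c r)))"
proof -
  obtain u where u: "u > max \<beta> 0" "\<forall>n\<ge>1. \<forall>\<omega>\<in>space P. R n \<omega> \<ge> u"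
    using R_lower by blast
  interpret prob_space P by (rule P)
  interpret ibp P m M R \<alpha> \<beta> c u B
  proof (rule ibp.intro[OF P ibp_axioms.intro])
    show "measure m {x} = 0" for x using m_diffuse by blast
    show "random_measure P (M n)" if "1 \<le> n" for n using M_rm that by blast
    show "R n \<in> borel_measurable P" if "1 \<le> n" for n using R_rv that by blast
    show "\<beta> < u" using u(1) by linarith
    show "u \<le> R n \<omega>" if "1 \<le> n" "\<omega> \<in> space P" for n \<omega> using u(2) that by blast
  qed (fact m_prob m_sets \<alpha> \<beta> c B M_cond[rule_format])+
  have Rbar': "AE \<omega> in P. (\<lambda>n. Rsum n \<omega> / real n) \<longlonglongrightarrow> r"
    using Rbar by (simp only: Rsum_def)
  have "AE \<omega> in P. (\<lambda>n. real (card (B \<inter> feat M n \<omega>)) / a_seq \<beta> n) \<longlonglongrightarrow> measure m B * lam_const \<alpha> \<beta> c r"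
    using strong_law[OF Rbar'] unfolding cnt_def lim_const_def[OF Rbar'] .
  moreover have "stably_to P (\<lambda>n \<omega>. sqrt (a_seq \<beta> n) *
        (real (card (B \<inter> feat M n \<omega>)) / a_seq \<beta> n - measure m B * lam_const \<alpha> \<beta> c r))
      (\<lambda>_. gauss0 (measure m B * lam_const \<alpha> \<beta> c r))"
    if int: "\<forall>j\<ge>1. integrable P (\<lambda>\<omega>. \<bar>(\<Sum>i=1..j. R i \<omega>) / real j - r\<bar>)"
      and rate: "(\<lambda>n. (\<Sum>j=1..n. real j powr (\<beta> - 1) *
          (\<integral>\<omega>. \<bar>(\<Sum>i=1..j. R i \<omega>) / real j - r\<bar> \<partial>P)) / sqrt (a_seq \<beta> n)) \<longlonglongrightarrow> 0"
  proof -
    have int': "integrable P (\<lambda>\<omega>. \<bar>Rsum j \<omega> / real j - r\<bar>)" if "1 \<le> j" for j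
      using int that by (simp only: Rsum_def)
    have rate': "(\<lambda>n. (\<Sum>j=1..n. real j powr (\<beta> - 1) * (\<integral>\<omega>. \<bar>Rsum j \<omega> / real j - r\<bar> \<partial>P)) / sqrt (a_seq \<beta> n)) \<longlonglongrightarrow> 0"
      using rate by (simp only: Rsum_def)
    have "stably_to P (Z r) (\<lambda>_. gauss0 (lim_const r))"
      by (rule stable_clt[OF Rbar' _ rate']) (rule int')
    moreover have "Z r = (\<lambda>n \<omega>. sqrt (a_seq \<beta> n) * (cnt n \<omega> / a_seq \<beta> n - lim_const r))"
      by (intro ext Z_def[OF Rbar' _ rate']) (rule int')
    ultimately show ?thesis
      by (simp only: cnt_def lim_const_def[OF Rbar'])
  qed
  ultimately show ?thesis by blast
qed

end
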